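(* Let $d$ be a positive integer and, for $j\ge 0$, let $$a_d(j)=\sum_{n\in\{0,1,2,\dots\}^d,\ n_1+\dots+n_d=j}\frac{1}{(n_1+1)\cdots(n_d+1)}.$$ (i) The norm of a function $\varphi(z)=\sum_{j\ge0}\widehat\varphi(j)z^j$ in $\mathcal D_d$ is $$\|\varphi\|_{\mathcal D_d}=\Big(\sum_{j=0}^\infty a_d(j)^{-1}|\widehat\varphi(j)|^2\Big)^{1/2}\approx[\varphi]_d,\qquad\text{where}\quad [\varphi]_d:=\Big(\sum_{j=0}^\infty\frac{j+1}{\log^{d-1}(j+2)}|\widehat\varphi(j)|^2\Big)^{1/2}.$$ (ii) An equivalent Hilbert norm $|[\varphi]|_d\approx[\varphi]_d$ for $\varphi$ in terms of the values of $\varphi$ is given by $$|[\varphi]|_d=\Big(|\varphi(0)|^2+\int_{\mathbb D}|\varphi'(z)|^2\,\frac{1}{\log^{d-1}\big(\frac{1}{1-|z|^2}\big)}\,\frac{dA(z)}{\pi}\Big)^{1/2}.$$ (iii) Let $HS_d$ be the space of holomorphic functions $\psi(z)=\sum_{j\ge0}\widehat\psi(j)z^j$ on $\mathbb D$ defined by the norm $$\|\psi\|_{HS_d}=\Big(\sum_{j=0}^\infty(j+1)^2a_d(j)|\widehat\psi(j)|^2\Big)^{1/2}.$$ Then $HS_d$ is the dual space of $\mathcal D_d$ under the duality pairing $\langle\varphi,\psi\rangle_{\mathcal D}=\sum_{j=0}^\infty(j+1)\widehat\varphi(j)\overline{\widehat\psi(j)}$ of $\mathcal D$. (iv) Moreover,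 $$\|\psi\|_{HS_d}\approx\Big(\sum_{j=0}^\infty(j+1)\log^{d-1}(j+2)|\widehat\psi(j)|^2\Big)^{1/2}\approx\Big(|\psi(0)|^2+\int_{\mathbb D}|\psi'(z)|^2\log^{d-1}\Big(\frac1{1-|z|^2}\Big)\frac{dA(z)}{\pi}\Big)^{1/2}.$$ (v) Furthermore, the norm of $HS_d$ can be written as $$\|\psi\|_{HS_d}^2=\sum_{(n_1,\dots,n_d)\in\{0,1,2,\dots\}^d}|\langle e_{n_1}\cdots e_{n_d},\psi\rangle_{\mathcal D}|^2,$$ where $e_n(z)=\frac{z^n}{\sqrt{n+1}}$, $n\ge 0$, is the canonical orthonormal basis of $\mathcal D$.
   Context: $\mathbb D=\{z\in\mathbb C:|z|<1\}$, and $dA/\pi$ is normalized area measure on $\mathbb D$. The Dirichlet space $\mathcal D$ is the reproducing kernel Hilbert space on $\mathbb D$ with kernel $k(w,z)=k_z(w)=\sum_{n=0}^\infty\frac{(\overline zw)^n}{n+1}=\frac1{\overline zw}\log\frac1{1-\overline zw}$; its inner product is $\langle f,g\rangle_{\mathcal D}=\sum_{j\ge0}(j+1)\widehat f(j)\overline{\widehat g(j)}$, where $\widehat f(j)$ denotes the $j$-th Taylor coefficient of $f$ at $0$. For a positive integer $d$, $\mathcal D_d$ is the reproducing kernel Hilbert space on $\mathbb D$ with kernel $k(w,z)^d$. The notation $A\approx B$ means that there are constants $0<c<C$, independent of the function (they may depend on $d$), such that $cA\le B\le CA$. The expression $\log^{m}(x)$ means $(\log x)^m$.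
   Formalization: In (ii), for d ≥ 2 the printed integral diverges (e.g. φ(z)=z); the equivalence is proved with log(e/(1-|z|²)) in place of log(1/(1-|z|²)), and with the printed weight only when the Taylor coefficients of index 1 ≤ j < d vanish, plus [φ]_d ≤ C|[φ]|_d in general. *)

theory Defs
  imports "HOL-Complex_Analysis.Complex_Analysis"
begin

section \<open>Hilbert spaces of functions and reproducing kernels\<close>

text \<open>A function on a set \<open>X\<close> is represented by its extension by zero to the whole type.\<close>

definition ip_norm :: "(('a \<Rightarrow> complex) \<Rightarrow> ('a \<Rightarrow> complex) \<Rightarrow> complex) \<Rightarrow> ('a \<Rightarrow> complex) \<Rightarrow> real" where
  "ip_norm ip f = sqrt (Re (ip f f))"

locale hilbert_function_space =
  fixes X :: "'a set"
    and V :: "('a \<Rightarrow> complex) set"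
    and ip :: "('a \<Rightarrow> complex) \<Rightarrow> ('a \<Rightarrow> complex) \<Rightarrow> complex"
  assumes outside: "f \<in> V \<Longrightarrow> x \<notin> X \<Longrightarrow> f x = 0"
    and zero_closed: "(\<lambda>x. 0) \<in> V"
    and add_closed: "f \<in> V \<Longrightarrow> g \<in> V \<Longrightarrow> (\<lambda>x. f x + g x) \<in> V"
    and scale_closed: "f \<in> V \<Longrightarrow> (\<lambda>x. c * f x) \<in> V"
    and ip_add: "f \<in> V \<Longrightarrow> g \<in> V \<Longrightarrow> h \<in> V \<Longrightarrow> ip (\<lambda>x. f x + g x) h = ip f h + ip g h"
    and ip_scale: "f \<in> V \<Longrightarrow> g \<in> V \<Longrightarrow> ip (\<lambda>x. c * f x) g = c * ip f g"
    and ip_commute: "f \<in> V \<Longrightarrow> g \<in> V \<Longrightarrow> ip g f = cnj (ip f g)"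
    and ip_nonneg: "f \<in> V \<Longrightarrow> 0 \<le> Re (ip f f)"
    and ip_definite: "f \<in> V \<Longrightarrow> ip f f = 0 \<Longrightarrow> f = (\<lambda>x. 0)"
    and complete: "(\<And>n::nat. F n \<in> V) \<Longrightarrow>
        (\<And>e. 0 < e \<Longrightarrow> \<exists>N. \<forall>m\<ge>N. \<forall>n\<ge>N. ip_norm ip (\<lambda>x. F m x - F n x) < e) \<Longrightarrow>
        \<exists>f\<in>V. (\<lambda>n. ip_norm ip (\<lambda>x. F n x - f x)) \<longlonglongrightarrow> 0"

locale reproducing_kernel_hilbert_space = hilbert_function_space X V ip
  for X :: "'a set" and V :: "('a \<Rightarrow> complex) set"
    and ip :: "('a \<Rightarrow> complex) \<Rightarrow> ('a \<Rightarrow> complex) \<Rightarrow> complex" +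
  fixes K :: "'a \<Rightarrow> 'a \<Rightarrow> complex"
  assumes kernel_mem: "z \<in> X \<Longrightarrow> (\<lambda>w. if w \<in> X then K w z else 0) \<in> V"
    and reproducing: "f \<in> V \<Longrightarrow> z \<in> X \<Longrightarrow> f z = ip f (\<lambda>w. if w \<in> X then K w z else 0)"

definition hilbert_norm_on ::
    "'a set \<Rightarrow> ('a \<Rightarrow> complex) set \<Rightarrow> (('a \<Rightarrow> complex) \<Rightarrow> ennreal) \<Rightarrow> bool" where
  "hilbert_norm_on X V N \<longleftrightarrow>
     (\<exists>ip. hilbert_function_space X V ip \<and> (\<forall>f\<in>V. N f = ennreal (ip_norm ip f)))"

definition comparable_on :: "'b set \<Rightarrow> ('b \<Rightarrow> ennreal) \<Rightarrow> ('b \<Rightarrow> ennreal) \<Rightarrow> bool" where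
  "comparable_on S A B \<longleftrightarrow>
     (\<exists>c C :: real. 0 < c \<and> c < C \<and> (\<forall>f\<in>S. ennreal c * A f \<le> B f \<and> B f \<le> ennreal C * A f))"

definition dual_norm ::
    "('a \<Rightarrow> complex) set \<Rightarrow> (('a \<Rightarrow> complex) \<Rightarrow> real) \<Rightarrow> (('a \<Rightarrow> complex) \<Rightarrow> complex) \<Rightarrow> ennreal" where
  "dual_norm V nrm L = (SUP f\<in>{f \<in> V. nrm f \<le> 1}. ennreal (cmod (L f)))"

definition bounded_functional ::
    "('a \<Rightarrow> complex) set \<Rightarrow> (('a \<Rightarrow> complex) \<Rightarrow> real) \<Rightarrow> (('a \<Rightarrow> complex) \<Rightarrow> complex) \<Rightarrow> bool" where
  "bounded_functional V nrm L \<longleftrightarrow>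
     (\<forall>f\<in>V. \<forall>g\<in>V. L (\<lambda>x. f x + g x) = L f + L g) \<and>
     (\<forall>f\<in>V. \<forall>c. L (\<lambda>x. c * f x) = c * L f) \<and>
     dual_norm V nrm L < \<infinity>"

text \<open>
  The space \<open>W\<close> with norm \<open>N\<close> is, isometrically, the dual of \<open>V\<close> under the pairing \<open>B\<close>
  (linear in the first and conjugate-linear in the second argument).
\<close>

definition is_dual_under ::
    "('a \<Rightarrow> complex) set \<Rightarrow> (('a \<Rightarrow> complex) \<Rightarrow> real) \<Rightarrow>
     ('a \<Rightarrow> complex) set \<Rightarrow> (('a \<Rightarrow> complex) \<Rightarrow> ennreal) \<Rightarrow>
     (('a \<Rightarrow> complex) \<Rightarrow> ('a \<Rightarrow> complex) \<Rightarrow> complex) \<Rightarrow> bool" where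
  "is_dual_under V nrm W N B \<longleftrightarrow>
     (\<forall>\<psi>\<in>W. bounded_functional V nrm (\<lambda>\<phi>. B \<phi> \<psi>) \<and> dual_norm V nrm (\<lambda>\<phi>. B \<phi> \<psi>) = N \<psi>) \<and>
     (\<forall>L. bounded_functional V nrm L \<longrightarrow> (\<exists>!\<psi>. \<psi> \<in> W \<and> (\<forall>\<phi>\<in>V. L \<phi> = B \<phi> \<psi>)))"


section \<open>Holomorphic functions on the unit disc\<close>

abbreviation unit_disc :: "complex set" where
  "unit_disc \<equiv> ball 0 1"

definition hol_disc :: "(complex \<Rightarrow> complex) set" where
  "hol_disc = {f. f holomorphic_on unit_disc \<and> (\<forall>z. z \<notin> unit_disc \<longrightarrow> f z = 0)}"

definition taylor :: "(complex \<Rightarrow> complex) \<Rightarrow> nat \<Rightarrow> complex" where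
  "taylor f j = (deriv ^^ j) f 0 / fact j"

definition esqrt :: "ennreal \<Rightarrow> ennreal" where
  "esqrt x = (if x = \<infinity> then \<infinity> else ennreal (sqrt (enn2real x)))"

text \<open>Norms are extended-valued, so that they make sense for every holomorphic function.\<close>

definition coeff_norm :: "(nat \<Rightarrow> real) \<Rightarrow> (complex \<Rightarrow> complex) \<Rightarrow> ennreal" where
  "coeff_norm w f = esqrt (\<Sum>j. ennreal (w j * (cmod (taylor f j))\<^sup>2))"

definition area_norm :: "(complex \<Rightarrow> real) \<Rightarrow> (complex \<Rightarrow> complex) \<Rightarrow> ennreal" where
  "area_norm w f = esqrt (ennreal ((cmod (f 0))\<^sup>2) +
     (\<integral>\<^sup>+z\<in>unit_disc. ennreal ((cmod (deriv f z))\<^sup>2 * w z / pi) \<partial>lborel))"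


section \<open>The Dirichlet space and powers of its kernel\<close>

definition dirichlet_kernel :: "complex \<Rightarrow> complex \<Rightarrow> complex" where
  "dirichlet_kernel w z = (\<Sum>n. (cnj z * w) ^ n / of_nat (n + 1))"

definition dirichlet_ip :: "(complex \<Rightarrow> complex) \<Rightarrow> (complex \<Rightarrow> complex) \<Rightarrow> complex" where
  "dirichlet_ip f g = (\<Sum>j. of_nat (j + 1) * taylor f j * cnj (taylor g j))"

definition dirichlet_basis :: "nat \<Rightarrow> complex \<Rightarrow> complex" where
  "dirichlet_basis n z = z ^ n / of_real (sqrt (real (n + 1)))"

definition multi_indices :: "nat \<Rightarrow> (nat \<Rightarrow> nat) set" where
  "multi_indices d = {..<d} \<rightarrow>\<^sub>E UNIV"

definition a_coeff :: "nat \<Rightarrow> nat \<Rightarrow> real" where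
  "a_coeff d j = (\<Sum>n | n \<in> multi_indices d \<and> (\<Sum>i<d. n i) = j. 1 / (\<Prod>i<d. real (n i + 1)))"

lemma finite_multi_indices_sum: "finite {n \<in> multi_indices d. (\<Sum>i<d. n i) = j}"
proof (rule finite_subset)
  show "{n \<in> multi_indices d. (\<Sum>i<d. n i) = j} \<subseteq> {..<d} \<rightarrow>\<^sub>E {..j}"
  proof
    fix n assume n: "n \<in> {n \<in> multi_indices d. (\<Sum>i<d. n i) = j}"
    have "n i \<le> j" if "i < d" for i
      using n that member_le_sum[of i "{..<d}" n] by auto
    with n show "n \<in> {..<d} \<rightarrow>\<^sub>E {..j}"
      unfolding multi_indices_def PiE_iff by blast
  qed
qed (auto intro: finite_PiE)

definition powered_dirichlet_rkhs ::
    "nat \<Rightarrow> (complex \<Rightarrow> complex) set \<Rightarrow>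
     ((complex \<Rightarrow> complex) \<Rightarrow> (complex \<Rightarrow> complex) \<Rightarrow> complex) \<Rightarrow> bool" where
  "powered_dirichlet_rkhs d V ip \<longleftrightarrow>
     reproducing_kernel_hilbert_space unit_disc V ip (\<lambda>w z. dirichlet_kernel w z ^ d)"

abbreviation D_norm :: "nat \<Rightarrow> (complex \<Rightarrow> complex) \<Rightarrow> ennreal" where
  "D_norm d \<equiv> coeff_norm (\<lambda>j. 1 / a_coeff d j)"

abbreviation D_log_norm :: "nat \<Rightarrow> (complex \<Rightarrow> complex) \<Rightarrow> ennreal" where
  "D_log_norm d \<equiv> coeff_norm (\<lambda>j. real (j + 1) / ln (real (j + 2)) ^ (d - 1))"

text \<open>
  For \<open>d \<ge> 2\<close> the weight \<open>1 / log\<^sup>d\<^sup>-\<^sup>1 (1/(1-|z|\<^sup>2))\<close> behaves like \<open>|z|\<^sup>-\<^sup>2\<^sup>(\<^sup>d\<^sup>-\<^sup>1\<^sup>)\<close>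
  at the origin, so the first norm below is infinite as soon as some Taylor coefficient
  of index \<open>1 \<le> j < d\<close> is nonzero. The second norm uses the weight with the same behaviour at the
  unit circle that stays bounded at the origin, as \<open>log (e/(1-|z|\<^sup>2)) = 1 + log (1/(1-|z|\<^sup>2))\<close>.
\<close>

abbreviation D_area_norm :: "nat \<Rightarrow> (complex \<Rightarrow> complex) \<Rightarrow> ennreal" where
  "D_area_norm d \<equiv> area_norm (\<lambda>z. 1 / ln (1 / (1 - (cmod z)\<^sup>2)) ^ (d - 1))"

abbreviation D_area_norm_reg :: "nat \<Rightarrow> (complex \<Rightarrow> complex) \<Rightarrow> ennreal" where
  "D_area_norm_reg d \<equiv> area_norm (\<lambda>z. 1 / ln (exp 1 / (1 - (cmod z)\<^sup>2)) ^ (d - 1))"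

definition low_coeffs_vanish :: "nat \<Rightarrow> (complex \<Rightarrow> complex) set" where
  "low_coeffs_vanish d = {f. \<forall>j. 1 \<le> j \<and> j < d \<longrightarrow> taylor f j = 0}"

abbreviation HS_norm :: "nat \<Rightarrow> (complex \<Rightarrow> complex) \<Rightarrow> ennreal" where
  "HS_norm d \<equiv> coeff_norm (\<lambda>j. (real (j + 1))\<^sup>2 * a_coeff d j)"

definition HS :: "nat \<Rightarrow> (complex \<Rightarrow> complex) set" where
  "HS d = {\<psi> \<in> hol_disc. HS_norm d \<psi> < \<infinity>}"

abbreviation HS_log_norm :: "nat \<Rightarrow> (complex \<Rightarrow> complex) \<Rightarrow> ennreal" where
  "HS_log_norm d \<equiv> coeff_norm (\<lambda>j. real (j + 1) * ln (real (j + 2)) ^ (d - 1))"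

abbreviation HS_area_norm :: "nat \<Rightarrow> (complex \<Rightarrow> complex) \<Rightarrow> ennreal" where
  "HS_area_norm d \<equiv> area_norm (\<lambda>z. ln (1 / (1 - (cmod z)\<^sup>2)) ^ (d - 1))"

end

theory Submission
  imports Defs
begin

text \<open>
  The kernel \<open>k\<^sup>d\<close> expands as \<open>\<Sum>j. a\<^sub>d(j) (cnj z w)\<^sup>j\<close>, so a reproducing kernel Hilbert
  space with this kernel is the space of power series with weights \<open>1 / a\<^sub>d(j)\<close>: in any such space
  the kernel combinations are dense, and their norms are determined by the kernel. The recursion
  \<open>a\<^sub>d\<^sub>+\<^sub>1(j) = \<Sum>m\<le>j. a\<^sub>d(j - m) / (m + 1)\<close> gives \<open>a\<^sub>d(j) \<approx> log\<^sup>d\<^sup>-\<^sup>1 (j + 2) / (j + 1)\<close> by induction.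

  By rotation invariance and Parseval on circles, an area norm with radial weight \<open>om (|z|\<^sup>2)\<close> is a
  coefficient norm with weights \<open>j\<^sup>2 \<integral> t\<^sup>j\<^sup>-\<^sup>1 om(t) dt\<close> over \<open>0 < t < 1\<close>. For logarithmic \<open>om\<close> these
  moments are concentrated at \<open>1 - t \<approx> 1/n\<close>, \<open>n = j + 1\<close>: the ratio of \<open>1 + ln (1/(1 - t))\<close> and
  \<open>1 + ln n\<close> lies between \<open>1 / (1 + |ln u|)\<close> and \<open>1 + |ln u|\<close> for \<open>u = n (1 - t)\<close>, and
  \<open>(1 + |ln u|)\<^sup>k\<close> is at most a constant times \<open>u + 1 / sqrt u\<close>.

  Duality is that of weighted sequence spaces: under the pairing with weights \<open>j + 1\<close>, the dual of
  the weights \<open>w(j)\<close> is \<open>(j + 1)\<^sup>2 / w(j)\<close>.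
\<close>

section \<open>Taylor coefficients and power series on the disc\<close>

text \<open>The statement quantifies over every realisation \<open>V\<close>, \<open>ip\<close> of
  the kernel, so uniqueness is what allows all later work to take place in the concrete spaces
  \<open>weighted_hol S w\<close>. There functions are coefficient sequences, and
  \<open>disc_weight\<close> is the growth condition that turns every sequence of finite norm back
  into a function on the disc.

  The obstacle in (ii) is the pole of the area weight at the origin for d >= 2, which makes finitely
  many moments infinite. Weights are therefore taken in \<open>ennreal\<close>, where infinity times
  0 is 0: one comparison principle then serves the regularised weight on all of
  \<open>hol_disc\<close> and the singular weight on the subspace where the critical coefficients
  vanish.

  Area integrals are evaluated without polar coordinates. The integral does not change when the
  integrand is rotated, so it equals its own average over all angles; Tonelli moves that average
  inside, where at fixed z it is the mean square of a Fourier series. What remains is the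
  distribution of |z|^2, which under normalized area is uniform on (0, 1).\<close>

lemma taylor_eqI:
  assumes "\<And>z. z \<in> unit_disc \<Longrightarrow> (\<lambda>n. b n * z ^ n) sums f z"
  shows "taylor f j = b j"
proof -
  have "eventually (\<lambda>z::complex. z \<in> unit_disc) (nhds 0)"
    by (intro eventually_nhds_in_open) auto
  then have "f has_fps_expansion Abs_fps b"
    by (intro has_fps_expansionI) (elim eventually_mono, simp only: fps_nth_Abs_fps assms)
  from fps_nth_fps_expansion[OF this, of j] show ?thesis
    by (simp add: taylor_def)
qed

lemma hol_disc_sums:
  assumes "f \<in> hol_disc" "z \<in> unit_disc"
  shows "(\<lambda>n. taylor f n * z ^ n) sums f z"
  using holomorphic_power_series[of f 0 1 z] assms by (simp add: hol_disc_def taylor_def)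

text \<open>The series converges at a radius r strictly between |z| and 1, which forces absolute
  convergence at z.\<close>

lemma summable_taylor:
  assumes "f \<in> hol_disc" "z \<in> unit_disc"
  shows "summable (\<lambda>n. norm (taylor f n * z ^ n))"
proof -
  obtain r where r: "cmod z < r" "r < 1"
    using assms(2) dense[of "cmod z" 1] by auto
  then have "r > 0" by (smt (verit) norm_ge_zero)
  then have "summable (\<lambda>n. taylor f n * complex_of_real r ^ n)"
    using r by (intro sums_summable[OF hol_disc_sums[OF assms(1)]]) auto
  from powser_insidea[OF this, of z] r \<open>r > 0\<close> show ?thesis by simp
qed

lemma hol_disc_eqI:
  assumes "f \<in> hol_disc" "g \<in> hol_disc" "\<And>j. taylor f j = taylor g j"
  shows "f = g"
proof
  fix z
  show "f z = g z"
  proof (cases "z \<in> unit_disc")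
    case True
    then show ?thesis
      using hol_disc_sums[of f z] hol_disc_sums[of g z] assms
      by (auto intro: sums_unique2)
  qed (use assms in \<open>auto simp: hol_disc_def\<close>)
qed

lemma hol_disc_add: "f \<in> hol_disc \<Longrightarrow> g \<in> hol_disc \<Longrightarrow> (\<lambda>z. f z + g z) \<in> hol_disc"
  by (auto simp: hol_disc_def intro: holomorphic_intros)

lemma hol_disc_scale: "f \<in> hol_disc \<Longrightarrow> (\<lambda>z. c * f z) \<in> hol_disc"
  by (auto simp: hol_disc_def intro: holomorphic_intros)

lemma hol_disc_0: "(\<lambda>z. 0) \<in> hol_disc"
  by (auto simp: hol_disc_def)

lemma taylor_add:
  assumes "f \<in> hol_disc" "g \<in> hol_disc"
  shows "taylor (\<lambda>z. f z + g z) j = taylor f j + taylor g j"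
  using sums_add[OF hol_disc_sums hol_disc_sums, OF assms(1) _ assms(2)]
  by (intro taylor_eqI) (auto simp: algebra_simps)

lemma taylor_scale:
  assumes "f \<in> hol_disc"
  shows "taylor (\<lambda>z. c * f z) j = c * taylor f j"
  using sums_mult[OF hol_disc_sums, OF assms]
  by (intro taylor_eqI) (auto simp: algebra_simps)

lemma taylor_diff:
  assumes "f \<in> hol_disc" "g \<in> hol_disc"
  shows "taylor (\<lambda>z. f z - g z) j = taylor f j - taylor g j"
  using sums_diff[OF hol_disc_sums hol_disc_sums, OF assms(1) _ assms(2)]
  by (intro taylor_eqI) (auto simp: algebra_simps)

lemma taylor_0 [simp]: "taylor (\<lambda>z. 0) j = 0"
  by (rule taylor_eqI) auto

lemma taylor_at_0: "taylor f 0 = f 0"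
  by (simp add: taylor_def)

lemma taylor_deriv: "taylor (deriv f) j = of_nat (Suc j) * taylor f (Suc j)"
  unfolding taylor_def funpow_Suc_right o_def by (simp add: fact_Suc divide_simps del: of_nat_Suc)

lemma taylor_monomial: "taylor (\<lambda>z. c * z ^ m) j = (if j = m then c else 0)"
proof (rule taylor_eqI)
  fix z :: complex
  show "(\<lambda>n. (if n = m then c else 0) * z ^ n) sums (c * z ^ m)"
    using sums_single[of m "\<lambda>n. c * z ^ n"] by (simp add: if_distrib if_distribR cong: if_cong)
qed

text \<open>The value 0 off the disc follows the convention of extension by zero, without which the
  sum would not be an element of \<open>hol_disc\<close>.\<close>

definition power_series :: "(nat \<Rightarrow> complex) \<Rightarrow> complex \<Rightarrow> complex" where
  "power_series b z = (if z \<in> unit_disc then \<Sum>n. b n * z ^ n else 0)"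

lemma
  assumes "\<And>r. 0 < r \<Longrightarrow> r < 1 \<Longrightarrow> summable (\<lambda>n. cmod (b n) * r ^ n)"
  shows power_series_hol_disc: "power_series b \<in> hol_disc"
    and taylor_power_series: "taylor (power_series b) j = b j"
proof -
  have *: "(\<lambda>n. b n * z ^ n) sums power_series b z" if z: "z \<in> unit_disc" for z
  proof -
    obtain r where r: "cmod z < r" "r < 1"
      using z dense[of "cmod z" 1] by auto
    then have "r > 0" by (smt (verit) norm_ge_zero)
    have "summable (\<lambda>n. b n * z ^ n)"
    proof (rule summable_comparison_test'[OF assms[OF \<open>r > 0\<close> \<open>r < 1\<close>]])
      show "norm (b n * z ^ n) \<le> cmod (b n) * r ^ n" for n
        using r by (auto simp: norm_mult norm_power intro!: mult_left_mono power_mono)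
    qed
    then show ?thesis using z by (simp add: power_series_def summable_sums)
  qed
  have "power_series b holomorphic_on unit_disc"
    using * by (intro power_series_holomorphic[of 0 1 b]) auto
  then show "power_series b \<in> hol_disc"
    by (auto simp: hol_disc_def power_series_def)
  show "taylor (power_series b) j = b j"
    using * by (rule taylor_eqI)
qed

lemma summable_of_finite_support:
  fixes b :: "nat \<Rightarrow> 'a::real_normed_vector"
  assumes "\<And>j. j \<ge> N \<Longrightarrow> b j = 0"
  shows "summable b"
  by (rule summable_finite[of "{..<N}"]) (use assms in auto)

lemma
  assumes "\<And>j. j \<ge> N \<Longrightarrow> b j = 0"
  shows polynomial_hol_disc: "power_series b \<in> hol_disc"
    and taylor_polynomial: "taylor (power_series b) j = b j"
proof -
  have "summable (\<lambda>n. cmod (b n) * r ^ n)" for r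
    by (rule summable_of_finite_support[of N]) (use assms in auto)
  then show "power_series b \<in> hol_disc" "taylor (power_series b) j = b j"
    by (auto intro: power_series_hol_disc taylor_power_series)
qed

section \<open>Coefficient norms\<close>

lemma esqrt_ennreal: "esqrt (ennreal x) = ennreal (sqrt x)" 
  by (cases "x \<ge> 0") (auto simp: esqrt_def ennreal_neg)

lemma esqrt_top [simp]: "esqrt \<infinity> = \<infinity>" "esqrt top = top"
  by (auto simp: esqrt_def)

lemma esqrt_mono: "x \<le> y \<Longrightarrow> esqrt x \<le> esqrt y"
  by (cases x; cases y) (auto simp: esqrt_ennreal ennreal_leI top_unique)

lemma esqrt_less_top_iff: "esqrt x < \<infinity> \<longleftrightarrow> x < \<infinity>"
  by (cases x) (auto simp: esqrt_ennreal)

lemma esqrt_power2: "(esqrt x)\<^sup>2 = x"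
proof (cases x)
  case (real r)
  then show ?thesis by (simp only: esqrt_ennreal ennreal_power real_sqrt_ge_zero real_sqrt_pow2)
next
  case top
  then show ?thesis by (simp add: power2_eq_square ennreal_mult_top)
qed

lemma esqrt_cmult:
  assumes "0 < c"
  shows "esqrt (ennreal c * x) = ennreal (sqrt c) * esqrt x"
proof (cases x)
  case (real r)
  then show ?thesis
    using assms by (simp add: esqrt_ennreal ennreal_mult[symmetric] real_sqrt_mult)
next
  case top
  then show ?thesis using assms by (simp add: ennreal_mult_top)
qed

text \<open>The weights may be infinite, as the moments of a singular area weight are. An infinite
  weight contributes nothing where the Taylor coefficient vanishes, because
  \<open>top * 0 = 0\<close> in \<open>ennreal\<close>.\<close>

definition ecoeff_norm :: "(nat \<Rightarrow> ennreal) \<Rightarrow> (complex \<Rightarrow> complex) \<Rightarrow> ennreal" where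
  "ecoeff_norm W f = esqrt (\<Sum>j. W j * ennreal ((cmod (taylor f j))\<^sup>2))"

lemma coeff_norm_eq_ecoeff_norm:
  assumes "\<And>j. 0 \<le> w j"
  shows "coeff_norm w = ecoeff_norm (\<lambda>j. ennreal (w j))"
  using assms by (simp add: fun_eq_iff coeff_norm_def ecoeff_norm_def ennreal_mult)

text \<open>Only indices with a nonzero coefficient are compared, so that infinite weights do no
  harm on a subspace where the corresponding coefficients are zero. The constant compares squares,
  hence \<open>sqrt C\<close> for the norms.\<close>

lemma ecoeff_norm_mono:
  assumes "\<And>j. taylor f j \<noteq> 0 \<Longrightarrow> W j \<le> ennreal C * W' j" "0 < C"
  shows "ecoeff_norm W f \<le> ennreal (sqrt C) * ecoeff_norm W' f"
proof -
  have "(\<Sum>j. W j * ennreal ((cmod (taylor f j))\<^sup>2))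
      \<le> (\<Sum>j. ennreal C * (W' j * ennreal ((cmod (taylor f j))\<^sup>2)))"
  proof (intro suminf_le summableI)
    show "W j * ennreal ((cmod (taylor f j))\<^sup>2)
        \<le> ennreal C * (W' j * ennreal ((cmod (taylor f j))\<^sup>2))" for j
      using assms(1)[of j]
      by (cases "taylor f j = 0") (auto simp flip: mult.assoc intro!: mult_right_mono)
  qed
  then have "(\<Sum>j. W j * ennreal ((cmod (taylor f j))\<^sup>2))
      \<le> ennreal C * (\<Sum>j. W' j * ennreal ((cmod (taylor f j))\<^sup>2))" by simp
  from esqrt_mono[OF this] show ?thesis
    unfolding ecoeff_norm_def by (simp only: esqrt_cmult[OF \<open>0 < C\<close>])
qed

lemma comparable_onI:
  assumes "0 < c" "0 < C"
    and "\<And>f. f \<in> S \<Longrightarrow> A f \<le> ennreal c * B f" "\<And>f. f \<in> S \<Longrightarrow> B f \<le> ennreal C * A f"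
  shows "comparable_on S A B"
  unfolding comparable_on_def
proof (intro exI conjI ballI)
  \<comment> \<open>\<open>comparable_on\<close> asks for a strict inequality between its two
    constants; halving 1/c on one side and adding it on the other secures this.\<close>
  let ?C = "C + 1 / c"
  show "0 < inverse c / 2" "inverse c / 2 < ?C" using assms(1,2)
    by (auto simp: field_simps add_pos_pos)
  fix f assume f: "f \<in> S"
  show "B f \<le> ennreal ?C * A f"
    by (rule order.trans[OF assms(4)[OF f]]) (use assms in \<open>auto intro!: mult_right_mono ennreal_leI\<close>)
  have "ennreal (inverse c / 2) * A f \<le> ennreal (inverse c / 2) * (ennreal c * B f)"
    by (intro mult_left_mono assms(3) f) auto
  also have "\<dots> = ennreal (1/2) * B f"
    using assms(1) by (simp flip: mult.assoc ennreal_mult)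
  also have "\<dots> \<le> ennreal 1 * B f" by (intro mult_right_mono ennreal_leI) auto
  finally show "ennreal (inverse c / 2) * A f \<le> B f" by simp
qed

lemma comparable_onE:
  assumes "comparable_on S A B"
  obtains C where "0 < C" "\<And>f. f \<in> S \<Longrightarrow> A f \<le> ennreal C * B f" "\<And>f. f \<in> S \<Longrightarrow> B f \<le> ennreal C * A f"
proof -
  from assms obtain c C where c: "0 < c" "c < C"
    and *: "\<And>f. f \<in> S \<Longrightarrow> ennreal c * A f \<le> B f" "\<And>f. f \<in> S \<Longrightarrow> B f \<le> ennreal C * A f"
    unfolding comparable_on_def by blast
  show thesis
  proof
    show "0 < C + 1 / c" using c by (simp add: add_pos_pos)
    fix f assume f: "f \<in> S"
    have "A f = ennreal (1 / c) * (ennreal c * A f)"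
      using c by (simp flip: mult.assoc ennreal_mult)
    also have "\<dots> \<le> ennreal (1 / c) * B f" by (intro mult_left_mono * f) auto
    also have "\<dots> \<le> ennreal (C + 1 / c) * B f"
      using c by (intro mult_right_mono ennreal_leI) auto
    finally show "A f \<le> ennreal (C + 1 / c) * B f" .
    show "B f \<le> ennreal (C + 1 / c) * A f"
      by (rule order.trans[OF *(2)[OF f]]) (use c in \<open>auto intro!: mult_right_mono ennreal_leI\<close>)
  qed
qed

lemma comparable_on_ecoeff_norm:
  assumes "0 < c" "0 < C"
    and "\<And>f j. f \<in> S \<Longrightarrow> taylor f j \<noteq> 0 \<Longrightarrow> W j \<le> ennreal c * W' j"
    and "\<And>f j. f \<in> S \<Longrightarrow> taylor f j \<noteq> 0 \<Longrightarrow> W' j \<le> ennreal C * W j"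
  shows "comparable_on S (ecoeff_norm W) (ecoeff_norm W')"
  by (rule comparable_onI[of "sqrt c" "sqrt C"])
     (use assms in \<open>auto intro!: ecoeff_norm_mono\<close>)

lemma comparable_on_coeff_norm:
  assumes "0 < c" "0 < C" "\<And>j. 0 \<le> w j" "\<And>j. 0 \<le> v j"
    and "\<And>j. w j \<le> c * v j" "\<And>j. v j \<le> C * w j"
  shows "comparable_on S (coeff_norm w) (coeff_norm v)"
  unfolding coeff_norm_eq_ecoeff_norm[OF assms(3)] coeff_norm_eq_ecoeff_norm[OF assms(4)]
  by (rule comparable_on_ecoeff_norm[of c C])
     (use assms in \<open>auto simp flip: ennreal_mult intro!: ennreal_leI\<close>)

lemma suminf_ennreal_finite_iff:
  assumes "\<And>j. 0 \<le> f j"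
  shows "(\<Sum>j. ennreal (f j)) \<noteq> top \<longleftrightarrow> summable f"
proof
  assume "(\<Sum>j. ennreal (f j)) \<noteq> top"
  then show "summable f" by (rule summable_suminf_not_top[OF assms])
next
  assume "summable f"
  then show "(\<Sum>j. ennreal (f j)) \<noteq> top" by (rule ennreal_suminf_neq_top[OF _ assms])
qed

lemma coeff_norm_finite_iff:
  assumes "\<And>j. 0 \<le> w j"
  shows "coeff_norm w f < \<infinity> \<longleftrightarrow> summable (\<lambda>j. w j * (cmod (taylor f j))\<^sup>2)"
proof -
  have "coeff_norm w f < \<infinity> \<longleftrightarrow> (\<Sum>j. ennreal (w j * (cmod (taylor f j))\<^sup>2)) \<noteq> top"
    unfolding coeff_norm_def esqrt_less_top_iff by (simp add: less_top)
  also have "\<dots> \<longleftrightarrow> summable (\<lambda>j. w j * (cmod (taylor f j))\<^sup>2)"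
    by (rule suminf_ennreal_finite_iff) (simp add: assms)
  finally show ?thesis .
qed

lemma coeff_norm_eq_sqrt_suminf:
  assumes "\<And>j. 0 \<le> w j" "summable (\<lambda>j. w j * (cmod (taylor f j))\<^sup>2)"
  shows "coeff_norm w f = ennreal (sqrt (\<Sum>j. w j * (cmod (taylor f j))\<^sup>2))"
proof -
  have nonneg: "0 \<le> w j * (cmod (taylor f j))\<^sup>2" for j by (simp add: assms(1))
  from suminf_ennreal[OF nonneg ennreal_suminf_neq_top[OF assms(2) nonneg]] show ?thesis
    unfolding coeff_norm_def by (simp only: esqrt_ennreal)
qed

section \<open>Weighted spaces of holomorphic functions\<close>

text \<open>\<open>S\<close> lists the coefficients that are forced to vanish: empty for the full
  space, and the indices 1, ..., d - 1 for the subspace on which the singular area norm is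
  finite.\<close>

definition weighted_hol :: "nat set \<Rightarrow> (nat \<Rightarrow> real) \<Rightarrow> (complex \<Rightarrow> complex) set" where
  "weighted_hol S w = {f \<in> hol_disc. (\<forall>j\<in>S. taylor f j = 0) \<and> summable (\<lambda>j. w j * (cmod (taylor f j))\<^sup>2)}"

definition weighted_ip :: "(nat \<Rightarrow> real) \<Rightarrow> (complex \<Rightarrow> complex) \<Rightarrow> (complex \<Rightarrow> complex) \<Rightarrow> complex" where
  "weighted_ip w f g = (\<Sum>j. of_real (w j) * taylor f j * cnj (taylor g j))"

text \<open>The second condition says that 1/w is the coefficient sequence of a power series of
  radius at least 1. It makes the diagonal kernel with coefficients 1/w converge on the disc, and
  every sequence with finite weighted norm the Taylor sequence of a holomorphic function.\<close>

definition disc_weight :: "(nat \<Rightarrow> real) \<Rightarrow> bool" where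
  "disc_weight w \<longleftrightarrow> (\<forall>j. 0 < w j) \<and> (\<forall>r. 0 < r \<longrightarrow> r < 1 \<longrightarrow> summable (\<lambda>j. r ^ j / w j))"

lemma disc_weight_pos: "disc_weight w \<Longrightarrow> 0 < w j"
  by (simp add: disc_weight_def)

lemma disc_weight_mono:
  assumes "disc_weight w" "0 < C" "\<And>j. 0 < v j" "\<And>j. w j \<le> C * v j"
  shows "disc_weight v"
  unfolding disc_weight_def
proof (intro conjI allI impI)
  fix r :: real assume r: "0 < r" "r < 1"
  have s: "summable (\<lambda>j. C * (r ^ j / w j))"
    using assms(1) r by (intro summable_mult) (simp add: disc_weight_def)
  show "summable (\<lambda>j. r ^ j / v j)"
  proof (rule summable_comparison_test'[OF s])
    fix j
    have "inverse (v j) \<le> C * inverse (w j)"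
      using assms(2) assms(3,4)[of j] disc_weight_pos[OF assms(1), of j] by (simp add: field_simps)
    from mult_left_mono[OF this, of "r ^ j"] show "norm (r ^ j / v j) \<le> C * (r ^ j / w j)"
      using r assms(3)[of j] by (simp add: field_simps)
  qed
qed (use assms in auto)

text \<open>By the arithmetic-geometric mean inequality, 2 |b| r^n <= w |b|^2 + r^(2n) / w, and
  r^(2n) <= r^n; both terms on the right are summable.\<close>

lemma summable_weighted_powser:
  assumes w: "disc_weight w" and b: "summable (\<lambda>j. w j * (cmod (b j))\<^sup>2)" and r: "0 < r" "r < 1"
  shows "summable (\<lambda>n. cmod (b n) * r ^ n)"
proof -
  have "summable (\<lambda>j. r ^ j / w j)" using w r by (simp add: disc_weight_def)
  from summable_add[OF b this] show ?thesis
  proof (rule summable_comparison_test')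
    fix n
    have wn: "0 < w n" by (rule disc_weight_pos[OF w])
    have rn: "0 < r ^ n" "r ^ n \<le> 1" using r by (auto intro: power_le_one)
    have "2 * (w n * cmod (b n)) * r ^ n \<le> (w n * cmod (b n))\<^sup>2 + (r ^ n)\<^sup>2"
      by (rule sum_squares_bound)
    also have "(r ^ n)\<^sup>2 \<le> r ^ n" using rn by (simp add: power2_eq_square mult_left_le)
    finally have "2 * (cmod (b n) * r ^ n) \<le> w n * (cmod (b n))\<^sup>2 + r ^ n / w n"
      using wn by (simp add: field_simps power2_eq_square)
    moreover have "0 \<le> w n * (cmod (b n))\<^sup>2 + r ^ n / w n" "0 \<le> cmod (b n) * r ^ n" using wn rn by auto
    ultimately show "norm (cmod (b n) * r ^ n) \<le> w n * (cmod (b n))\<^sup>2 + r ^ n / w n" by simp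
  qed
qed

lemma power_series_weighted_hol:
  assumes "disc_weight w" "summable (\<lambda>j. w j * (cmod (b j))\<^sup>2)" "\<And>j. j \<in> S \<Longrightarrow> b j = 0"
  shows "power_series b \<in> weighted_hol S w" "taylor (power_series b) j = b j"
proof -
  note s = summable_weighted_powser[OF assms(1,2)]
  show *: "taylor (power_series b) j = b j" for j by (intro taylor_power_series s)
  show "power_series b \<in> weighted_hol S w"
    unfolding weighted_hol_def by (auto simp: * assms(2,3) intro: power_series_hol_disc s)
qed

lemma weighted_holD:
  assumes "f \<in> weighted_hol S w"
  shows "f \<in> hol_disc" "\<And>j. j \<in> S \<Longrightarrow> taylor f j = 0" "summable (\<lambda>j. w j * (cmod (taylor f j))\<^sup>2)"
  using assms by (auto simp: weighted_hol_def)

lemma cmod_add_power2_le: "(cmod (a + b))\<^sup>2 \<le> 2 * (cmod a)\<^sup>2 + 2 * (cmod b)\<^sup>2"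
proof -
  have "(cmod (a + b))\<^sup>2 \<le> (cmod a + cmod b)\<^sup>2"
    by (intro power_mono norm_triangle_ineq) auto
  also have "\<dots> \<le> 2 * (cmod a)\<^sup>2 + 2 * (cmod b)\<^sup>2"
    using sum_squares_bound[of "cmod a" "cmod b"] by (simp add: power2_sum)
  finally show ?thesis .
qed

lemma summable_weighted_add:
  assumes w: "\<And>j. 0 \<le> w j"
    and a: "summable (\<lambda>j. w j * (cmod (a j))\<^sup>2)" and b: "summable (\<lambda>j. w j * (cmod (b j))\<^sup>2)"
  shows "summable (\<lambda>j. w j * (cmod (a j + b j))\<^sup>2)"
proof (rule summable_comparison_test'[OF summable_add[OF summable_mult[OF a, of 2] summable_mult[OF b, of 2]]])
  fix j
  show "norm (w j * (cmod (a j + b j))\<^sup>2) \<le> 2 * (w j * (cmod (a j))\<^sup>2) + 2 * (w j * (cmod (b j))\<^sup>2)"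
    using mult_left_mono[OF cmod_add_power2_le[of "a j" "b j"] w[of j]] w[of j]
    by (simp add: algebra_simps)
qed

lemma weighted_hol_add:
  assumes "\<And>j. 0 \<le> w j" "f \<in> weighted_hol S w" "g \<in> weighted_hol S w"
  shows "(\<lambda>z. f z + g z) \<in> weighted_hol S w"
  using assms summable_weighted_add[of w "taylor f" "taylor g"]
  by (auto simp: weighted_hol_def hol_disc_add taylor_add)

lemma weighted_hol_scale:
  assumes "f \<in> weighted_hol S w"
  shows "(\<lambda>z. c * f z) \<in> weighted_hol S w"
  using assms summable_mult[of "\<lambda>j. w j * (cmod (taylor f j))\<^sup>2" "(cmod c)\<^sup>2"]
  by (auto simp: weighted_hol_def hol_disc_scale taylor_scale norm_mult power_mult_distrib mult_ac)

lemma norm_weighted_product_le: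
  assumes "0 \<le> w"
  shows "norm (of_real w * a * cnj b :: complex) \<le> w * (cmod a)\<^sup>2 + w * (cmod b)\<^sup>2"
proof -
  have "2 * (cmod a * cmod b) \<le> (cmod a)\<^sup>2 + (cmod b)\<^sup>2"
    using sum_squares_bound[of "cmod a" "cmod b"] by simp
  then have "cmod a * cmod b \<le> (cmod a)\<^sup>2 + (cmod b)\<^sup>2"
    using mult_nonneg_nonneg[of "cmod a" "cmod b"] by (smt (verit) norm_ge_zero)
  from mult_left_mono[OF this assms] show ?thesis
    using assms by (simp add: norm_mult algebra_simps)
qed

lemma summable_weighted_ip:
  assumes "\<And>j. 0 \<le> w j"
    and "summable (\<lambda>j. w j * (cmod (a j))\<^sup>2)" "summable (\<lambda>j. w j * (cmod (b j))\<^sup>2)"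
  shows "summable (\<lambda>j. of_real (w j) * a j * cnj (b j))"
  by (rule summable_comparison_test'[OF summable_add[OF assms(2,3)]])
     (rule norm_weighted_product_le[OF assms(1)])

lemma weighted_ip_self:
  assumes "summable (\<lambda>j. w j * (cmod (taylor f j))\<^sup>2)"
  shows "weighted_ip w f f = of_real (\<Sum>j. w j * (cmod (taylor f j))\<^sup>2)"
proof -
  have "of_real (w j) * taylor f j * cnj (taylor f j) = complex_of_real (w j * (cmod (taylor f j))\<^sup>2)" for j
    using complex_norm_square[of "taylor f j"] by (simp add: mult.assoc)
  then show ?thesis
    unfolding weighted_ip_def by (simp only: suminf_of_real[OF assms])
qed

lemma ip_norm_weighted_ip:
  assumes "f \<in> weighted_hol S w"
  shows "ip_norm (weighted_ip w) f = sqrt (\<Sum>j. w j * (cmod (taylor f j))\<^sup>2)"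
  using weighted_ip_self[OF weighted_holD(3)[OF assms]] by (simp add: ip_norm_def)

lemma weighted_hol_eq:
  assumes "\<And>j. 0 \<le> w j"
  shows "weighted_hol S w = {f \<in> hol_disc. (\<forall>j\<in>S. taylor f j = 0) \<and> coeff_norm w f < \<infinity>}"
  using coeff_norm_finite_iff[OF assms] by (auto simp: weighted_hol_def)

lemma ennreal_ip_norm_weighted_ip:
  assumes "\<And>j. 0 \<le> w j" "f \<in> weighted_hol S w"
  shows "ennreal (ip_norm (weighted_ip w) f) = coeff_norm w f"
  using ip_norm_weighted_ip[OF assms(2)] coeff_norm_eq_sqrt_suminf[OF assms(1) weighted_holD(3)[OF assms(2)]]
  by simp

text \<open>This is the completeness proof for l2: coefficients converge one by one, a Cauchy bound
  on finite partial sums survives the limit in one index, and letting the number of terms grow gives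
  convergence in norm.\<close>

lemma weighted_hol_complete:
  assumes w: "disc_weight w" and F: "\<And>n::nat. F n \<in> weighted_hol S w"
    and Cauchy: "\<And>e. 0 < e \<Longrightarrow> \<exists>N. \<forall>m\<ge>N. \<forall>n\<ge>N. ip_norm (weighted_ip w) (\<lambda>x. F m x - F n x) < e"
  shows "\<exists>f\<in>weighted_hol S w. (\<lambda>n. ip_norm (weighted_ip w) (\<lambda>x. F n x - f x)) \<longlonglongrightarrow> 0"
proof -
  note w0 = disc_weight_pos[OF w]
  have diff: "(\<lambda>x. f x - g x) \<in> weighted_hol S w"
    if "f \<in> weighted_hol S w" "g \<in> weighted_hol S w" for f g
    using weighted_hol_add[OF less_imp_le[OF w0] that(1) weighted_hol_scale[OF that(2), of "-1"]] by simp
  have nrm: "(ip_norm (weighted_ip w) (\<lambda>x. f x - g x))\<^sup>2 = (\<Sum>j. w j * (cmod (taylor f j - taylor g j))\<^sup>2)"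
       "summable (\<lambda>j. w j * (cmod (taylor f j - taylor g j))\<^sup>2)"
    if "f \<in> weighted_hol S w" "g \<in> weighted_hol S w" for f g
  proof -
    note d = weighted_holD(3)[OF diff[OF that]]
    then show "summable (\<lambda>j. w j * (cmod (taylor f j - taylor g j))\<^sup>2)"
      using that by (simp add: taylor_diff weighted_holD(1))
    show "(ip_norm (weighted_ip w) (\<lambda>x. f x - g x))\<^sup>2 = (\<Sum>j. w j * (cmod (taylor f j - taylor g j))\<^sup>2)"
      using d ip_norm_weighted_ip[OF diff[OF that]] suminf_nonneg[OF d] less_imp_le[OF w0] that
      by (simp add: taylor_diff weighted_holD(1))
  qed
  have nonneg: "0 \<le> ip_norm (weighted_ip w) (\<lambda>x. F m x - f x)" if "f \<in> weighted_hol S w" for m f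
    using ip_norm_weighted_ip[OF diff[OF F that]] w0
    by (simp add: suminf_nonneg weighted_holD(3)[OF diff[OF F that]] less_imp_le)
  \<comment> \<open>N does not depend on the number J of terms, and for fixed J only finitely many
    coefficients are involved, so the limit in n can be taken later.\<close>
  have partial: "\<exists>N. \<forall>m\<ge>N. \<forall>n\<ge>N. \<forall>J. (\<Sum>j<J. w j * (cmod (taylor (F m) j - taylor (F n) j))\<^sup>2) \<le> e\<^sup>2"
    if e: "0 < e" for e
  proof -
    obtain N where N: "\<And>m n. m \<ge> N \<Longrightarrow> n \<ge> N \<Longrightarrow> ip_norm (weighted_ip w) (\<lambda>x. F m x - F n x) < e"
      using Cauchy[OF e] by blast
    show ?thesis
    proof (intro exI allI impI)
      fix m n J assume "N \<le> m" "N \<le> n"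
      have "(\<Sum>j<J. w j * (cmod (taylor (F m) j - taylor (F n) j))\<^sup>2)
          \<le> (\<Sum>j. w j * (cmod (taylor (F m) j - taylor (F n) j))\<^sup>2)"
        by (rule sum_le_suminf[OF nrm(2)[OF F F]]) (use w0 in \<open>auto simp: less_imp_le\<close>)
      also have "\<dots> = (ip_norm (weighted_ip w) (\<lambda>x. F m x - F n x))\<^sup>2"
        by (rule nrm(1)[OF F F, symmetric])
      also have "\<dots> \<le> e\<^sup>2"
        using N[OF \<open>N \<le> m\<close> \<open>N \<le> n\<close>] nonneg[OF F] by (intro power_mono) auto
      finally show "(\<Sum>j<J. w j * (cmod (taylor (F m) j - taylor (F n) j))\<^sup>2) \<le> e\<^sup>2" .
    qed
  qed
  have "\<exists>l. (\<lambda>n. taylor (F n) j) \<longlonglongrightarrow> l" for j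
  proof -
    have "Cauchy (\<lambda>n. taylor (F n) j)"
      unfolding Cauchy_def
    proof (intro allI impI)
      fix e :: real assume e: "e > 0"
      \<comment> \<open>Chosen so that the square of \<open>e'\<close> is \<open>w j\<close> times
        the square of e/2; the weight then cancels and leaves a bound on the single
        coefficient.\<close>
      define e' where "e' = e * sqrt (w j) / 2"
      have e': "e' > 0" using e w0[of j] by (simp add: e'_def)
      obtain N where N: "\<And>m n J. m \<ge> N \<Longrightarrow> n \<ge> N \<Longrightarrow>
          (\<Sum>j<J. w j * (cmod (taylor (F m) j - taylor (F n) j))\<^sup>2) \<le> e'\<^sup>2"
        using partial[OF e'] by blast
      show "\<exists>M. \<forall>m\<ge>M. \<forall>n\<ge>M. dist (taylor (F m) j) (taylor (F n) j) < e"
      proof (intro exI allI impI)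
        fix m n assume mn: "N \<le> m" "N \<le> n"
        have "w j * (cmod (taylor (F m) j - taylor (F n) j))\<^sup>2
            \<le> (\<Sum>j<Suc j. w j * (cmod (taylor (F m) j - taylor (F n) j))\<^sup>2)"
          by (rule member_le_sum) (use w0 in \<open>auto simp: less_imp_le\<close>)
        also have "\<dots> \<le> e'\<^sup>2" by (rule N[OF mn])
        also have "\<dots> = w j * (e / 2)\<^sup>2"
          using w0[of j] by (simp add: e'_def power_mult_distrib power_divide)
        finally have "(cmod (taylor (F m) j - taylor (F n) j))\<^sup>2 \<le> (e / 2)\<^sup>2"
          using w0[of j] by simp
        then have "cmod (taylor (F m) j - taylor (F n) j) \<le> e / 2"
          by (rule power2_le_imp_le) (use e in simp)
        then show "dist (taylor (F m) j) (taylor (F n) j) < e"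
          using e by (simp add: dist_norm)
      qed
    qed
    then show ?thesis by (simp add: Cauchy_convergent_iff convergent_def)
  qed
  then obtain b where b: "\<And>j. (\<lambda>n. taylor (F n) j) \<longlonglongrightarrow> b j" by metis
  have limit: "\<exists>N. \<forall>m\<ge>N. \<forall>J. (\<Sum>j<J. w j * (cmod (taylor (F m) j - b j))\<^sup>2) \<le> e\<^sup>2"
    if e: "0 < e" for e
  proof -
    obtain N where N: "\<And>m n J. m \<ge> N \<Longrightarrow> n \<ge> N \<Longrightarrow>
          (\<Sum>j<J. w j * (cmod (taylor (F m) j - taylor (F n) j))\<^sup>2) \<le> e\<^sup>2"
        using partial[OF e] by blast
    show ?thesis
    proof (intro exI allI impI)
      fix m J assume m: "N \<le> m"
      have "(\<lambda>n. \<Sum>j<J. w j * (cmod (taylor (F m) j - taylor (F n) j))\<^sup>2)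
          \<longlonglongrightarrow> (\<Sum>j<J. w j * (cmod (taylor (F m) j - b j))\<^sup>2)"
        by (intro tendsto_intros b)
      then show "(\<Sum>j<J. w j * (cmod (taylor (F m) j - b j))\<^sup>2) \<le> e\<^sup>2"
        by (rule LIMSEQ_le_const2) (use N[OF m] in blast)
    qed
  qed
  have sumdiff: "summable (\<lambda>j. w j * (cmod (taylor (F m) j - b j))\<^sup>2)"
    if "\<And>J. (\<Sum>j<J. w j * (cmod (taylor (F m) j - b j))\<^sup>2) \<le> c" for m c
  proof (rule bounded_imp_summable)
    show "0 \<le> w j * (cmod (taylor (F m) j - b j))\<^sup>2" for j
      using w0[of j] by simp
    show "(\<Sum>j\<le>n. w j * (cmod (taylor (F m) j - b j))\<^sup>2) \<le> c" for n
      using that[of "Suc n"] by (simp add: lessThan_Suc_atMost)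
  qed
  obtain N1 where N1: "\<And>m J. m \<ge> N1 \<Longrightarrow> (\<Sum>j<J. w j * (cmod (taylor (F m) j - b j))\<^sup>2) \<le> 1\<^sup>2"
    using limit[of 1] by auto
  \<comment> \<open>The limit sequence is written as b = F - (F - b) with F a late member of the
    sequence; both terms on the right have finite norm.\<close>
  have "summable (\<lambda>j. w j * (cmod (taylor (F N1) j + (-1) * (taylor (F N1) j - b j)))\<^sup>2)"
    by (rule summable_weighted_add)
       (use w0 sumdiff[OF N1[OF order.refl]] weighted_holD(3)[OF F] in
          \<open>auto simp: less_imp_le norm_mult norm_minus_commute\<close>)
  then have sb: "summable (\<lambda>j. w j * (cmod (b j))\<^sup>2)" by simp
  have bS: "b j = 0" if "j \<in> S" for j
    using b[of j] weighted_holD(2)[OF F that] by (simp add: LIMSEQ_const_iff)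
  note g = power_series_weighted_hol[OF w sb bS]
  show ?thesis
  proof (rule bexI[OF _ g(1)], rule LIMSEQ_I)
    fix e :: real assume e: "0 < e"
    then have "0 < e / 2" by simp
    from limit[OF this] obtain N where
      N: "\<And>m J. m \<ge> N \<Longrightarrow> (\<Sum>j<J. w j * (cmod (taylor (F m) j - b j))\<^sup>2) \<le> (e / 2)\<^sup>2"
      by blast
    show "\<exists>no. \<forall>n\<ge>no. norm (ip_norm (weighted_ip w) (\<lambda>x. F n x - power_series b x) - 0) < e"
    proof (intro exI allI impI)
      fix m assume m: "N \<le> m"
      have "(ip_norm (weighted_ip w) (\<lambda>x. F m x - power_series b x))\<^sup>2
          = (\<Sum>j. w j * (cmod (taylor (F m) j - b j))\<^sup>2)"
        using nrm(1)[OF F g(1)] by (simp add: g(2))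
      also have "\<dots> \<le> (e / 2)\<^sup>2"
        using suminf_le_const[OF sumdiff[OF N[OF m]] N[OF m]] .
      finally have "ip_norm (weighted_ip w) (\<lambda>x. F m x - power_series b x) \<le> e / 2"
        by (rule power2_le_imp_le) (use e in simp)
      then show "norm (ip_norm (weighted_ip w) (\<lambda>x. F m x - power_series b x) - 0) < e"
        using e nonneg[OF g(1), of m] by simp
    qed
  qed
qed

lemma hilbert_function_space_weighted_hol:
  assumes w: "disc_weight w"
  shows "hilbert_function_space unit_disc (weighted_hol S w) (weighted_ip w)"
proof -
  note w0 = disc_weight_pos[OF w]
  have w1: "0 \<le> w j" for j using w0[of j] by simp
  have s: "summable (\<lambda>j. of_real (w j) * taylor f j * cnj (taylor g j))"
    if "f \<in> weighted_hol S w" "g \<in> weighted_hol S w" for f g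
    using that by (intro summable_weighted_ip w1) (auto dest: weighted_holD(3))
  show ?thesis
  proof
    fix f assume f: "f \<in> weighted_hol S w"
    show "f x = 0" if "x \<notin> unit_disc" for x
      using weighted_holD(1)[OF f] that by (auto simp: hol_disc_def)
    show "(\<lambda>x. c * f x) \<in> weighted_hol S w" for c by (rule weighted_hol_scale[OF f])
    show "0 \<le> Re (weighted_ip w f f)"
      by (simp add: weighted_ip_self weighted_holD(3)[OF f] suminf_nonneg w1)
    show "f = (\<lambda>x. 0)" if "weighted_ip w f f = 0"
    proof -
      have "(\<Sum>j. w j * (cmod (taylor f j))\<^sup>2) = 0"
        using that by (simp add: weighted_ip_self weighted_holD(3)[OF f])
      then have "w j * (cmod (taylor f j))\<^sup>2 = 0" for j
        using suminf_eq_zero_iff[OF weighted_holD(3)[OF f]] w1 by simp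
      then have "taylor f j = 0" for j using w0[of j] by (metis less_irrefl mult_eq_0_iff norm_eq_zero power_eq_0_iff)
      then show ?thesis
        by (intro hol_disc_eqI weighted_holD(1)[OF f] hol_disc_0) simp
    qed
    fix g assume g: "g \<in> weighted_hol S w"
    show "(\<lambda>x. f x + g x) \<in> weighted_hol S w" by (rule weighted_hol_add[OF w1 f g])
    show "weighted_ip w (\<lambda>x. c * f x) g = c * weighted_ip w f g" for c
      using s[OF f g] unfolding weighted_ip_def
      by (simp add: taylor_scale weighted_holD(1)[OF f] mult_ac suminf_mult[symmetric])
    show "weighted_ip w g f = cnj (weighted_ip w f g)"
      using summable_sums[OF s[OF f g]] sums_cnj[of "\<lambda>j. of_real (w j) * taylor f j * cnj (taylor g j)"]
      unfolding weighted_ip_def by (intro sums_unique[symmetric]) (simp add: mult_ac)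
    fix h assume h: "h \<in> weighted_hol S w"
    show "weighted_ip w (\<lambda>x. f x + g x) h = weighted_ip w f h + weighted_ip w g h"
      using s[OF f h] s[OF g h] unfolding weighted_ip_def
      by (simp add: taylor_add weighted_holD(1)[OF f] weighted_holD(1)[OF g] algebra_simps suminf_add)
  next
    show "(\<lambda>x. 0) \<in> weighted_hol S w"
      by (simp add: weighted_hol_def hol_disc_0)
  next
    fix F :: "nat \<Rightarrow> complex \<Rightarrow> complex"
    assume "\<And>n. F n \<in> weighted_hol S w"
      "\<And>e. 0 < e \<Longrightarrow> \<exists>N. \<forall>m\<ge>N. \<forall>n\<ge>N. ip_norm (weighted_ip w) (\<lambda>x. F m x - F n x) < e"
    then show "\<exists>f\<in>weighted_hol S w. (\<lambda>n. ip_norm (weighted_ip w) (\<lambda>x. F n x - f x)) \<longlonglongrightarrow> 0"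
      by (rule weighted_hol_complete[OF w])
  qed
qed

text \<open>The kernel function at z has the coefficients \<open>cnj z ^ j / w j\<close>. Pairing
  with it cancels the weight and leaves the Taylor series of f at z.\<close>

lemma reproducing_kernel_weighted_hol:
  assumes w: "disc_weight w"
    and K: "\<And>x z. x \<in> unit_disc \<Longrightarrow> z \<in> unit_disc \<Longrightarrow> (\<lambda>j. of_real (1 / w j) * (cnj z * x) ^ j) sums K x z"
  shows "reproducing_kernel_hilbert_space unit_disc (weighted_hol {} w) (weighted_ip w) K"
proof -
  interpret hilbert_function_space unit_disc "weighted_hol {} w" "weighted_ip w"
    by (rule hilbert_function_space_weighted_hol[OF w])
  note w0 = disc_weight_pos[OF w]
  have ker: "(\<lambda>x. if x \<in> unit_disc then K x z else 0) \<in> weighted_hol {} w"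
    "taylor (\<lambda>x. if x \<in> unit_disc then K x z else 0) j = of_real (1 / w j) * cnj z ^ j"
    if z: "z \<in> unit_disc" for z j
  proof -
    let ?b = "\<lambda>j. of_real (1 / w j) * cnj z ^ j :: complex"
    have eq: "(\<lambda>x. if x \<in> unit_disc then K x z else 0) = power_series ?b"
      using sums_unique[OF K[OF _ z]] by (auto simp: fun_eq_iff power_series_def power_mult_distrib mult_ac)
    have "summable (\<lambda>j. w j * (cmod (?b j))\<^sup>2)"
    \<comment> \<open>\<open>disc_weight\<close> speaks only of positive radii, here |z|^2; at z = 0
      the kernel function is constant.\<close>
    proof (cases "z = 0")
      case True
      show ?thesis by (rule summable_of_finite_support[of 1]) (auto simp: True)
    next
      case False
      then have "(cmod z)\<^sup>2 > 0" "(cmod z)\<^sup>2 < 1"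
        using z by (auto simp: power_less_one_iff abs_square_less_1)
      then have "summable (\<lambda>j. ((cmod z)\<^sup>2) ^ j / w j)"
        using w by (simp add: disc_weight_def)
      moreover have "w j * (cmod (?b j))\<^sup>2 = ((cmod z)\<^sup>2) ^ j / w j" for j
        using w0[of j]
        by (simp add: norm_mult norm_power norm_divide power2_eq_square field_simps power_mult_distrib)
      ultimately show ?thesis by simp
    qed
    from power_series_weighted_hol[OF w this, of "{}"]
    show "(\<lambda>x. if x \<in> unit_disc then K x z else 0) \<in> weighted_hol {} w"
      "taylor (\<lambda>x. if x \<in> unit_disc then K x z else 0) j = ?b j"
      unfolding eq by blast+
  qed
  show ?thesis
  proof
    fix z :: complex assume z: "z \<in> unit_disc"
    show "(\<lambda>x. if x \<in> unit_disc then K x z else 0) \<in> weighted_hol {} w" by (rule ker[OF z])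
    fix f assume f: "f \<in> weighted_hol {} w"
    have "f z = (\<Sum>j. taylor f j * z ^ j)"
      using sums_unique[OF hol_disc_sums[OF weighted_holD(1)[OF f] z]] .
    also have "\<dots> = weighted_ip w f (\<lambda>x. if x \<in> unit_disc then K x z else 0)"
      unfolding weighted_ip_def ker(2)[OF z] using w0 by (intro suminf_cong) (simp add: less_imp_neq[THEN not_sym])
    finally show "f z = weighted_ip w f (\<lambda>x. if x \<in> unit_disc then K x z else 0)" .
  qed
qed

section \<open>Uniqueness of the space with a given reproducing kernel\<close>

context hilbert_function_space
begin

abbreviation nsq :: "('a \<Rightarrow> complex) \<Rightarrow> real" where
  "nsq f \<equiv> Re (ip f f)"

lemma diff_closed: "f \<in> V \<Longrightarrow> g \<in> V \<Longrightarrow> (\<lambda>x. f x - g x) \<in> V"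
  using add_closed[of f "\<lambda>x. (-1) * g x"] scale_closed[of g "-1"] by simp

lemma ip_add_right:
  assumes "f \<in> V" "g \<in> V" "h \<in> V"
  shows "ip h (\<lambda>x. f x + g x) = ip h f + ip h g"
  using ip_add[OF assms] ip_commute[OF assms(1,3)] ip_commute[OF assms(2,3)]
    ip_commute[OF add_closed[OF assms(1,2)] assms(3)] by simp

lemma ip_scale_right:
  assumes "f \<in> V" "h \<in> V"
  shows "ip h (\<lambda>x. c * f x) = cnj c * ip h f"
  using ip_scale[OF assms, of c] ip_commute[OF assms]
    ip_commute[OF scale_closed[OF assms(1), of c] assms(2)] by simp

lemma ip_zero_right: "f \<in> V \<Longrightarrow> ip f (\<lambda>x. 0) = 0"
  using ip_scale_right[of f f 0] by simp

lemma ip_self: "f \<in> V \<Longrightarrow> ip f f = of_real (nsq f)"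
  using ip_commute[of f f] by (simp add: complex_eq_iff)

text \<open>All the Hilbert space geometry below (Cauchy-Schwarz, the parallelogram law, convergence
  of norms) is read off from this one expansion at suitable c.\<close>

lemma nsq_add_scale:
  assumes "f \<in> V" "g \<in> V"
  shows "nsq (\<lambda>x. f x + c * g x) = nsq f + 2 * Re (cnj c * ip f g) + (cmod c)\<^sup>2 * nsq g"
proof -
  have "ip (\<lambda>x. f x + c * g x) (\<lambda>x. f x + c * g x)
      = ip f f + cnj c * ip f g + (c * ip g f + c * (cnj c * ip g g))"
    using assms by (simp add: ip_add ip_add_right ip_scale ip_scale_right scale_closed add_closed algebra_simps)
  also have "c * ip g f = cnj (cnj c * ip f g)"
    using ip_commute[OF assms] by simp
  also have "c * (cnj c * ip g g) = of_real ((cmod c)\<^sup>2 * nsq g)"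
    using ip_self[OF assms(2)] complex_norm_square[of c] by (simp flip: mult.assoc)
  finally show ?thesis by simp
qed

lemma nsq_scale: "f \<in> V \<Longrightarrow> nsq (\<lambda>x. c * f x) = (cmod c)\<^sup>2 * nsq f"
  using nsq_add_scale[OF zero_closed, of f c] ip_commute[OF zero_closed, of f] ip_zero_right[of f]
    ip_zero_right[OF zero_closed] by simp

lemma nsq_diff:
  assumes "f \<in> V" "g \<in> V"
  shows "nsq (\<lambda>x. f x - g x) = nsq f - 2 * Re (ip f g) + nsq g"
  using nsq_add_scale[OF assms, of "-1"] by simp

lemma nsq_commute: "f \<in> V \<Longrightarrow> g \<in> V \<Longrightarrow> nsq (\<lambda>x. f x - g x) = nsq (\<lambda>x. g x - f x)"
  using ip_commute[of f g] by (simp add: nsq_diff)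

text \<open>The parallelogram law with the nonnegative term for the sum dropped. It replaces the
  triangle inequality and keeps the argument free of square roots.\<close>

lemma nsq_diff_le:
  assumes "f \<in> V" "g \<in> V" "h \<in> V"
  shows "nsq (\<lambda>x. f x - g x) \<le> 2 * nsq (\<lambda>x. f x - h x) + 2 * nsq (\<lambda>x. g x - h x)"
proof -
  let ?a = "\<lambda>x. f x - h x" and ?b = "\<lambda>x. g x - h x"
  have "?a \<in> V" "?b \<in> V" using assms by (auto intro: diff_closed)
  note * = nsq_add_scale[OF this, of "-1"] nsq_add_scale[OF this, of 1]
  have "0 \<le> nsq (\<lambda>x. ?a x + 1 * ?b x)"
    using \<open>?a \<in> V\<close> \<open>?b \<in> V\<close> by (intro ip_nonneg add_closed scale_closed)
  with * show ?thesis by simp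
qed

lemma Cauchy_Schwarz:
  assumes "f \<in> V" "g \<in> V"
  shows "(cmod (ip f g))\<^sup>2 \<le> nsq f * nsq g"
proof (cases "nsq g = 0")
  case True
  then have "g = (\<lambda>x. 0)" using assms ip_self[of g] by (intro ip_definite) auto
  then show ?thesis using ip_zero_right[OF assms(1)] ip_zero_right[OF zero_closed] by simp
next
  case False
  \<comment> \<open>This c minimises the squared norm of f + c g; nonnegativity of the minimum is
    the claim.\<close>
  define c where "c = - ip f g / of_real (nsq g)"
  have pos: "nsq g > 0" using False ip_nonneg[OF assms(2)] by simp
  have "cnj c * ip f g = - of_real ((cmod (ip f g))\<^sup>2 / nsq g)"
    using complex_norm_square[of "ip f g"] by (simp add: c_def mult.commute)
  then have "2 * Re (cnj c * ip f g) = - 2 * (cmod (ip f g))\<^sup>2 / nsq g" by simp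
  moreover have "(cmod c)\<^sup>2 * nsq g = (cmod (ip f g))\<^sup>2 / nsq g"
    using pos by (simp add: c_def norm_divide power_divide power2_eq_square)
  ultimately have "0 \<le> nsq f - (cmod (ip f g))\<^sup>2 / nsq g"
    using nsq_add_scale[OF assms, of c] ip_nonneg[OF add_closed[OF assms(1) scale_closed[OF assms(2), of c]]]
    by simp
  then show ?thesis using pos by (simp add: field_simps)
qed

lemma ip_norm_tendsto_iff:
  assumes "\<And>n. F n \<in> V"
  shows "(\<lambda>n. ip_norm ip (F n)) \<longlonglongrightarrow> 0 \<longleftrightarrow> (\<lambda>n. nsq (F n)) \<longlonglongrightarrow> 0"
proof
  assume "(\<lambda>n. ip_norm ip (F n)) \<longlonglongrightarrow> 0"
  from tendsto_power[OF this, of 2] show "(\<lambda>n. nsq (F n)) \<longlonglongrightarrow> 0"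
    using ip_nonneg[OF assms] by (simp add: ip_norm_def)
next
  assume "(\<lambda>n. nsq (F n)) \<longlonglongrightarrow> 0"
  from tendsto_real_sqrt[OF this] show "(\<lambda>n. ip_norm ip (F n)) \<longlonglongrightarrow> 0"
    by (simp add: ip_norm_def)
qed

lemma complete_nsq:
  assumes "\<And>n. F n \<in> V"
    and "\<And>e. 0 < e \<Longrightarrow> \<exists>N. \<forall>m\<ge>N. \<forall>n\<ge>N. nsq (\<lambda>x. F m x - F n x) < e"
  shows "\<exists>f\<in>V. (\<lambda>n. nsq (\<lambda>x. F n x - f x)) \<longlonglongrightarrow> 0"
proof -
  have "\<exists>N. \<forall>m\<ge>N. \<forall>n\<ge>N. ip_norm ip (\<lambda>x. F m x - F n x) < e" if "0 < e" for e
    using assms(2)[of "e\<^sup>2"] that by (auto simp: ip_norm_def real_less_rsqrt intro!: real_less_lsqrt less_imp_le)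
  from complete[OF assms(1) this] obtain f where f: "f \<in> V" "(\<lambda>n. ip_norm ip (\<lambda>x. F n x - f x)) \<longlonglongrightarrow> 0"
    by blast
  then show ?thesis
    using ip_norm_tendsto_iff[of "\<lambda>n x. F n x - f x"] diff_closed[OF assms(1) f(1)] by blast
qed

lemma ip_tendsto_zero:
  assumes "\<And>n. F n \<in> V" "g \<in> V" "(\<lambda>n. nsq (F n)) \<longlonglongrightarrow> 0"
  shows "(\<lambda>n. ip (F n) g) \<longlonglongrightarrow> 0"
proof -
  have "(\<lambda>n. nsq (F n) * nsq g) \<longlonglongrightarrow> 0" using tendsto_mult_left_zero[OF assms(3)] .
  then have "(\<lambda>n. (cmod (ip (F n) g))\<^sup>2) \<longlonglongrightarrow> 0"
    by (rule tendsto_sandwich[OF _ _ tendsto_const, rotated 2])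
       (use Cauchy_Schwarz[OF assms(1,2)] in auto)
  from tendsto_real_sqrt[OF this] show ?thesis
    by (simp add: tendsto_norm_zero_iff)
qed

lemma nsq_tendsto:
  assumes "\<And>n. F n \<in> V" "f \<in> V" "(\<lambda>n. nsq (\<lambda>x. F n x - f x)) \<longlonglongrightarrow> 0"
  shows "(\<lambda>n. nsq (F n)) \<longlonglongrightarrow> nsq f"
proof -
  let ?D = "\<lambda>n x. F n x - f x"
  have D: "?D n \<in> V" for n using assms by (auto intro: diff_closed)
  have "nsq (F n) = nsq (?D n) + 2 * Re (ip (?D n) f) + nsq f" for n
    using nsq_add_scale[OF D assms(2), of n 1] by simp
  moreover have "(\<lambda>n. nsq (?D n) + 2 * Re (ip (?D n) f) + nsq f) \<longlonglongrightarrow> 0 + 2 * Re 0 + nsq f"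
    by (intro tendsto_intros assms ip_tendsto_zero D)
  ultimately show ?thesis by simp
qed

text \<open>Elements of S nearly realising the distance from f form a Cauchy sequence, with a limit
  g in V. Near-minimality makes f - g orthogonal to S, hence zero by \<open>orth\<close>, so the
  minimising sequence itself approximates f.\<close>

lemma subspace_dense:
  assumes SV: "S \<subseteq> V" and S0: "S \<noteq> {}"
    and Sadd: "\<And>f g. f \<in> S \<Longrightarrow> g \<in> S \<Longrightarrow> (\<lambda>x. f x + g x) \<in> S"
    and Sscale: "\<And>f c. f \<in> S \<Longrightarrow> (\<lambda>x. c * f x) \<in> S"
    and orth: "\<And>h. h \<in> V \<Longrightarrow> (\<And>s. s \<in> S \<Longrightarrow> ip h s = 0) \<Longrightarrow> h = (\<lambda>x. 0)"
    and f: "f \<in> V"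
  shows "\<exists>s. (\<forall>n::nat. s n \<in> S) \<and> (\<lambda>n. nsq (\<lambda>x. s n x - f x)) \<longlonglongrightarrow> 0"
proof -
  define \<delta> where "\<delta> = (INF s\<in>S. nsq (\<lambda>x. f x - s x))"
  have fs: "(\<lambda>x. f x - s x) \<in> V" if "s \<in> S" for s using that SV f by (auto intro: diff_closed)
  have bdd: "bdd_below ((\<lambda>s. nsq (\<lambda>x. f x - s x)) ` S)"
    by (rule bdd_belowI2[of _ 0]) (use fs ip_nonneg in blast)
  have lower: "\<delta> \<le> nsq (\<lambda>x. f x - s x)" if "s \<in> S" for s
    unfolding \<delta>_def by (rule cINF_lower[OF bdd that])
  have "\<exists>s\<in>S. nsq (\<lambda>x. f x - s x) < \<delta> + inverse (real (Suc n))" for n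
    using cINF_less_iff[OF S0 bdd, of "\<delta> + inverse (real (Suc n))"] unfolding \<delta>_def by simp
  then obtain s where s: "\<And>n. s n \<in> S" "\<And>n. nsq (\<lambda>x. f x - s n x) < \<delta> + inverse (real (Suc n))"
    by metis
  have sV: "s n \<in> V" for n using s SV by auto
  have close: "nsq (\<lambda>x. s m x - s n x) \<le> 2 * inverse (real (Suc m)) + 2 * inverse (real (Suc n))" for m n
  proof -
    let ?a = "\<lambda>x. f x - s m x" and ?b = "\<lambda>x. f x - s n x"
    \<comment> \<open>The midpoint of \<open>s m\<close> and \<open>s n\<close> lies in S, so its
      squared distance to f is at least \<delta>; the parallelogram law then makes
      \<open>s m - s n\<close> small.\<close>
    let ?h = "\<lambda>x. (1/2) * (s m x + s n x)"
    have h: "?h \<in> S" using Sscale[OF Sadd[OF s(1) s(1)], of "1/2" m n] by simp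
    have ab: "?a \<in> V" "?b \<in> V" by (auto intro: fs s)
    have eq: "(\<lambda>x. ?a x + 1 * ?b x) = (\<lambda>x. 2 * (f x - ?h x))" by (auto simp: algebra_simps)
    have "nsq (\<lambda>x. 2 * (f x - ?h x)) = 4 * nsq (\<lambda>x. f x - ?h x)"
      using nsq_scale[OF fs[OF h], of 2] by simp
    moreover have "nsq (\<lambda>x. ?a x + 1 * ?b x) + nsq (\<lambda>x. ?a x + (-1) * ?b x) = 2 * nsq ?a + 2 * nsq ?b"
      unfolding nsq_add_scale[OF ab] by simp
    moreover have "(\<lambda>x. ?a x + (-1) * ?b x) = (\<lambda>x. s n x - s m x)" by auto
    ultimately have "nsq (\<lambda>x. s n x - s m x) = 2 * nsq ?a + 2 * nsq ?b - 4 * nsq (\<lambda>x. f x - ?h x)"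
      unfolding eq by simp
    with lower[OF h] s(2)[of m] s(2)[of n] nsq_commute[OF sV sV, of m n] show ?thesis by linarith
  qed
  have lim: "(\<lambda>n. inverse (real (Suc n))) \<longlonglongrightarrow> 0" by (rule LIMSEQ_inverse_real_of_nat)
  have "\<exists>g\<in>V. (\<lambda>n. nsq (\<lambda>x. s n x - g x)) \<longlonglongrightarrow> 0"
  proof (rule complete_nsq[OF sV])
    fix e :: real assume e: "0 < e"
    obtain N where N: "\<And>n. n \<ge> N \<Longrightarrow> norm (inverse (real (Suc n)) - 0) < e / 4"
      using LIMSEQ_D[OF lim, of "e / 4"] e by auto
    show "\<exists>N. \<forall>m\<ge>N. \<forall>n\<ge>N. nsq (\<lambda>x. s m x - s n x) < e"
    proof (intro exI allI impI)
      fix m n assume "N \<le> m" "N \<le> n"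
      with N[of m] N[of n] close[of m n] show "nsq (\<lambda>x. s m x - s n x) < e" by simp
    qed
  qed
  then obtain g where g: "g \<in> V" "(\<lambda>n. nsq (\<lambda>x. s n x - g x)) \<longlonglongrightarrow> 0" by blast
  have "(\<lambda>x. f x - g x) = (\<lambda>x. 0)"
  proof (rule orth)
    show fg: "(\<lambda>x. f x - g x) \<in> V" using f g by (auto intro: diff_closed)
    fix u assume u: "u \<in> S"
    then have uV: "u \<in> V" using SV by auto
    \<comment> \<open>Moving \<open>s n\<close> inside S along u by the best multiple lowers the
      squared distance by |<f - s n, u>|^2 / |u|^2. As \<open>s n\<close> is within 1/(n+1) of the
      infimum, the gain is at most that.\<close>
    have bound: "(cmod (ip (\<lambda>x. f x - s n x) u))\<^sup>2 \<le> nsq u * inverse (real (Suc n))" for n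
    proof (cases "nsq u = 0")
      case True
      then show ?thesis using Cauchy_Schwarz[OF fs[OF s(1)] uV, of n] by simp
    next
      case False
      let ?a = "\<lambda>x. f x - s n x" 
      define c where "c = - ip ?a u / of_real (nsq u)"
      have pos: "nsq u > 0" using False ip_nonneg[OF uV] by simp
      have "cnj c * ip ?a u = - of_real ((cmod (ip ?a u))\<^sup>2 / nsq u)"
        using complex_norm_square[of "ip ?a u"] by (simp add: c_def mult.commute)
      then have 1: "2 * Re (cnj c * ip ?a u) = - 2 * (cmod (ip ?a u))\<^sup>2 / nsq u" by simp
      have 2: "(cmod c)\<^sup>2 * nsq u = (cmod (ip ?a u))\<^sup>2 / nsq u"
        using pos by (simp add: c_def norm_divide power_divide power2_eq_square)
      have "\<delta> \<le> nsq (\<lambda>x. f x - (s n x + (-c) * u x))"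
        by (intro lower Sadd s Sscale u)
      also have "(\<lambda>x. f x - (s n x + (-c) * u x)) = (\<lambda>x. ?a x + c * u x)" by auto
      also have "nsq \<dots> = nsq ?a - (cmod (ip ?a u))\<^sup>2 / nsq u"
        unfolding nsq_add_scale[OF fs[OF s(1)] uV] 1 2 by simp
      finally have "(cmod (ip ?a u))\<^sup>2 / nsq u \<le> inverse (real (Suc n))" using s(2)[of n] by simp
      then show ?thesis using pos by (simp add: field_simps)
    qed
    have "(\<lambda>n. (cmod (ip (\<lambda>x. f x - s n x) u))\<^sup>2) \<longlonglongrightarrow> 0"
      by (rule tendsto_sandwich[OF _ _ tendsto_const tendsto_mult_right_zero[OF lim, of "nsq u"]])
         (use bound in auto)
    from tendsto_real_sqrt[OF this] have 1: "(\<lambda>n. ip (\<lambda>x. f x - s n x) u) \<longlonglongrightarrow> 0"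
      by (simp add: tendsto_norm_zero_iff)
    have 2: "(\<lambda>n. ip (\<lambda>x. s n x - g x) u) \<longlonglongrightarrow> 0"
      by (rule ip_tendsto_zero[OF diff_closed[OF sV g(1)] uV g(2)])
    have "ip (\<lambda>x. f x - g x) u = ip (\<lambda>x. f x - s n x) u + ip (\<lambda>x. s n x - g x) u" for n
      using ip_add[OF fs[OF s(1)] diff_closed[OF sV g(1)] uV, of n n] by simp
    with tendsto_add[OF 1 2] show "ip (\<lambda>x. f x - g x) u = 0" by (simp add: LIMSEQ_const_iff)
  qed
  then have "f = g" by (auto simp: fun_eq_iff)
  with g s show ?thesis by blast
qed

end

text \<open>Lists of coefficient-point pairs serve as names for finite combinations that do not
  refer to a space, so one list can be interpreted in two spaces with the same kernel. Concatenation
  is addition.\<close>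

definition kernel_comb :: "'a set \<Rightarrow> ('a \<Rightarrow> 'a \<Rightarrow> complex) \<Rightarrow> (complex \<times> 'a) list \<Rightarrow> 'a \<Rightarrow> complex" where
  "kernel_comb X K p x = (\<Sum>(c, z)\<leftarrow>p. c * (if x \<in> X then K x z else 0))"

lemma kernel_comb_Nil: "kernel_comb X K [] = (\<lambda>x. 0)"
  by (simp add: kernel_comb_def fun_eq_iff)

lemma kernel_comb_Cons:
  "kernel_comb X K ((c, z) # p) = (\<lambda>x. c * (if x \<in> X then K x z else 0) + kernel_comb X K p x)"
  by (simp add: kernel_comb_def fun_eq_iff)

lemma kernel_comb_append:
  "kernel_comb X K (p @ q) = (\<lambda>x. kernel_comb X K p x + kernel_comb X K q x)"
  by (simp add: kernel_comb_def fun_eq_iff)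

lemma kernel_comb_scale:
  "kernel_comb X K (map (\<lambda>(c, z). (a * c, z)) p) = (\<lambda>x. a * kernel_comb X K p x)"
  by (induction p) (auto simp: kernel_comb_def fun_eq_iff algebra_simps)

context reproducing_kernel_hilbert_space
begin

abbreviation coeff_lists :: "(complex \<times> 'a) list set" where
  "coeff_lists \<equiv> {p. snd ` set p \<subseteq> X}"

lemma kernel_comb_mem: "p \<in> coeff_lists \<Longrightarrow> kernel_comb X K p \<in> V"
  by (induction p) (auto simp: kernel_comb_Nil zero_closed kernel_comb_Cons intro!: add_closed scale_closed kernel_mem)

lemma ip_kernel_comb:
  assumes "f \<in> V" "p \<in> coeff_lists"
  shows "ip f (kernel_comb X K p) = (\<Sum>(c, z)\<leftarrow>p. cnj c * f z)"
  using assms(2)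
proof (induction p)
  case Nil
  then show ?case by (simp add: kernel_comb_Nil ip_zero_right assms)
next
  case (Cons a p)
  then show ?case
    by (cases a) (simp add: kernel_comb_Cons ip_add_right ip_scale_right scale_closed kernel_mem
        kernel_comb_mem assms(1) reproducing[symmetric] del: if_split split del: if_split)
qed

text \<open>The right-hand side involves the kernel only, not the inner product.\<close>

lemma nsq_kernel_comb:
  assumes "p \<in> coeff_lists"
  shows "nsq (kernel_comb X K p) = Re (\<Sum>(c, z)\<leftarrow>p. cnj c * kernel_comb X K p z)"
  by (simp only: ip_kernel_comb[OF kernel_comb_mem assms, OF assms])

text \<open>A function orthogonal to the kernel at every point of X vanishes on X by the reproducing
  property, so the orthogonal complement of the combinations is trivial.\<close>

lemma kernel_comb_dense:
  assumes "f \<in> V"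
  shows "\<exists>p. (\<forall>n::nat. p n \<in> coeff_lists) \<and> (\<lambda>n. nsq (\<lambda>x. kernel_comb X K (p n) x - f x)) \<longlonglongrightarrow> 0"
proof -
  have "\<exists>s. (\<forall>n::nat. s n \<in> kernel_comb X K ` coeff_lists) \<and> (\<lambda>n. nsq (\<lambda>x. s n x - f x)) \<longlonglongrightarrow> 0"
  proof (rule subspace_dense[OF _ _ _ _ _ assms])
    show "kernel_comb X K ` coeff_lists \<subseteq> V" using kernel_comb_mem by blast
    have "[] \<in> coeff_lists" by simp
    then show "kernel_comb X K ` coeff_lists \<noteq> {}" by blast
  next
    fix f g assume "f \<in> kernel_comb X K ` coeff_lists" "g \<in> kernel_comb X K ` coeff_lists"
    then obtain p q where pq: "p \<in> coeff_lists" "q \<in> coeff_lists" "f = kernel_comb X K p" "g = kernel_comb X K q"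
      by blast
    then have "p @ q \<in> coeff_lists" by auto
    then show "(\<lambda>x. f x + g x) \<in> kernel_comb X K ` coeff_lists"
      unfolding pq(3,4) kernel_comb_append[symmetric] by (rule imageI)
  next
    fix f c assume "f \<in> kernel_comb X K ` coeff_lists"
    then obtain p where p: "p \<in> coeff_lists" "f = kernel_comb X K p" by blast
    then have "map (\<lambda>(a, z). (c * a, z)) p \<in> coeff_lists" by force
    then show "(\<lambda>x. c * f x) \<in> kernel_comb X K ` coeff_lists"
      unfolding p(2) kernel_comb_scale[symmetric] by (rule imageI)
  next
    fix h assume h: "h \<in> V" "\<And>s. s \<in> kernel_comb X K ` coeff_lists \<Longrightarrow> ip h s = 0"
    have "h x = 0" if "x \<in> X" for x
      using h(2)[of "kernel_comb X K [(1, x)]"] ip_kernel_comb[OF h(1), of "[(1, x)]"] that by simp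
    then show "h = (\<lambda>x. 0)" using outside[OF h(1)] by (auto simp: fun_eq_iff)
  qed
  then obtain s where s: "\<And>n::nat. s n \<in> kernel_comb X K ` coeff_lists"
      "(\<lambda>n. nsq (\<lambda>x. s n x - f x)) \<longlonglongrightarrow> 0" by blast
  from s(1) have "\<forall>n. \<exists>p. p \<in> coeff_lists \<and> s n = kernel_comb X K p" by blast
  from choice[OF this] obtain p where "\<And>n. p n \<in> coeff_lists" "\<And>n. s n = kernel_comb X K (p n)" by blast
  with s(2) show ?thesis by (intro exI[of _ p]) auto
qed

lemma tendsto_pointwise:
  assumes "\<And>n. F n \<in> V" "f \<in> V" "(\<lambda>n. nsq (\<lambda>x. F n x - f x)) \<longlonglongrightarrow> 0" "z \<in> X"
  shows "(\<lambda>n. F n z) \<longlonglongrightarrow> f z"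
proof -
  have "(\<lambda>n. F n z - f z) \<longlonglongrightarrow> 0"
    using ip_tendsto_zero[OF diff_closed[OF assms(1,2)] kernel_mem[OF assms(4)] assms(3)]
      reproducing[OF diff_closed[OF assms(1,2)] assms(4)] by simp
  then show ?thesis by (simp add: LIM_zero_iff)
qed

end

text \<open>Combinations approximating f in the first space have the same mutual distances in the
  second, hence converge there too. Point evaluations are continuous in both spaces, so the two
  limits are the same function, and the norms pass to the limit.\<close>

lemma rkhs_subset:
  assumes "reproducing_kernel_hilbert_space X V1 ip1 K" "reproducing_kernel_hilbert_space X V2 ip2 K"
    and f: "f \<in> V1"
  shows "f \<in> V2 \<and> ip_norm ip2 f = ip_norm ip1 f"
proof -
  interpret A: reproducing_kernel_hilbert_space X V1 ip1 K by fact
  interpret B: reproducing_kernel_hilbert_space X V2 ip2 K by fact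
  have same: "A.nsq (kernel_comb X K p) = B.nsq (kernel_comb X K p)" if "p \<in> A.coeff_lists" for p
    using A.nsq_kernel_comb[OF that] B.nsq_kernel_comb[OF that] by simp
  obtain p where p: "\<And>n::nat. p n \<in> A.coeff_lists"
    and lim: "(\<lambda>n. A.nsq (\<lambda>x. kernel_comb X K (p n) x - f x)) \<longlonglongrightarrow> 0"
    using A.kernel_comb_dense[OF f] by blast
  let ?s = "\<lambda>n. kernel_comb X K (p n)"
  note sA = A.kernel_comb_mem[OF p] and sB = B.kernel_comb_mem[OF p]
  have diff: "A.nsq (\<lambda>x. ?s m x - ?s n x) = B.nsq (\<lambda>x. ?s m x - ?s n x)" for m n
  proof -
    let ?q = "p m @ map (\<lambda>(c, z). ((-1) * c, z)) (p n)"
    have "?q \<in> A.coeff_lists" using p[of m] p[of n] by force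
    from same[OF this] show ?thesis by (simp only: kernel_comb_append kernel_comb_scale) simp
  qed
  have "\<exists>g\<in>V2. (\<lambda>n. B.nsq (\<lambda>x. ?s n x - g x)) \<longlonglongrightarrow> 0"
  proof (rule B.complete_nsq[OF sB])
    fix e :: real assume e: "0 < e"
    obtain N where N: "\<And>n. n \<ge> N \<Longrightarrow> norm (A.nsq (\<lambda>x. ?s n x - f x) - 0) < e / 4"
      using LIMSEQ_D[OF lim, of "e / 4"] e by auto
    show "\<exists>N. \<forall>m\<ge>N. \<forall>n\<ge>N. B.nsq (\<lambda>x. ?s m x - ?s n x) < e"
    proof (intro exI allI impI)
      fix m n assume "N \<le> m" "N \<le> n"
      with N[of m] N[of n] A.nsq_diff_le[OF sA sA f, of m n] diff[of m n]
      show "B.nsq (\<lambda>x. ?s m x - ?s n x) < e" by simp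
    qed
  qed
  then obtain g where g: "g \<in> V2" "(\<lambda>n. B.nsq (\<lambda>x. ?s n x - g x)) \<longlonglongrightarrow> 0" by blast
  have "f z = g z" for z
  proof (cases "z \<in> X")
    case True
    show ?thesis
      by (rule LIMSEQ_unique[OF A.tendsto_pointwise[OF sA f lim True] B.tendsto_pointwise[OF sB g True]])
  next
    case False
    then show ?thesis using A.outside[OF f] B.outside[OF g(1)] by simp
  qed
  then have fg: "f = g" by auto
  have "(\<lambda>n. A.nsq (?s n)) \<longlonglongrightarrow> A.nsq f" by (rule A.nsq_tendsto[OF sA f lim])
  moreover have "(\<lambda>n. B.nsq (?s n)) \<longlonglongrightarrow> B.nsq f" using B.nsq_tendsto[OF sB g] fg by simp
  ultimately have "A.nsq f = B.nsq f" unfolding same[OF p] by (rule LIMSEQ_unique)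
  then show ?thesis using g fg by (simp add: ip_norm_def)
qed

lemma rkhs_unique:
  assumes "reproducing_kernel_hilbert_space X V1 ip1 K" "reproducing_kernel_hilbert_space X V2 ip2 K"
  shows "V1 = V2" "f \<in> V1 \<Longrightarrow> ip_norm ip1 f = ip_norm ip2 f"
  subgoal using rkhs_subset[OF assms, THEN conjunct1] rkhs_subset[OF assms(2,1), THEN conjunct1] by blast
  subgoal using rkhs_subset[OF assms, THEN conjunct2] by simp
  done

section \<open>Radial area integrals\<close>

lemma borel_measurable_Complex [measurable]:
  assumes [measurable]: "f \<in> borel_measurable M" "g \<in> borel_measurable M"
  shows "(\<lambda>z. Complex (f z) (g z)) \<in> borel_measurable M"
  unfolding Complex_eq by measurable

text \<open>Lebesgue measure is determined by its values on boxes, and boxes in the plane are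
  products of intervals. This opens the way to iterated integrals in x and y.\<close>

lemma lborel_complex: "(lborel :: complex measure) = distr (lborel \<Otimes>\<^sub>M lborel) borel (\<lambda>p. Complex (fst p) (snd p))"
proof (rule lborel_eqI)
  fix l u :: complex assume le: "\<And>b. b \<in> Basis \<Longrightarrow> l \<bullet> b \<le> u \<bullet> b"
  have le': "Re l \<le> Re u" "Im l \<le> Im u" using le[of 1] le[of \<i>] by (auto simp: Basis_complex_def)
  have "(\<lambda>p. Complex (fst p) (snd p)) -` box l u \<inter> space (lborel \<Otimes>\<^sub>M lborel)
      = {Re l<..<Re u} \<times> {Im l<..<Im u}"
    by (auto simp: box_def Basis_complex_def space_pair_measure)
  then have "emeasure (distr (lborel \<Otimes>\<^sub>M lborel) borel (\<lambda>p. Complex (fst p) (snd p))) (box l u)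
      = emeasure (lborel \<Otimes>\<^sub>M lborel) ({Re l<..<Re u} \<times> {Im l<..<Im u})"
    by (subst emeasure_distr) auto
  also have "\<dots> = emeasure lborel {Re l<..<Re u} * emeasure lborel {Im l<..<Im u}"
    by (rule lborel.emeasure_pair_measure_Times) auto
  also have "\<dots> = ennreal (Re u - Re l) * ennreal (Im u - Im l)"
    using le' by simp
  also have "\<dots> = (\<Prod>b\<in>Basis. ennreal ((u - l) \<bullet> b))"
    by (simp add: Basis_complex_def)
  finally show "emeasure (distr (lborel \<Otimes>\<^sub>M lborel) borel (\<lambda>p. Complex (fst p) (snd p))) (box l u)
      = (\<Prod>b\<in>Basis. (u - l) \<bullet> b)"
    using le by (subst prod_ennreal[symmetric]) (auto simp: inner_diff_left)
qed simp

lemma nn_integral_complex: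
  assumes [measurable]: "f \<in> borel_measurable borel"
  shows "(\<integral>\<^sup>+z. f z \<partial>lborel) = (\<integral>\<^sup>+x. \<integral>\<^sup>+y. f (Complex x y) \<partial>lborel \<partial>lborel)"
proof -
  have m: "(\<lambda>p. f (Complex (fst p) (snd p))) \<in> borel_measurable (lborel \<Otimes>\<^sub>M lborel)"
    by measurable
  have "(\<integral>\<^sup>+z. f z \<partial>lborel) = (\<integral>\<^sup>+p. f (Complex (fst p) (snd p)) \<partial>(lborel \<Otimes>\<^sub>M lborel))"
    by (subst lborel_complex) (subst nn_integral_distr, auto)
  also have "\<dots> = (\<integral>\<^sup>+x. \<integral>\<^sup>+y. f (Complex x y) \<partial>lborel \<partial>lborel)"
    using lborel.nn_integral_fst[OF m] by simp
  finally show ?thesis .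
qed

lemma nn_integral_complex_swap:
  assumes [measurable]: "f \<in> borel_measurable borel"
  shows "(\<integral>\<^sup>+z. f z \<partial>lborel) = (\<integral>\<^sup>+y. \<integral>\<^sup>+x. f (Complex x y) \<partial>lborel \<partial>lborel)"
proof -
  have "case_prod (\<lambda>x y. f (Complex x y)) \<in> borel_measurable (lborel \<Otimes>\<^sub>M lborel)"
    unfolding case_prod_unfold by measurable
  from lborel_pair.Fubini'[OF this] show ?thesis by (simp add: nn_integral_complex)
qed

text \<open>With one coordinate fixed, a shear is a translation of the other; the order of
  integration is chosen so that the translated coordinate is innermost.\<close>

lemma nn_integral_shear:
  assumes [measurable]: "f \<in> borel_measurable borel"
  shows "(\<integral>\<^sup>+z. f (Complex (Re z + a * Im z) (Im z)) \<partial>lborel) = (\<integral>\<^sup>+z. f z \<partial>lborel)"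
    and "(\<integral>\<^sup>+z. f (Complex (Re z) (Im z + a * Re z)) \<partial>lborel) = (\<integral>\<^sup>+z. f z \<partial>lborel)"
proof -
  have tr: "(\<integral>\<^sup>+x. h (x + t) \<partial>lborel) = (\<integral>\<^sup>+x. h x \<partial>lborel)"
    if [measurable]: "h \<in> borel_measurable borel" for h :: "real \<Rightarrow> ennreal" and t
    using nn_integral_real_affine[of h 1 t] by (simp add: add.commute)
  have "(\<integral>\<^sup>+x. f (Complex (x + a * y) y) \<partial>lborel) = (\<integral>\<^sup>+x. f (Complex x y) \<partial>lborel)" for y
    by (rule tr) measurable
  then show "(\<integral>\<^sup>+z. f (Complex (Re z + a * Im z) (Im z)) \<partial>lborel) = (\<integral>\<^sup>+z. f z \<partial>lborel)"
    by (simp add: nn_integral_complex_swap)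
  have "(\<integral>\<^sup>+y. f (Complex x (y + a * x)) \<partial>lborel) = (\<integral>\<^sup>+y. f (Complex x y) \<partial>lborel)" for x
    by (rule tr) measurable
  then show "(\<integral>\<^sup>+z. f (Complex (Re z) (Im z + a * Re z)) \<partial>lborel) = (\<integral>\<^sup>+z. f z \<partial>lborel)"
    by (simp add: nn_integral_complex)
qed

text \<open>A rotation by an angle other than \<open>\<pi>\<close> is a product of three shears.\<close>

lemma nn_integral_rotate:
  assumes [measurable]: "f \<in> borel_measurable borel" and \<theta>: "- pi < \<theta>" "\<theta> < pi"
  shows "(\<integral>\<^sup>+z. f (cis \<theta> * z) \<partial>lborel) = (\<integral>\<^sup>+z. f z \<partial>lborel)"
proof -
  \<comment> \<open>The composite of x + a y, y + b x, x + a y has diagonal entries 1 + ab and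
    off-diagonal entries 2a + a^2 b and b. Matching it with the rotation gives b = sin \<theta> and
    a = -tan(\<theta>/2), well behaved because cos(\<theta>/2) > 0.\<close>
  define a where "a = - tan (\<theta> / 2)"
  define b where "b = sin \<theta>"
  have c0: "cos (\<theta> / 2) > 0" using \<theta> by (intro cos_gt_zero_pi) auto
  have sd: "sin \<theta> = 2 * sin (\<theta> / 2) * cos (\<theta> / 2)" using sin_double[of "\<theta> / 2"] by simp
  have "a * b = - (2 * (sin (\<theta> / 2))\<^sup>2)"
    using c0 by (simp add: a_def b_def sd tan_def power2_eq_square)
  moreover have cd: "cos \<theta> = 1 - 2 * (sin (\<theta> / 2))\<^sup>2" using cos_double_sin[of "\<theta> / 2"] by simp
  ultimately have ab: "1 + a * b = cos \<theta>" by simp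
  have "1 + cos \<theta> = 2 * (cos (\<theta> / 2))\<^sup>2" using cos_double_cos[of "\<theta> / 2"] by simp
  then have "a * (1 + cos \<theta>) = - sin \<theta>"
    using c0 by (simp add: a_def sd tan_def power2_eq_square)
  then have aab: "a + cos \<theta> * a = - sin \<theta>" by (simp add: algebra_simps)
  have rot: "cis \<theta> * z = (let u = Complex (Re z + a * Im z) (Im z);
       v = Complex (Re u) (Im u + b * Re u) in Complex (Re v + a * Im v) (Im v))" for z
  proof -
    have "Re z + a * Im z + a * (Im z + b * (Re z + a * Im z))
        = (1 + a * b) * Re z + (a + (1 + a * b) * a) * Im z" by (simp add: algebra_simps)
    also have "\<dots> = cos \<theta> * Re z - sin \<theta> * Im z" unfolding ab aab by simp
    finally have 1: "Re z + a * Im z + a * (Im z + b * (Re z + a * Im z)) = cos \<theta> * Re z - sin \<theta> * Im z" .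
    have "Im z + b * (Re z + a * Im z) = b * Re z + (1 + a * b) * Im z" by (simp add: algebra_simps)
    also have "\<dots> = sin \<theta> * Re z + cos \<theta> * Im z" unfolding ab by (simp add: b_def)
    finally have 2: "Im z + b * (Re z + a * Im z) = sin \<theta> * Re z + cos \<theta> * Im z" .
    show ?thesis
      using 1 by (simp add: Let_def complex_eq_iff 2)
  qed
  show ?thesis
    unfolding rot Let_def
    by (subst nn_integral_shear(1)[where f = "\<lambda>u. f (Complex (Re (Complex (Re u) (Im u + b * Re u)) + a * Im (Complex (Re u) (Im u + b * Re u))) (Im (Complex (Re u) (Im u + b * Re u))))"], measurable)
       (subst nn_integral_shear(2)[where f = "\<lambda>v. f (Complex (Re v + a * Im v) (Im v))"], measurable,
        rule nn_integral_shear(1), measurable)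
qed

section \<open>Fourier series on the circle\<close>

text \<open>The open interval omits the angle pi, which the shear decomposition does not reach. The
  total mass is 2 pi, without normalization.\<close>

abbreviation circle_measure :: "real measure" where
  "circle_measure \<equiv> restrict_space lborel {-pi<..<pi}"

lemma finite_circle_measure: "finite_measure circle_measure"
  by (rule finite_measureI) (simp add: emeasure_restrict_space space_restrict_space)

lemma measure_circle_measure: "measure circle_measure (space circle_measure) = 2 * pi"
  by (simp add: measure_restrict_space space_restrict_space)

lemma borel_measurable_circle_measure:
  assumes "f \<in> borel_measurable borel"
  shows "f \<in> borel_measurable circle_measure"
  by (rule measurable_restrict_space1) (use assms in simp)

lemma borel_measurable_cis [measurable]: "(\<lambda>\<theta>. cis \<theta>) \<in> borel_measurable borel"
  unfolding cis_conv_exp by (intro borel_measurable_continuous_onI continuous_intros)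

lemma integral_cis:
  "(\<integral>\<theta>. cis (of_int n * \<theta>) \<partial>circle_measure) = (if n = 0 then of_real (2 * pi) else 0)"
proof (cases "n = 0")
  case True
  interpret finite_measure circle_measure by (rule finite_circle_measure)
  show ?thesis using True measure_circle_measure by (simp add: scaleR_conv_of_real)
next
  case False
  have si: "set_integrable lborel {-pi<..<pi} (\<lambda>\<theta>. cis (of_int n * \<theta>))"
  proof (rule set_integrable_subset[of lborel "{-pi..pi}"])
    show "set_integrable lborel {-pi..pi} (\<lambda>\<theta>. cis (of_int n * \<theta>))"
      by (rule borel_integrable_atLeastAtMost') (intro continuous_intros)
  qed auto
  let ?F = "\<lambda>\<theta>. cis (of_int n * \<theta>) / (\<i> * of_int n)"
  have "((\<lambda>\<theta>. cis (of_int n * \<theta>)) has_integral ?F pi - ?F (- pi)) {-pi..pi}"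
  proof (rule fundamental_theorem_of_calculus)
    fix x :: real
    have "((\<lambda>\<theta>. exp (\<i> * (of_int n * of_real \<theta>)) / (\<i> * of_int n)) has_vector_derivative
        exp (\<i> * (of_int n * of_real x))) (at x within {-pi..pi})"
      by (rule has_vector_derivative_real_field)
         (use False in \<open>auto intro!: derivative_eq_intros simp: field_simps\<close>)
    then show "(?F has_vector_derivative cis (of_int n * x)) (at x within {-pi..pi})"
      by (simp add: cis_conv_exp)
  qed simp
  moreover have "cis (of_int n * pi) = cis (- (of_int n * pi))"
    by (simp add: complex_eq_iff sin_zero_iff_int2)
  ultimately have "((\<lambda>\<theta>. cis (of_int n * \<theta>)) has_integral 0) {-pi..pi}" by simp
  then have "((\<lambda>\<theta>. cis (of_int n * \<theta>)) has_integral 0) {-pi<..<pi}"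
    by (simp add: has_integral_Icc_iff_Ioo)
  then have "integral {-pi<..<pi} (\<lambda>\<theta>. cis (of_int n * \<theta>)) = 0" by (rule integral_unique)
  then show ?thesis
    using False set_borel_integral_eq_integral(2)[OF si]
    by (simp add: integral_restrict_space set_lebesgue_integral_def)
qed

lemma sums_integral_circle:
  fixes u :: "nat \<Rightarrow> real \<Rightarrow> complex"
  assumes meas: "\<And>n. u n \<in> borel_measurable borel"
    and bound: "\<And>n \<theta>. cmod (u n \<theta>) \<le> B n" and B: "summable B"
  shows "(\<lambda>n. \<integral>\<theta>. u n \<theta> \<partial>circle_measure) sums (\<integral>\<theta>. (\<Sum>n. u n \<theta>) \<partial>circle_measure)"
proof -
  interpret finite_measure circle_measure by (rule finite_circle_measure)
  have i: "integrable circle_measure (u n)" for n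
    by (rule integrable_const_bound[of _ "B n"]) (auto intro: borel_measurable_circle_measure meas bound)
  show "(\<lambda>n. \<integral>\<theta>. u n \<theta> \<partial>circle_measure) sums (\<integral>\<theta>. (\<Sum>n. u n \<theta>) \<partial>circle_measure)"
  proof (rule sums_integral[OF i])
    show "AE x in circle_measure. summable (\<lambda>n. norm (u n x))"
      by (rule AE_I2) (rule summable_comparison_test'[OF B], use bound in simp)
    show "summable (\<lambda>n. \<integral>x. norm (u n x) \<partial>circle_measure)"
    proof (rule summable_comparison_test'[OF summable_mult[OF B, of "2 * pi"]])
      fix n
      have "(\<integral>x. norm (u n x) \<partial>circle_measure) \<le> (\<integral>x. B n \<partial>circle_measure)"
        by (intro integral_mono integrable_norm i bound) simp
      then show "norm (\<integral>x. norm (u n x) \<partial>circle_measure) \<le> 2 * pi * B n"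
        using measure_circle_measure by (simp add: integral_nonneg_AE)
    qed
  qed
qed

text \<open>The coefficients are absolutely summable, so termwise integration suffices. One pass
  recovers \<open>c k\<close> as a Fourier coefficient of the sum h; a second integrates |h|^2
  written as the sum of \<open>cnj (c k) * h * cis (- k \<theta>)\<close>.\<close>

lemma Parseval_circle:
  assumes c: "summable (\<lambda>j. cmod (c j))"
  shows "(\<integral>\<^sup>+\<theta>. ennreal ((cmod (\<Sum>j. c j * cis (real j * \<theta>)))\<^sup>2) \<partial>circle_measure)
     = ennreal (2 * pi) * (\<Sum>j. ennreal ((cmod (c j))\<^sup>2))"
proof -
  interpret finite_measure circle_measure by (rule finite_circle_measure)
  define h where "h \<theta> = (\<Sum>j. c j * cis (real j * \<theta>))" for \<theta>
  define C where "C = (\<Sum>j. cmod (c j))"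
  have hs: "summable (\<lambda>j. norm (c j * cis (real j * \<theta>)))" for \<theta>
    using c by (simp add: norm_mult)
  have h_meas [measurable]: "h \<in> borel_measurable borel"
    unfolding h_def by measurable
  have hC: "cmod (h \<theta>) \<le> C" for \<theta>
    using summable_norm[OF hs, of \<theta>] by (simp add: h_def C_def norm_mult)
  have C0: "C \<ge> 0" using hC[of 0] norm_ge_zero[of "h 0"] by linarith
  have coeff: "(\<integral>\<theta>. h \<theta> * cis (- (real k * \<theta>)) \<partial>circle_measure) = of_real (2 * pi) * c k" for k
  proof -
    have "(\<lambda>j. \<integral>\<theta>. c j * cis (real j * \<theta>) * cis (- (real k * \<theta>)) \<partial>circle_measure) sums
       (\<integral>\<theta>. (\<Sum>j. c j * cis (real j * \<theta>) * cis (- (real k * \<theta>))) \<partial>circle_measure)"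
      by (rule sums_integral_circle[OF _ _ c]) (auto simp: norm_mult)
    moreover have "(\<Sum>j. c j * cis (real j * \<theta>) * cis (- (real k * \<theta>))) = h \<theta> * cis (- (real k * \<theta>))" for \<theta>
      unfolding h_def by (rule suminf_mult2[symmetric]) (rule summable_norm_cancel[OF hs])
    moreover have "(\<integral>\<theta>. c j * cis (real j * \<theta>) * cis (- (real k * \<theta>)) \<partial>circle_measure)
        = (if j = k then of_real (2 * pi) * c k else 0)" for j
    proof -
      have "c j * cis (real j * \<theta>) * cis (- (real k * \<theta>)) = c j * cis (of_int (int j - int k) * \<theta>)" for \<theta>
        by (simp add: cis_mult algebra_simps)
      then have "(\<integral>\<theta>. c j * cis (real j * \<theta>) * cis (- (real k * \<theta>)) \<partial>circle_measure)
          = c j * (\<integral>\<theta>. cis (of_int (int j - int k) * \<theta>) \<partial>circle_measure)"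
        by (simp only: integral_mult_right_zero)
      then show ?thesis unfolding integral_cis by simp
    qed
    ultimately show ?thesis
      using sums_single[of k "\<lambda>j. of_real (2 * pi) * c k"] sums_unique2 by fastforce
  qed
  have "(\<lambda>k. \<integral>\<theta>. cnj (c k) * (h \<theta> * cis (- (real k * \<theta>))) \<partial>circle_measure) sums
      (\<integral>\<theta>. (\<Sum>k. cnj (c k) * (h \<theta> * cis (- (real k * \<theta>)))) \<partial>circle_measure)"
  proof (rule sums_integral_circle[OF _ _ summable_mult2[OF c, of C]])
    show "(\<lambda>\<theta>. cnj (c k) * (h \<theta> * cis (- (real k * \<theta>)))) \<in> borel_measurable borel" for k
      by measurable
  qed (use hC in \<open>auto simp: norm_mult intro!: mult_left_mono\<close>)
  moreover have "(\<Sum>k. cnj (c k) * (h \<theta> * cis (- (real k * \<theta>)))) = of_real ((cmod (h \<theta>))\<^sup>2)" for \<theta>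
  proof -
    have "(\<lambda>k. cnj (c k * cis (real k * \<theta>))) sums cnj (h \<theta>)"
      unfolding sums_cnj h_def by (rule summable_sums[OF summable_norm_cancel[OF hs]])
    from sums_mult[OF this, of "h \<theta>"] have "(\<lambda>k. cnj (c k) * (h \<theta> * cis (- (real k * \<theta>)))) sums (h \<theta> * cnj (h \<theta>))"
      by (simp add: cis_cnj mult_ac)
    then show ?thesis unfolding complex_norm_square[symmetric] of_real_power[symmetric]
      by (simp add: sums_iff)
  qed
  moreover have "(\<integral>\<theta>. cnj (c k) * (h \<theta> * cis (- (real k * \<theta>))) \<partial>circle_measure)
      = of_real (2 * pi * (cmod (c k))\<^sup>2)" for k
  proof -
    have "(\<integral>\<theta>. cnj (c k) * (h \<theta> * cis (- (real k * \<theta>))) \<partial>circle_measure)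
        = cnj (c k) * (of_real (2 * pi) * c k)"
      by (simp only: integral_mult_right_zero coeff)
    then show ?thesis using complex_norm_square[of "c k"] by (simp add: mult_ac)
  qed
  ultimately have "(\<lambda>k. complex_of_real (2 * pi * (cmod (c k))\<^sup>2)) sums
     of_real (\<integral>\<theta>. (cmod (h \<theta>))\<^sup>2 \<partial>circle_measure)"
    by (simp only: integral_complex_of_real)
  then have s: "(\<lambda>k. 2 * pi * (cmod (c k))\<^sup>2) sums (\<integral>\<theta>. (cmod (h \<theta>))\<^sup>2 \<partial>circle_measure)"
    by (simp only: sums_of_real_iff)
  have "integrable circle_measure (\<lambda>\<theta>. (cmod (h \<theta>))\<^sup>2)"
    by (rule integrable_const_bound[of _ "C\<^sup>2"])
       (auto intro!: borel_measurable_circle_measure power_mono hC)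
  then have "(\<integral>\<^sup>+\<theta>. ennreal ((cmod (h \<theta>))\<^sup>2) \<partial>circle_measure) = ennreal (\<integral>\<theta>. (cmod (h \<theta>))\<^sup>2 \<partial>circle_measure)"
    by (intro nn_integral_eq_integral) auto
  also have "\<dots> = (\<Sum>k. ennreal (2 * pi * (cmod (c k))\<^sup>2))"
    by (rule suminf_ennreal_eq[symmetric, OF _ s]) simp
  also have "\<dots> = ennreal (2 * pi) * (\<Sum>k. ennreal ((cmod (c k))\<^sup>2))"
    by (simp add: ennreal_mult)
  finally show ?thesis unfolding h_def .
qed

text \<open>Orthogonality of the powers of z for a radial weight, obtained by averaging over
  rotations: at fixed z the angular average of |g|^2 is given by Parseval with coefficients
  \<open>b j * z ^ j\<close>.\<close>

lemma nn_integral_disc_series: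
  assumes g: "g holomorphic_on unit_disc" and [measurable]: "Om \<in> borel_measurable borel"
    and b: "\<And>z. z \<in> unit_disc \<Longrightarrow> (\<lambda>j. b j * z ^ j) sums g z"
      "\<And>z. z \<in> unit_disc \<Longrightarrow> summable (\<lambda>j. cmod (b j * z ^ j))"
  shows "(\<integral>\<^sup>+z\<in>unit_disc. ennreal ((cmod (g z))\<^sup>2) * Om ((cmod z)\<^sup>2) \<partial>lborel)
    = (\<Sum>j. ennreal ((cmod (b j))\<^sup>2) * (\<integral>\<^sup>+z\<in>unit_disc. ennreal (((cmod z)\<^sup>2) ^ j) * Om ((cmod z)\<^sup>2) \<partial>lborel))"
proof -
  \<comment> \<open>Extension by zero makes the integrand measurable on the whole plane, where
    rotation invariance and Tonelli apply.\<close>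
  define G where "G z = (if z \<in> unit_disc then g z else 0)" for z
  have G [measurable]: "G \<in> borel_measurable borel"
  proof -
    have "(\<lambda>z. indicator unit_disc z *\<^sub>R g z) \<in> borel_measurable borel"
      using holomorphic_on_imp_continuous_on[OF g] by (intro borel_measurable_continuous_on_indicator) auto
    also have "(\<lambda>z. indicator unit_disc z *\<^sub>R g z) = G"
      by (auto simp: G_def fun_eq_iff split: split_indicator)
    finally show ?thesis .
  qed
  define R where "R z = Om ((cmod z)\<^sup>2) * indicator unit_disc z" for z :: complex
  have [measurable]: "unit_disc \<in> sets borel" by simp
  have R [measurable]: "R \<in> borel_measurable borel" unfolding R_def by measurable
  define I where "I = (\<integral>\<^sup>+z. ennreal ((cmod (G z))\<^sup>2) * R z \<partial>lborel)"
  have rot: "(\<integral>\<^sup>+z. ennreal ((cmod (G (cis \<theta> * z)))\<^sup>2) * R z \<partial>lborel) = I" if "\<theta> \<in> {-pi<..<pi}" for \<theta>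
  proof -
    have R_rot: "R (cis \<theta> * z) = R z" for z
      by (simp add: R_def norm_mult indicator_def)
    have "I = (\<integral>\<^sup>+z. ennreal ((cmod (G (cis \<theta> * z)))\<^sup>2) * R (cis \<theta> * z) \<partial>lborel)"
      unfolding I_def by (rule nn_integral_rotate[symmetric]) (use that in auto)
    then show ?thesis by (simp add: R_rot)
  qed
  have meas: "case_prod (\<lambda>z \<theta>. ennreal ((cmod (G (cis \<theta> * z)))\<^sup>2) * R z * indicator {-pi<..<pi} \<theta>)
      \<in> borel_measurable (lborel \<Otimes>\<^sub>M lborel)"
    by measurable
  have circ: "(\<integral>\<^sup>+\<theta>. ennreal ((cmod (G (cis \<theta> * z)))\<^sup>2) * R z * indicator {-pi<..<pi} \<theta> \<partial>lborel)
     = ennreal (2 * pi) * (\<Sum>j. ennreal ((cmod (b j))\<^sup>2) * (ennreal (((cmod z)\<^sup>2) ^ j) * R z))" for z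
  proof (cases "z \<in> unit_disc")
    case False
    then show ?thesis by (simp add: R_def)
  next
    case True
    have "G (cis \<theta> * z) = (\<Sum>j. b j * z ^ j * cis (real j * \<theta>))" for \<theta>
    proof -
      have "cis \<theta> * z \<in> unit_disc" using True by (simp add: norm_mult)
      from sums_unique[OF b(1)[OF this]] this show ?thesis
        by (simp add: G_def power_mult_distrib Complex.DeMoivre mult.assoc mult.commute[of "cis _"])
    qed
    then have "(\<integral>\<^sup>+\<theta>. ennreal ((cmod (G (cis \<theta> * z)))\<^sup>2) * R z * indicator {-pi<..<pi} \<theta> \<partial>lborel)
        = (\<integral>\<^sup>+\<theta>. ennreal ((cmod (\<Sum>j. b j * z ^ j * cis (real j * \<theta>)))\<^sup>2) * R z \<partial>circle_measure)"
      by (simp add: nn_integral_restrict_space)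
    also have "\<dots> = (\<integral>\<^sup>+\<theta>. ennreal ((cmod (\<Sum>j. b j * z ^ j * cis (real j * \<theta>)))\<^sup>2) \<partial>circle_measure) * R z"
      by (rule nn_integral_multc) (rule borel_measurable_circle_measure, measurable)
    also have "\<dots> = ennreal (2 * pi) * ((\<Sum>j. ennreal ((cmod (b j * z ^ j))\<^sup>2)) * R z)"
      using Parseval_circle[OF b(2)[OF True]] by (simp add: mult.assoc)
    also have "(\<Sum>j. ennreal ((cmod (b j * z ^ j))\<^sup>2)) * R z
        = (\<Sum>j. ennreal ((cmod (b j))\<^sup>2) * (ennreal (((cmod z)\<^sup>2) ^ j) * R z))"
      unfolding ennreal_suminf_multc[symmetric]
      by (simp add: norm_mult norm_power power_mult_distrib ennreal_mult mult.assoc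
          power_mult[symmetric] mult.commute[of _ 2])
    finally show ?thesis .
  qed
  \<comment> \<open>Each rotated integral equals I, so integrating over the angle only multiplies by
    2 pi; the same factor comes out of Parseval and cancels at the end.\<close>
  have "ennreal (2 * pi) * I = (\<integral>\<^sup>+\<theta>. I * indicator {-pi<..<pi} \<theta> \<partial>lborel)"
    by (simp add: nn_integral_cmult_indicator mult.commute)
  also have "\<dots> = (\<integral>\<^sup>+\<theta>. \<integral>\<^sup>+z. ennreal ((cmod (G (cis \<theta> * z)))\<^sup>2) * R z * indicator {-pi<..<pi} \<theta> \<partial>lborel \<partial>lborel)"
    by (intro nn_integral_cong) (auto simp: rot split: split_indicator)
  also have "\<dots> = (\<integral>\<^sup>+z. \<integral>\<^sup>+\<theta>. ennreal ((cmod (G (cis \<theta> * z)))\<^sup>2) * R z * indicator {-pi<..<pi} \<theta> \<partial>lborel \<partial>lborel)"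
    by (rule lborel_pair.Fubini'[OF meas])
  also have "\<dots> = ennreal (2 * pi) * (\<integral>\<^sup>+z. (\<Sum>j. ennreal ((cmod (b j))\<^sup>2) * (ennreal (((cmod z)\<^sup>2) ^ j) * R z)) \<partial>lborel)"
    unfolding circ by (rule nn_integral_cmult) measurable
  also have "(\<integral>\<^sup>+z. (\<Sum>j. ennreal ((cmod (b j))\<^sup>2) * (ennreal (((cmod z)\<^sup>2) ^ j) * R z)) \<partial>lborel)
      = (\<Sum>j. ennreal ((cmod (b j))\<^sup>2) * (\<integral>\<^sup>+z. ennreal (((cmod z)\<^sup>2) ^ j) * R z \<partial>lborel))"
    by (subst nn_integral_suminf, measurable) (intro suminf_cong nn_integral_cmult, measurable)
  finally have "I = (\<Sum>j. ennreal ((cmod (b j))\<^sup>2) * (\<integral>\<^sup>+z. ennreal (((cmod z)\<^sup>2) ^ j) * R z \<partial>lborel))"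
    by (subst (asm) ennreal_mult_cancel_left) auto
  moreover have "I = (\<integral>\<^sup>+z\<in>unit_disc. ennreal ((cmod (g z))\<^sup>2) * Om ((cmod z)\<^sup>2) \<partial>lborel)"
    unfolding I_def R_def G_def by (intro nn_integral_cong) (auto split: split_indicator)
  ultimately show ?thesis by (simp add: R_def mult_ac)
qed

section \<open>Radial weights and the distribution of |z|^2\<close>

lemma emeasure_complex_ball:
  assumes "0 \<le> r"
  shows "emeasure lborel (ball (0::complex) r) = ennreal (pi * r\<^sup>2)"
    "emeasure lborel (cball (0::complex) r) = ennreal (pi * r\<^sup>2)"
  using assms by (simp_all add: emeasure_ball emeasure_cball unit_ball_vol_2)

text \<open>For 0 <= x < 1 the part of the disc where |z|^2 > x is an annulus of area pi (1 - x).
  Agreement on all rays (x, \<infinity>) identifies the two measures.\<close>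

lemma distr_norm_power2:
  "distr (density lborel (indicator unit_disc)) borel (\<lambda>z::complex. (cmod z)\<^sup>2)
    = density lborel (\<lambda>t. ennreal pi * indicator {0<..<1} t)" (is "?M = ?N")
proof (rule measure_eqI_lessThan)
  have M: "emeasure ?M {x<..} = emeasure lborel (unit_disc \<inter> {z. x < (cmod z)\<^sup>2})" for x
  proof -
    have "{z. x < (cmod z)\<^sup>2} \<in> sets lborel" by measurable
    then have "emeasure (density lborel (indicator unit_disc)) {z::complex. x < (cmod z)\<^sup>2}
        = (\<integral>\<^sup>+z. indicator unit_disc z * indicator {z. x < (cmod z)\<^sup>2} z \<partial>lborel)"
      by (intro emeasure_density borel_measurable_indicator) auto
    also have "\<dots> = emeasure lborel (unit_disc \<inter> {z. x < (cmod z)\<^sup>2})"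
      unfolding indicator_inter_arith[symmetric] by (rule nn_integral_indicator) simp
    finally show ?thesis
      by (simp add: emeasure_distr vimage_def)
  qed
  have N: "emeasure ?N {x<..} = ennreal pi * emeasure lborel ({0<..<1} \<inter> {x<..})" for x
    by (simp add: emeasure_density mult.assoc nn_integral_cmult indicator_inter_arith[symmetric])
  show "emeasure ?M {x<..} < \<infinity>" for x
  proof -
    have "emeasure ?M {x<..} \<le> emeasure lborel (ball (0::complex) 1)"
      unfolding M by (rule emeasure_mono) auto
    also have "\<dots> < \<infinity>" by (simp add: emeasure_complex_ball)
    finally show ?thesis .
  qed
  show "emeasure ?M {x<..} = emeasure ?N {x<..}" for x
  proof -
    consider "x < 0" | "0 \<le> x" "x < 1" | "1 \<le> x" by linarith
    then show ?thesis
    proof cases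
      case 1
      then have "unit_disc \<inter> {z. x < (cmod z)\<^sup>2} = ball 0 1" "{0<..<1} \<inter> {x<..} = {0<..<1::real}"
        by (auto intro: less_le_trans)
      then show ?thesis unfolding M N by (simp add: emeasure_complex_ball)
    next
      case 2
      then have "unit_disc \<inter> {z. x < (cmod z)\<^sup>2} = ball 0 1 - cball 0 (sqrt x)"
        by (auto simp: not_le real_less_lsqrt real_less_rsqrt real_le_lsqrt intro: real_le_rsqrt)
           (metis not_le real_le_rsqrt norm_ge_zero real_sqrt_le_iff real_sqrt_unique)+
      moreover have "emeasure lborel (ball 0 1 - cball (0::complex) (sqrt x)) = ennreal pi - ennreal (pi * x)"
      proof (subst emeasure_Diff)
        have "sqrt x < 1" using 2 by simp
        then show "cball (0::complex) (sqrt x) \<subseteq> ball 0 1" by (simp add: cball_subset_ball_iff)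
      qed (use 2 in \<open>auto simp: emeasure_complex_ball\<close>)
      moreover have "{0<..<1} \<inter> {x<..} = {x<..<1}" using 2 by auto
      moreover have "ennreal pi - ennreal (pi * x) = ennreal pi * ennreal (1 - x)"
        using 2 by (simp add: ennreal_minus ennreal_mult[symmetric] algebra_simps)
      ultimately show ?thesis using 2 unfolding M N by simp
    next
      case 3
      have "unit_disc \<inter> {z. x < (cmod z)\<^sup>2} = {}"
      proof -
        have "(cmod z)\<^sup>2 < 1" if "cmod z < 1" for z using that by (simp add: power_less_one_iff abs_square_less_1)
        then show ?thesis using 3 by force
      qed
      moreover have "{0<..<1} \<inter> {x<..} = {}" using 3 by auto
      ultimately show ?thesis unfolding M N by (simp del: greaterThanLessThan_def)
    qed
  qed
qed auto

lemma nn_integral_disc_radial: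
  assumes [measurable]: "H \<in> borel_measurable borel"
  shows "(\<integral>\<^sup>+z\<in>unit_disc. H ((cmod z)\<^sup>2) \<partial>lborel) = ennreal pi * (\<integral>\<^sup>+t\<in>{0<..<1}. H t \<partial>lborel)"
proof -
  have "(\<integral>\<^sup>+z\<in>unit_disc. H ((cmod z)\<^sup>2) \<partial>lborel)
      = (\<integral>\<^sup>+t. H t \<partial>distr (density lborel (indicator unit_disc)) borel (\<lambda>z::complex. (cmod z)\<^sup>2))"
    by (subst nn_integral_distr, simp, measurable, subst nn_integral_density)
       (auto simp: mult.commute intro!: borel_measurable_indicator)
  also have "\<dots> = ennreal pi * (\<integral>\<^sup>+t\<in>{0<..<1}. H t \<partial>lborel)"
    unfolding distr_norm_power2
    by (subst nn_integral_density, measurable)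
       (subst nn_integral_cmult[symmetric], auto simp: mult_ac)
  finally show ?thesis .
qed

definition moment :: "(real \<Rightarrow> real) \<Rightarrow> nat \<Rightarrow> ennreal" where
  "moment om j = (\<integral>\<^sup>+t\<in>{0<..<1}. ennreal (t ^ j * om t) \<partial>lborel)"

text \<open>The squared area norm of z^j when the weight at z is om(|z|^2). The value 1 at j = 0
  accounts for |f(0)|^2; for other j the derivative supplies the factor j^2 and lowers the exponent
  by one.\<close>

definition area_weight :: "(real \<Rightarrow> real) \<Rightarrow> nat \<Rightarrow> ennreal" where
  "area_weight om j = (if j = 0 then 1 else ennreal ((real j)\<^sup>2) * moment om (j - 1))"

lemma area_norm_eq_ecoeff_norm:
  assumes [measurable]: "om \<in> borel_measurable borel" and f: "f \<in> hol_disc"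
  shows "area_norm (\<lambda>z. om ((cmod z)\<^sup>2)) f = ecoeff_norm (area_weight om) f"
proof -
  have hol: "deriv f holomorphic_on unit_disc"
    using f by (intro holomorphic_deriv) (auto simp: hol_disc_def)
  \<comment> \<open>The derivative is cut off outside the disc to be an element of
    \<open>hol_disc\<close>; its Taylor coefficients depend only on values near 0.\<close>
  define g where "g z = (if z \<in> unit_disc then deriv f z else 0)" for z
  have g: "g \<in> hol_disc"
    using holomorphic_cong[of unit_disc unit_disc g "deriv f"] hol by (auto simp: hol_disc_def g_def)
  have tg: "taylor g j = of_nat (Suc j) * taylor f (Suc j)" for j
  proof -
    have "(deriv ^^ j) g 0 = (deriv ^^ j) (deriv f) 0"
      by (rule higher_deriv_cong_ev[OF _ refl])
         (rule eventually_mono[OF eventually_nhds_in_open[of unit_disc]], auto simp: g_def)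
    then show ?thesis using taylor_deriv[of f j] by (simp add: taylor_def)
  qed
  have "(\<integral>\<^sup>+z\<in>unit_disc. ennreal ((cmod (deriv f z))\<^sup>2 * om ((cmod z)\<^sup>2) / pi) \<partial>lborel)
      = (\<integral>\<^sup>+z\<in>unit_disc. ennreal ((cmod (g z))\<^sup>2) * ennreal (om ((cmod z)\<^sup>2) / pi) \<partial>lborel)"
    by (intro nn_integral_cong) (auto simp: g_def ennreal_mult'[symmetric] split: split_indicator)
  also have "\<dots> = (\<Sum>j. ennreal ((cmod (taylor g j))\<^sup>2) *
      (\<integral>\<^sup>+z\<in>unit_disc. ennreal (((cmod z)\<^sup>2) ^ j) * ennreal (om ((cmod z)\<^sup>2) / pi) \<partial>lborel))"
    by (rule nn_integral_disc_series)
       (use g in \<open>auto simp: hol_disc_def intro: hol_disc_sums[OF g, simplified] summable_taylor[OF g, simplified]\<close>)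
  also have "\<dots> = (\<Sum>j. ennreal ((cmod (taylor g j))\<^sup>2) * moment om j)"
  proof (intro suminf_cong arg_cong2[of _ _ _ _ "(*)"] refl)
    fix j
    have "(\<integral>\<^sup>+z\<in>unit_disc. ennreal (((cmod z)\<^sup>2) ^ j) * ennreal (om ((cmod z)\<^sup>2) / pi) \<partial>lborel)
        = ennreal pi * (\<integral>\<^sup>+t\<in>{0<..<1}. ennreal (t ^ j) * ennreal (om t / pi) \<partial>lborel)"
      by (rule nn_integral_disc_radial) measurable
    also have "\<dots> = (\<integral>\<^sup>+t\<in>{0<..<1}. ennreal (t ^ j * om t) \<partial>lborel)"
      by (subst nn_integral_cmult[symmetric], measurable, intro nn_integral_cong)
         (auto simp: ennreal_mult'[symmetric] ennreal_mult''[symmetric] split: split_indicator)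
    finally show "(\<integral>\<^sup>+z\<in>unit_disc. ennreal (((cmod z)\<^sup>2) ^ j) * ennreal (om ((cmod z)\<^sup>2) / pi) \<partial>lborel) = moment om j"
      by (simp add: moment_def)
  qed
  also have "\<dots> = (\<Sum>j. area_weight om (Suc j) * ennreal ((cmod (taylor f (Suc j)))\<^sup>2))"
    by (simp add: tg area_weight_def norm_mult power_mult_distrib ennreal_mult mult_ac del: of_nat_Suc)
  finally have eq: "(\<integral>\<^sup>+z\<in>unit_disc. ennreal ((cmod (deriv f z))\<^sup>2 * om ((cmod z)\<^sup>2) / pi) \<partial>lborel)
      = (\<Sum>j. area_weight om (Suc j) * ennreal ((cmod (taylor f (Suc j)))\<^sup>2))" .
  have "(\<Sum>j. area_weight om j * ennreal ((cmod (taylor f j))\<^sup>2))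
      = (\<Sum>j. area_weight om (Suc j) * ennreal ((cmod (taylor f (Suc j)))\<^sup>2)) + ennreal ((cmod (f 0))\<^sup>2)"
    using sums_unique[OF sums_Suc[OF summable_sums[OF summableI]],
        of "\<lambda>j. area_weight om j * ennreal ((cmod (taylor f j))\<^sup>2)"]
    by (simp add: area_weight_def taylor_at_0)
  then show ?thesis
    by (simp add: area_norm_def ecoeff_norm_def eq add.commute)
qed

section \<open>The coefficients of the powers of the kernel\<close>

lemma a_coeff_0: "a_coeff 0 j = (if j = 0 then 1 else 0)"
proof -
  have "{n. n \<in> multi_indices 0 \<and> (\<Sum>i<0. n i) = j} = (if j = 0 then {\<lambda>_. undefined} else {})"
    by (auto simp: multi_indices_def)
  then show ?thesis by (simp add: a_coeff_def)
qed

text \<open>The last entry m of the multi-index is split off. Multi-indices are extensional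
  functions, so the shortened one takes the value \<open>undefined\<close> at d.\<close>

lemma a_coeff_Suc: "a_coeff (Suc d) j = (\<Sum>m\<le>j. 1 / real (m + 1) * a_coeff d (j - m))"
proof -
  let ?A = "\<lambda>d j. {n. n \<in> multi_indices d \<and> (\<Sum>i<d. n i) = j}"
  have fin: "finite (?A d j)" for d j by (rule finite_multi_indices_sum)
  have "(\<Sum>m\<le>j. 1 / real (m + 1) * a_coeff d (j - m))
      = (\<Sum>m\<le>j. \<Sum>n\<in>?A d (j - m). 1 / real (m + 1) * (1 / (\<Prod>i<d. real (n i + 1))))"
    unfolding a_coeff_def sum_distrib_left ..
  also have "\<dots> = (\<Sum>(m, n)\<in>Sigma {..j} (\<lambda>m. ?A d (j - m)). 1 / real (m + 1) * (1 / (\<Prod>i<d. real (n i + 1))))"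
    by (rule sum.Sigma) (auto intro: fin)
  also have "\<dots> = (\<Sum>n\<in>?A (Suc d) j. 1 / (\<Prod>i<Suc d. real (n i + 1)))"
  proof (rule sum.reindex_bij_witness[of _ "\<lambda>n. (n d, n(d := undefined))" "\<lambda>(m, n). n(d := m)"])
    fix p assume p: "p \<in> Sigma {..j} (\<lambda>m. ?A d (j - m))"
    obtain m n where [simp]: "p = (m, n)" by (cases p)
    have m: "m \<le> j" and n: "n \<in> {..<d} \<rightarrow>\<^sub>E UNIV" "(\<Sum>i<d. n i) = j - m"
      using p by (auto simp: multi_indices_def)
    have "n d = undefined" by (rule PiE_arb[OF n(1)]) simp
    then show "((case p of (m, n) \<Rightarrow> n(d := m)) d, (case p of (m, n) \<Rightarrow> n(d := m))(d := undefined)) = p"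
      by auto
    show "(case p of (m, n) \<Rightarrow> n(d := m)) \<in> ?A (Suc d) j"
      using m n by (auto simp: multi_indices_def PiE_iff extensional_def)
    show "1 / (\<Prod>i<Suc d. real ((case p of (m, n) \<Rightarrow> n(d := m)) i + 1))
        = (case p of (m, n) \<Rightarrow> 1 / real (m + 1) * (1 / (\<Prod>i<d. real (n i + 1))))"
      by simp
  next
    fix n assume n: "n \<in> ?A (Suc d) j"
    show "(case (n d, n(d := undefined)) of (m, n) \<Rightarrow> n(d := m)) = n" by simp
    show "(n d, n(d := undefined)) \<in> Sigma {..j} (\<lambda>m. ?A d (j - m))"
      using n by (auto simp: multi_indices_def PiE_iff extensional_def)
  qed
  finally show ?thesis by (simp add: a_coeff_def)
qed

lemma a_coeff_1: "a_coeff (Suc 0) j = 1 / real (j + 1)"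
proof -
  have "(\<Sum>m\<le>j. 1 / real (m + 1) * a_coeff 0 (j - m)) = (\<Sum>m\<in>{j}. 1 / real (m + 1) * a_coeff 0 (j - m))"
    by (rule sum.mono_neutral_right) (auto simp: a_coeff_0)
  then show ?thesis by (simp add: a_coeff_Suc a_coeff_0)
qed

lemma a_coeff_nonneg: "0 \<le> a_coeff d j"
  by (auto simp: a_coeff_def intro!: sum_nonneg prod_nonneg)

section \<open>Expansion of the kernel powers by Cauchy products\<close>

lemma summable_dirichlet_series:
  assumes "norm (t::'a::{real_normed_field,banach}) < 1"
  shows "summable (\<lambda>n. norm (of_real (1 / real (n + 1)) * t ^ n))"
proof (rule summable_comparison_test'[OF summable_geometric[of "norm t"]])
  show "norm (norm (of_real (1 / real (n + 1)) * t ^ n)) \<le> norm t ^ n" for n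
    by (simp add: norm_mult norm_power norm_divide divide_le_eq mult_le_cancel_left1 flip: of_real_add of_nat_Suc)
qed (use assms in simp)

lemma summable_a_coeff:
  assumes "0 \<le> r" "r < 1"
  shows "summable (\<lambda>j. a_coeff d j * r ^ j)"
proof (induction d)
  case 0
  show ?case by (rule summable_of_finite_support[of 1]) (simp add: a_coeff_0)
next
  case (Suc d)
  have "summable (\<lambda>k. \<Sum>i\<le>k. 1 / real (i + 1) * r ^ i * (a_coeff d (k - i) * r ^ (k - i)))"
    using summable_dirichlet_series[of r] Suc assms
    by (intro summable_Cauchy_product) (auto simp: abs_mult a_coeff_nonneg)
  moreover have "(\<Sum>i\<le>k. 1 / real (i + 1) * r ^ i * (a_coeff d (k - i) * r ^ (k - i))) = a_coeff (Suc d) k * r ^ k" for k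
    unfolding a_coeff_Suc sum_distrib_right
    by (intro sum.cong refl) (simp add: power_add[symmetric] mult_ac)
  ultimately show ?case by simp
qed

lemma dirichlet_kernel_power_sums:
  assumes "cmod (cnj z * w) < 1"
  shows "(\<lambda>j. of_real (a_coeff d j) * (cnj z * w) ^ j) sums dirichlet_kernel w z ^ d"
proof (induction d)
  case 0
  have "(\<lambda>j. of_real (a_coeff 0 j) * (cnj z * w) ^ j) = (\<lambda>j. if j = 0 then 1 else 0)"
    by (auto simp: a_coeff_0)
  then show ?case using sums_single[of 0 "\<lambda>_. 1::complex"] by simp
next
  case (Suc d)
  let ?t = "cnj z * w"
  have "summable (\<lambda>j. norm (complex_of_real (a_coeff d j) * ?t ^ j))"
    using summable_a_coeff[of "cmod ?t" d] assms by (simp add: norm_mult norm_power a_coeff_nonneg)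
  from Cauchy_product_sums[OF summable_dirichlet_series[OF assms] this]
  have "(\<lambda>k. \<Sum>i\<le>k. of_real (1 / real (i + 1)) * ?t ^ i * (of_real (a_coeff d (k - i)) * ?t ^ (k - i))) sums
      ((\<Sum>k. of_real (1 / real (k + 1)) * ?t ^ k) * (\<Sum>k. of_real (a_coeff d k) * ?t ^ k))" .
  moreover have "(\<Sum>i\<le>k. of_real (1 / real (i + 1)) * ?t ^ i * (of_real (a_coeff d (k - i)) * ?t ^ (k - i)))
      = of_real (a_coeff (Suc d) k) * ?t ^ k" for k
  proof -
    have "x * ?t ^ i * (y * ?t ^ (k - i)) = x * y * ?t ^ k" if "i \<le> k" for i x y
      using that power_add[of ?t i "k - i"] by (simp add: mult_ac)
    then show ?thesis
      unfolding a_coeff_Suc of_real_sum sum_distrib_right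
      by (intro sum.cong refl) (simp only: of_real_mult atMost_iff)
  qed
  moreover have "(\<Sum>k. of_real (1 / real (k + 1)) * ?t ^ k) = dirichlet_kernel w z"
    by (simp add: dirichlet_kernel_def)
  ultimately show ?case using sums_unique[OF Suc] by simp
qed

text \<open>In the induction ln x <= x - 1 at x = (n+1)/(n+2) shows that the logarithm grows by at
  least 1/(n+2), which is at least half of 1/(n+1); hence the factor 2.\<close>

lemma harm_le_ln: "harm n \<le> 2 * ln (real n + 1)"
proof (induction n)
  case (Suc n)
  have "ln (real (n + 1) / real (n + 2)) \<le> real (n + 1) / real (n + 2) - 1"
    by (rule ln_le_minus_one) auto
  also have "\<dots> = - 1 / real (n + 2)" by (simp add: field_simps)
  also have "\<dots> \<le> - inverse (real (n + 1)) / 2" by (simp add: field_simps)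
  finally have "inverse (real (n + 1)) \<le> 2 * (ln (real (n + 2)) - ln (real (n + 1)))"
    by (simp add: ln_div)
  with Suc show ?case by (simp add: harm_Suc algebra_simps)
qed (simp add: harm_def)

lemma sum_inverse_eq_harm: "(\<Sum>m\<le>j. 1 / real (m + 1)) = harm (j + 1)"
  by (simp add: harm_altdef lessThan_Suc_atMost inverse_eq_divide)

text \<open>In the recursion the logarithm of j - m + 2 is bounded by that of j + 2, and partial
  fractions split the remaining sum into two harmonic sums, each at most 2 ln(j + 2). Every step
  therefore multiplies the constant by 4.\<close>

lemma a_coeff_upper:
  "\<exists>C>0. \<forall>j. a_coeff (Suc k) j \<le> C * ln (real (j + 2)) ^ k / real (j + 1)"
proof (induction k)
  case 0
  show ?case by (rule exI[of _ 1]) (simp add: a_coeff_1)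
next
  case (Suc k)
  then obtain C where C: "C > 0" "\<And>j. a_coeff (Suc k) j \<le> C * ln (real (j + 2)) ^ k / real (j + 1)" by blast
  show ?case
  proof (intro exI[of _ "4 * C"] conjI allI)
    fix j
    let ?l = "ln (real (j + 2))"
    have "a_coeff (Suc (Suc k)) j \<le> (\<Sum>m\<le>j. C * ?l ^ k / real (j + 2) * (1 / real (m + 1) + 1 / real (j - m + 1)))"
      unfolding a_coeff_Suc[of "Suc k"]
    proof (rule sum_mono)
      fix m assume "m \<in> {..j}"
      then have m: "m \<le> j" by simp
      have "a_coeff (Suc k) (j - m) \<le> C * ln (real (j - m + 2)) ^ k / real (j - m + 1)" by (rule C)
      also have "\<dots> \<le> C * ?l ^ k / real (j - m + 1)"
        using C(1) by (intro divide_right_mono mult_left_mono power_mono) auto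
      finally have "1 / real (m + 1) * a_coeff (Suc k) (j - m) \<le> 1 / real (m + 1) * (C * ?l ^ k / real (j - m + 1))"
        by (rule mult_left_mono) simp
      also have "\<dots> = C * ?l ^ k * (1 / real (m + 1) * (1 / real (j - m + 1)))" by simp
      also have "1 / real (m + 1) * (1 / real (j - m + 1)) = (1 / real (m + 1) + 1 / real (j - m + 1)) / real (j + 2)"
      proof -
        have "real (j + 2) = real (m + 1) + real (j - m + 1)" using m by simp
        moreover have "1 / x * (1 / y) = (1 / x + 1 / y) / (x + y)" if "0 < x" "0 < y" for x y :: real
        proof -
          have "1 / x + 1 / y = (x + y) / (x * y)" using that by (simp add: add_frac_eq)
          then show ?thesis using add_pos_pos[OF that] by simp
        qed
        ultimately show ?thesis by (metis of_nat_0_less_iff add_gr_0 zero_less_one)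
      qed
      finally show "1 / real (m + 1) * a_coeff (Suc k) (j - m)
          \<le> C * ?l ^ k / real (j + 2) * (1 / real (m + 1) + 1 / real (j - m + 1))" by simp
    qed
    also have "\<dots> = C * ?l ^ k / real (j + 2) * (2 * harm (j + 1))"
    proof -
      have "(\<Sum>m\<le>j. 1 / real (j - m + 1)) = (\<Sum>m\<le>j. 1 / real (m + 1))"
        by (rule sum.reindex_bij_witness[of _ "\<lambda>m. j - m" "\<lambda>m. j - m"]) auto
      then show ?thesis
        unfolding sum_distrib_left[symmetric] sum.distrib by (simp only: sum_inverse_eq_harm mult_2)
    qed
    also have "\<dots> \<le> C * ?l ^ k / real (j + 2) * (2 * (2 * ?l))"
      using harm_le_ln[of "j + 1"] C(1) by (intro mult_left_mono) (auto simp: add_ac)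
    also have "\<dots> = 4 * C * ?l ^ Suc k / real (j + 2)" by simp
    also have "\<dots> \<le> 4 * C * ?l ^ Suc k / real (j + 1)"
      using C(1) by (intro divide_left_mono) auto
    finally show "a_coeff (Suc (Suc k)) j \<le> 4 * C * ?l ^ Suc k / real (j + 1)" .
  qed (use C in auto)
qed

lemma ln_half_le:
  assumes "real j + 2 \<le> x\<^sup>2" "0 < x"
  shows "ln (real (j + 2)) / 2 \<le> ln x"
proof -
  have "ln (real (j + 2)) \<le> ln (x\<^sup>2)" using assms by (subst ln_le_cancel_iff) auto
  then show ?thesis using assms(2) by (simp add: ln_realpow)
qed

text \<open>Only the terms with m <= j/2 are kept. There j - m + 2 is at least the square root of j
  + 2, so each logarithm is at least half of ln(j + 2), and the harmonic sum over these m is also at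
  least half of it.\<close>

lemma a_coeff_lower:
  "\<exists>c>0. \<forall>j. c * ln (real (j + 2)) ^ k / real (j + 1) \<le> a_coeff (Suc k) j"
proof (induction k)
  case 0
  show ?case by (rule exI[of _ 1]) (simp add: a_coeff_1)
next
  case (Suc k)
  then obtain c where c: "c > 0" "\<And>j. c * ln (real (j + 2)) ^ k / real (j + 1) \<le> a_coeff (Suc k) j" by blast
  show ?case
  \<comment> \<open>k factors 1/2 come from the power of the logarithm and one more from the
    truncated harmonic sum.\<close>
  proof (intro exI[of _ "c / 2 ^ Suc k"] conjI allI)
    fix j
    let ?l = "ln (real (j + 2))"
    \<comment> \<open>The threshold (j + 3)/2 lies below both j - m + 2 for m <= j/2 and j div 2 +
      2, and its square exceeds j + 2.\<close>
    have h: "?l / 2 \<le> ln x" if "x \<ge> real j / 2 + 3 / 2" for x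
    proof (rule ln_half_le)
      have "real j + 2 \<le> (real j / 2 + 3 / 2)\<^sup>2" by (simp add: power2_eq_square field_simps)
      also have "\<dots> \<le> x\<^sup>2" by (rule power_mono) (use that in auto)
      finally show "real j + 2 \<le> x\<^sup>2" .
      show "0 < x" using that by simp
    qed
    have "c / 2 ^ Suc k * ?l ^ Suc k / real (j + 1) = c * (?l / 2) ^ k / real (j + 1) * (?l / 2)"
      by (simp add: power_divide mult_ac)
    also have "\<dots> \<le> c * (?l / 2) ^ k / real (j + 1) * harm (j div 2 + 1)"
    proof (rule mult_left_mono)
      have "?l / 2 \<le> ln (real (j div 2 + 1) + 1)" by (rule h) linarith
      also have "\<dots> \<le> harm (j div 2 + 1)" by (rule ln_le_harm)
      finally show "?l / 2 \<le> harm (j div 2 + 1)" .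
      show "0 \<le> c * (?l / 2) ^ k / real (j + 1)" using c(1) by simp
    qed
    also have "\<dots> = (\<Sum>m\<le>j div 2. 1 / real (m + 1) * (c * (?l / 2) ^ k / real (j + 1)))"
      by (simp only: sum_inverse_eq_harm[symmetric] sum_distrib_right mult.commute)
    also have "\<dots> \<le> (\<Sum>m\<le>j div 2. 1 / real (m + 1) * a_coeff (Suc k) (j - m))"
    proof (intro sum_mono mult_left_mono)
      fix m assume "m \<in> {..j div 2}"
      then have m: "m \<le> j div 2" by simp
      then have mj: "m \<le> j" "2 * m \<le> j" by auto
      have "c * (?l / 2) ^ k / real (j + 1) \<le> c * ln (real (j - m + 2)) ^ k / real (j + 1)"
        using c(1) mj by (intro divide_right_mono mult_left_mono power_mono h) auto
      also have "\<dots> \<le> c * ln (real (j - m + 2)) ^ k / real (j - m + 1)"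
        using c(1) by (intro divide_left_mono) auto
      also have "\<dots> \<le> a_coeff (Suc k) (j - m)" by (rule c(2))
      finally show "c * (?l / 2) ^ k / real (j + 1) \<le> a_coeff (Suc k) (j - m)" .
    qed auto
    also have "\<dots> \<le> a_coeff (Suc (Suc k)) j"
      unfolding a_coeff_Suc[of "Suc k"] by (rule sum_mono2) (auto simp: a_coeff_nonneg)
    finally show "c / 2 ^ Suc k * ?l ^ Suc k / real (j + 1) \<le> a_coeff (Suc (Suc k)) j" .
  qed (use c in auto)
qed

lemma a_coeff_pos: "0 < a_coeff (Suc k) j"
proof -
  obtain c where c: "c > 0" "\<And>j. c * ln (real (j + 2)) ^ k / real (j + 1) \<le> a_coeff (Suc k) j"
    using a_coeff_lower by blast
  have "0 < c * ln (real (j + 2)) ^ k / real (j + 1)" using c(1) by simp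
  also have "\<dots> \<le> a_coeff (Suc k) j" by (rule c)
  finally show ?thesis .
qed

section \<open>Moments of logarithmic weights\<close>

lemma power_le_fact_exp:
  assumes "0 \<le> (x::real)"
  shows "x ^ k \<le> fact k * exp x"
proof -
  have "(\<Sum>n\<in>{k}. inverse (fact n) * x ^ n) \<le> (\<Sum>n. inverse (fact n) * x ^ n)"
    by (rule sum_le_suminf) (use assms summable_exp[of x] in auto)
  then have "inverse (fact k) * x ^ k \<le> exp x" by (simp add: exp_def scaleR_conv_of_real inverse_eq_divide)
  then show ?thesis by (simp add: field_simps)
qed

text \<open>The bound x^k <= k! e^x at x = 1 + ln u.\<close>

lemma ln_power_le:
  assumes "1 \<le> (u::real)"
  shows "(1 + ln u) ^ k \<le> fact k * exp 1 * u"
  using power_le_fact_exp[of "1 + ln u" k] assms by (simp add: exp_add)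

text \<open>Powers of the logarithm are dominated by u at infinity and by an integrable singularity
  at 0. For u < 1 the substitution y = 1/sqrt u gives |ln u| = 2 ln y, which costs the factor
  2^k.\<close>

lemma abs_ln_power_le:
  assumes "0 < (u::real)"
  shows "(1 + \<bar>ln u\<bar>) ^ k \<le> 2 ^ k * fact k * exp 1 * (u + 1 / sqrt u)"
proof (cases "1 \<le> u")
  case True
  have "(1 + \<bar>ln u\<bar>) ^ k \<le> 1 * (fact k * exp 1 * u)" using ln_power_le[OF True, of k] True by simp
  also have "\<dots> \<le> 2 ^ k * (fact k * exp 1 * u)" using True by (intro mult_right_mono) auto
  also have "\<dots> \<le> 2 ^ k * fact k * exp 1 * (u + 1 / sqrt u)"
    using True by (simp add: algebra_simps)
  finally show ?thesis .
next
  case False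
  define y where "y = 1 / sqrt u"
  have y: "1 \<le> y" using False assms by (simp add: y_def)
  have "ln u = - 2 * ln y" using assms by (simp add: y_def ln_div ln_sqrt)
  then have "\<bar>ln u\<bar> = 2 * ln y" using y by simp
  then have "(1 + \<bar>ln u\<bar>) ^ k \<le> (2 * (1 + ln y)) ^ k" using y by (intro power_mono) auto
  also have "\<dots> = 2 ^ k * (1 + ln y) ^ k" by (rule power_mult_distrib)
  also have "\<dots> \<le> 2 ^ k * (fact k * exp 1 * y)" by (intro mult_left_mono ln_power_le y) simp
  also have "\<dots> \<le> 2 ^ k * fact k * exp 1 * (u + 1 / sqrt u)"
    using assms by (simp add: y_def algebra_simps)
  finally show ?thesis .
qed

lemma nn_integral_has_integral_Ioo:
  assumes "\<And>t. t \<in> {a..b} \<Longrightarrow> 0 \<le> f t" "(f has_integral I) {a..b::real}"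
  shows "(\<integral>\<^sup>+t\<in>{a<..<b}. ennreal (f t) \<partial>lborel) = ennreal I"
  by (rule nn_integral_has_integral_lebesgue') (use assms in \<open>auto simp: has_integral_Icc_iff_Ioo\<close>)

lemma nn_integral_power:
  "(\<integral>\<^sup>+t\<in>{0<..<1}. ennreal (t ^ i) \<partial>lborel) = ennreal (1 / real (i + 1))"
proof (rule nn_integral_has_integral_Ioo)
  have "((\<lambda>t. t ^ i) has_integral 1 ^ (i + 1) / real (i + 1) - 0 ^ (i + 1) / real (i + 1)) {0..1::real}"
  proof (rule fundamental_theorem_of_calculus)
    fix t :: real
    have "((\<lambda>t. t ^ (i + 1) / real (i + 1)) has_real_derivative t ^ i) (at t within {0..1})"
      by (rule derivative_eq_intros refl | simp del: of_nat_Suc of_nat_add)+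
    then show "((\<lambda>t. t ^ (i + 1) / real (i + 1)) has_vector_derivative t ^ i) (at t within {0..1})"
      by (simp only: has_real_derivative_iff_has_vector_derivative)
  qed simp
  then show "((\<lambda>t. t ^ i) has_integral 1 / real (i + 1)) {0..1::real}" by simp
qed auto

text \<open>A Beta integral. The factor i + 2 is the scale n of the moment estimates: u = n (1 - t)
  has mean 1 under the normalised density t^i.\<close>

lemma nn_integral_power_diff:
  "(\<integral>\<^sup>+t\<in>{0<..<1}. ennreal (t ^ i * (real (i + 2) * (1 - t))) \<partial>lborel) = ennreal (1 / real (i + 1))"
proof (rule nn_integral_has_integral_Ioo)
  let ?F = "\<lambda>t::real. real (i + 2) * (t ^ (i + 1) / real (i + 1)) - t ^ (i + 2)"
  have "((\<lambda>t. t ^ i * (real (i + 2) * (1 - t))) has_integral ?F 1 - ?F 0) {0..1::real}"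
  proof (rule fundamental_theorem_of_calculus)
    fix t :: real
    have "(?F has_real_derivative real (i + 2) * t ^ i - real (i + 2) * t ^ (i + 1)) (at t within {0..1})"
      by (rule derivative_eq_intros refl | simp del: of_nat_Suc of_nat_add)+
    then show "(?F has_vector_derivative t ^ i * (real (i + 2) * (1 - t))) (at t within {0..1})"
      by (simp add: has_real_derivative_iff_has_vector_derivative[symmetric] algebra_simps)
  qed simp
  moreover have "?F 1 - ?F 0 = 1 / real (i + 1)" by (simp add: field_simps)
  ultimately show "((\<lambda>t. t ^ i * (real (i + 2) * (1 - t))) has_integral 1 / real (i + 1)) {0..1::real}"
    by simp
qed auto

text \<open>The interval is the part u < 1 for u = n (1 - t), the only place where 1/sqrt u matters.
  The antiderivative is merely continuous at t = 1, hence the interior form of the fundamental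
  theorem.\<close>

lemma nn_integral_inverse_sqrt:
  assumes n: "1 \<le> (n::real)"
  shows "(\<integral>\<^sup>+t\<in>{1 - 1/n<..<1}. ennreal (1 / sqrt (n * (1 - t))) \<partial>lborel) = ennreal (2 / n)"
proof (rule nn_integral_has_integral_Ioo)
  let ?F = "\<lambda>t. - (2 / n) * sqrt (n * (1 - t))"
  have "((\<lambda>t. 1 / sqrt (n * (1 - t))) has_integral ?F 1 - ?F (1 - 1/n)) {1 - 1/n..1}"
  proof (rule fundamental_theorem_of_calculus_interior)
    fix t assume t: "t \<in> {1 - 1/n<..<1}"
    then have "n * (1 - t) > 0" using n by simp
    then have "(?F has_real_derivative 1 / sqrt (n * (1 - t))) (at t)"
      using n by (auto intro!: derivative_eq_intros simp: field_simps)
    then show "(?F has_vector_derivative 1 / sqrt (n * (1 - t))) (at t)"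
      by (simp add: has_real_derivative_iff_has_vector_derivative)
  next
    show "continuous_on {1 - 1/n..1} ?F" by (intro continuous_intros)
  qed (use n in auto)
  then show "((\<lambda>t. 1 / sqrt (n * (1 - t))) has_integral 2 / n) {1 - 1/n..1}"
    using n by simp
qed (use n in auto)

lemma moment_mono:
  assumes "\<And>t. 0 < t \<Longrightarrow> t < 1 \<Longrightarrow> om t \<le> om' t"
  shows "moment om i \<le> moment om' i"
  unfolding moment_def
  by (intro nn_integral_mono) (auto intro!: ennreal_leI mult_left_mono assms split: split_indicator)

text \<open>With n = i + 2 and u = n (1 - t), the integral of t^i u is 1/(i+1). The term t^i / sqrt
  u is at most t^i where u >= 1, and at most 1/sqrt u where u < 1, giving 1/(i+1) and 2/n.\<close>

lemma moment_upper:
  assumes om: "\<And>t. 0 < t \<Longrightarrow> t < 1 \<Longrightarrow>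
      om t \<le> M * (real (i + 2) * (1 - t) + 1 / sqrt (real (i + 2) * (1 - t)))"
    and M: "0 \<le> M"
  shows "moment om i \<le> ennreal (4 * M / real (i + 1))"
proof -
  let ?n = "real (i + 2)"
  let ?A = "\<lambda>t. ennreal (t ^ i * (?n * (1 - t))) * indicator {0<..<1::real} t"
  let ?B = "\<lambda>t. ennreal (t ^ i) * indicator {0<..<1::real} t"
  let ?C = "\<lambda>t. ennreal (1 / sqrt (?n * (1 - t))) * indicator {1 - 1/?n<..<1} t"
  have "moment om i \<le> (\<integral>\<^sup>+t. ennreal M * (?A t + (?B t + ?C t)) \<partial>lborel)"
    unfolding moment_def
  proof (rule nn_integral_mono)
    fix t :: real
    show "ennreal (t ^ i * om t) * indicator {0<..<1} t \<le> ennreal M * (?A t + (?B t + ?C t))"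
    proof (cases "0 < t \<and> t < 1")
      case True
      define u where "u = ?n * (1 - t)"
      have u: "0 < u" using True by (simp add: u_def)
      have ti: "0 \<le> t ^ i" "t ^ i \<le> 1" using True by (auto intro: power_le_one)
      have I: "indicator {0<..<1::real} t = (1::ennreal)" using True by simp
      have "t ^ i * om t \<le> t ^ i * (M * (u + 1 / sqrt u))"
        using om[of t] True unfolding u_def by (intro mult_left_mono) auto
      then have "ennreal (t ^ i * om t) \<le> ennreal (M * (t ^ i * u + t ^ i * (1 / sqrt u)))"
        by (intro ennreal_leI) (simp add: algebra_simps)
      also have "\<dots> = ennreal M * (ennreal (t ^ i * u) + ennreal (t ^ i * (1 / sqrt u)))"
        using M u ti by (simp add: ennreal_mult ennreal_plus)
      also have "ennreal (t ^ i * (1 / sqrt u)) \<le> ennreal (t ^ i) + ennreal (1 / sqrt u) * indicator {1 - 1/?n<..<1} t"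
      proof (cases "1 - 1/?n < t")
        case t: True
        have "t ^ i * (1 / sqrt u) \<le> 1 * (1 / sqrt u)" using ti u by (intro mult_right_mono) auto
        then have "ennreal (t ^ i * (1 / sqrt u)) \<le> ennreal (1 / sqrt u)" by (intro ennreal_leI) simp
        then show ?thesis using t True by (simp add: add_increasing)
      next
        case False
        then have "1 / ?n \<le> 1 - t" by simp
        then have "1 \<le> u" unfolding u_def by (simp add: field_simps)
        then have "1 / sqrt u \<le> 1" by simp
        then have "t ^ i * (1 / sqrt u) \<le> t ^ i * 1" using ti by (intro mult_left_mono) auto
        then have "ennreal (t ^ i * (1 / sqrt u)) \<le> ennreal (t ^ i)" by (intro ennreal_leI) simp
        then show ?thesis by (simp add: add_increasing2)
      qed
      finally show ?thesis unfolding I u_def by (simp add: mult_left_mono add_left_mono)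
    qed auto
  qed
  also have "\<dots> = ennreal M * (ennreal (1 / real (i + 1)) + (ennreal (1 / real (i + 1)) + ennreal (2 / ?n)))"
    using nn_integral_power[of i] nn_integral_power_diff[of i] nn_integral_inverse_sqrt[of ?n]
    by (simp add: nn_integral_cmult nn_integral_add del: of_nat_add)
  also have "\<dots> = ennreal (M * (1 / real (i + 1) + (1 / real (i + 1) + 2 / ?n)))"
    using M by (simp add: ennreal_mult ennreal_plus[symmetric] del: ennreal_plus)
  also have "\<dots> \<le> ennreal (4 * M / real (i + 1))"
  proof (rule ennreal_leI)
    have "2 / ?n \<le> 2 / real (i + 1)" by (intro divide_left_mono) auto
    then have "1 / real (i + 1) + (1 / real (i + 1) + 2 / ?n) \<le> 4 / real (i + 1)"
      by (simp add: add_divide_distrib[symmetric])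
    from mult_left_mono[OF this M] show "M * (1 / real (i + 1) + (1 / real (i + 1) + 2 / ?n)) \<le> 4 * M / real (i + 1)"
      by simp
  qed
  finally show ?thesis .
qed

text \<open>The moment is bounded below by its part over 1/4 <= n (1 - t) <= 1/2, n = i + 2. This
  interval has length 1/(4n), and t^i >= 1/2 on it by Bernoulli's inequality.\<close>

lemma moment_lower:
  assumes om: "\<And>t. 1 - 1 / (2 * real (i + 2)) \<le> t \<Longrightarrow> t \<le> 1 - 1 / (4 * real (i + 2)) \<Longrightarrow> c \<le> om t"
    and c: "0 \<le> c"
  shows "ennreal (c / (8 * real (i + 2))) \<le> moment om i"
proof -
  let ?n = "real (i + 2)"
  let ?I = "{1 - 1 / (2 * ?n)..1 - 1 / (4 * ?n)}"
  have "ennreal (c / (8 * ?n)) = (\<integral>\<^sup>+t. ennreal (c / 2) * indicator ?I t \<partial>lborel)"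
  proof -
    have "1 - 1 / (2 * n) \<le> 1 - 1 / (4 * n)" "1 - 1 / (4 * n) - (1 - 1 / (2 * n)) = 1 / (4 * n)"
      if "0 < n" for n :: real using that by (auto simp: field_simps)
    from this[of ?n] have "emeasure lborel ?I = ennreal (1 / (4 * ?n))" by simp
    then show ?thesis using c
      by (simp add: nn_integral_cmult_indicator ennreal_mult[symmetric] del: of_nat_add emeasure_lborel_Icc)
  qed
  also have "\<dots> \<le> moment om i"
    unfolding moment_def
  proof (rule nn_integral_mono)
    fix t :: real
    show "ennreal (c / 2) * indicator ?I t \<le> ennreal (t ^ i * om t) * indicator {0<..<1} t"
    proof (cases "t \<in> ?I")
      case True
      define s where "s = 1 / (2 * ?n)"
      have s: "0 \<le> s" "s \<le> 1/4" "real i * s \<le> 1/2" by (auto simp: s_def field_simps)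
      have ts: "1 - s \<le> t" using True by (simp add: s_def)
      have "1 / (4 * ?n) > 0" "t \<le> 1 - 1 / (4 * ?n)" using True by auto
      then have t: "0 < t" "t < 1" using s(2) ts by linarith+
      have "1 / 2 \<le> 1 - real i * s" using s by simp
      also have "\<dots> \<le> (1 - s) ^ i" using Bernoulli_inequality[of "-s" i] s by simp
      also have "\<dots> \<le> t ^ i" using ts s by (intro power_mono) auto
      finally have "1 / 2 \<le> t ^ i" .
      then have "1 / 2 * c \<le> t ^ i * om t"
        using om[of t] True c t by (intro mult_mono) auto
      then have "ennreal (c / 2) \<le> ennreal (t ^ i * om t)" by (intro ennreal_leI) simp
      then show ?thesis using True t by simp
    qed auto
  qed
  finally show ?thesis .
qed

lemma ln_exp_div:
  assumes "t < (1::real)"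
  shows "ln (exp 1 / (1 - t)) = 1 + ln (1 / (1 - t))"
  using assms by (simp add: ln_div)

lemma ln_weight_nonneg:
  assumes "0 \<le> t" "t < (1::real)"
  shows "0 \<le> ln (1 / (1 - t))"
  using assms by (intro ln_ge_zero) (simp add: field_simps)

text \<open>Since ln(n (1 - t)) = ln n - ln(1/(1 - t)), the two logarithms differ by the absolute
  value of the left side; 1 + a + b <= (1 + a)(1 + b) turns this into a ratio bound.\<close>

lemma ln_weight_compare:
  fixes t n :: real
  assumes "0 < t" "t < 1" "1 \<le> n"
  shows "ln (exp 1 / (1 - t)) \<le> (1 + ln n) * (1 + \<bar>ln (n * (1 - t))\<bar>)"
    and "1 + ln n \<le> ln (exp 1 / (1 - t)) * (1 + \<bar>ln (n * (1 - t))\<bar>)"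
proof -
  let ?u = "ln (n * (1 - t))" and ?L = "ln (1 / (1 - t))"
  have u: "?u = ln n - ?L" using assms by (simp add: ln_mult ln_div)
  have L: "0 \<le> ?L" using ln_weight_nonneg[of t] assms by simp
  have n: "0 \<le> ln n" using assms by simp
  have "1 + ?L \<le> 1 + ln n + \<bar>?u\<bar>" unfolding u by simp
  also have "\<dots> \<le> (1 + ln n) * (1 + \<bar>?u\<bar>)" using mult_nonneg_nonneg[OF n abs_ge_zero[of ?u]] by (simp add: algebra_simps)
  finally show "ln (exp 1 / (1 - t)) \<le> (1 + ln n) * (1 + \<bar>?u\<bar>)" using assms by (simp add: ln_exp_div)
  have "1 + ln n \<le> 1 + ?L + \<bar>?u\<bar>" unfolding u by simp
  also have "\<dots> \<le> (1 + ?L) * (1 + \<bar>?u\<bar>)" using mult_nonneg_nonneg[OF L abs_ge_zero[of ?u]] by (simp add: algebra_simps)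
  finally show "1 + ln n \<le> ln (exp 1 / (1 - t)) * (1 + \<bar>?u\<bar>)" using assms by (simp add: ln_exp_div)
qed

lemma moment_log_upper:
  "moment (\<lambda>t. ln (exp 1 / (1 - t)) ^ k) i
    \<le> ennreal (4 * (2 ^ k * fact k * exp 1) * (1 + ln (real (i + 2))) ^ k / real (i + 1))"
proof -
  let ?M = "2 ^ k * fact k * exp 1 :: real"
  let ?n = "real (i + 2)"
  have "moment (\<lambda>t. ln (exp 1 / (1 - t)) ^ k) i \<le> ennreal (4 * (?M * (1 + ln ?n) ^ k) / real (i + 1))"
  proof (rule moment_upper)
    fix t :: real assume t: "0 < t" "t < 1"
    let ?u = "?n * (1 - t)"
    have u: "0 < ?u" using t by simp
    have "ln (exp 1 / (1 - t)) ^ k \<le> ((1 + ln ?n) * (1 + \<bar>ln ?u\<bar>)) ^ k"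
      using ln_weight_compare(1)[OF t, of ?n] ln_weight_nonneg[of t] t
      by (intro power_mono) (auto simp: ln_exp_div)
    also have "\<dots> = (1 + ln ?n) ^ k * (1 + \<bar>ln ?u\<bar>) ^ k" by (rule power_mult_distrib)
    also have "\<dots> \<le> (1 + ln ?n) ^ k * (?M * (?u + 1 / sqrt ?u))"
      by (intro mult_left_mono abs_ln_power_le u) simp
    finally show "ln (exp 1 / (1 - t)) ^ k \<le> ?M * (1 + ln ?n) ^ k * (?u + 1 / sqrt ?u)"
      by (simp only: mult_ac)
  qed simp
  then show ?thesis by (simp only: mult.assoc)
qed

lemma moment_inverse_log_upper:
  "moment (\<lambda>t. 1 / ln (exp 1 / (1 - t)) ^ k) i
    \<le> ennreal (4 * (2 ^ k * fact k * exp 1) * (1 / (1 + ln (real (i + 2))) ^ k) / real (i + 1))"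
proof -
  let ?M = "2 ^ k * fact k * exp 1 :: real"
  let ?n = "real (i + 2)"
  have "moment (\<lambda>t. 1 / ln (exp 1 / (1 - t)) ^ k) i \<le> ennreal (4 * (?M * (1 / (1 + ln ?n) ^ k)) / real (i + 1))"
  proof (rule moment_upper)
    fix t :: real assume t: "0 < t" "t < 1"
    let ?u = "?n * (1 - t)" and ?L = "ln (exp 1 / (1 - t))"
    have u: "0 < ?u" using t by simp
    have L: "0 < ?L" using ln_weight_nonneg[of t] ln_exp_div[of t] t by linarith
    have n: "0 < 1 + ln ?n" by (simp add: add_pos_nonneg)
    have "(1 + ln ?n) ^ k \<le> (?L * (1 + \<bar>ln ?u\<bar>)) ^ k"
      using ln_weight_compare(2)[OF t, of ?n] n by (intro power_mono) auto
    also have "\<dots> = ?L ^ k * (1 + \<bar>ln ?u\<bar>) ^ k" by (rule power_mult_distrib)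
    also have "\<dots> \<le> ?L ^ k * (?M * (?u + 1 / sqrt ?u))"
      using L by (intro mult_left_mono abs_ln_power_le u) simp
    finally have *: "(1 + ln ?n) ^ k \<le> ?L ^ k * (?M * (?u + 1 / sqrt ?u))" .
    have pos: "0 < ?L ^ k" "0 < (1 + ln ?n) ^ k" using L n by simp_all
    have "1 / a \<le> M * (1 / b) * v" if "b \<le> a * (M * v)" "0 < a" "0 < b" for a b M v :: real
      using that by (simp add: field_simps)
    from this[OF * pos] show "1 / ?L ^ k \<le> ?M * (1 / (1 + ln ?n) ^ k) * (?u + 1 / sqrt ?u)" .
  qed (simp add: add_nonneg_nonneg)
  then show ?thesis by (simp only: mult.assoc)
qed

text \<open>On the window 1 - t <= 1/(2n), n = i + 2, the logarithm is at least ln 2 + ln n, and ln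
  2 >= 1/2 gives at least (1 + ln n)/2.\<close>

lemma moment_log_lower:
  "ennreal (1 / (8 * 2 ^ k) * (1 + ln (real (i + 2))) ^ k / real (i + 2)) \<le> moment (\<lambda>t. ln (1 / (1 - t)) ^ k) i"
proof -
  let ?n = "real (i + 2)"
  have "ennreal (((1 + ln ?n) / 2) ^ k / (8 * ?n)) \<le> moment (\<lambda>t. ln (1 / (1 - t)) ^ k) i"
  proof (rule moment_lower)
    fix t assume t: "1 - 1 / (2 * ?n) \<le> t" "t \<le> 1 - 1 / (4 * ?n)"
    have "0 < 1 / (4 * ?n)" by simp
    then have s: "0 < 1 - t" using t by linarith
    have "1 - t \<le> 1 / (2 * ?n)" using t by simp
    then have "2 * ?n \<le> 1 / (1 - t)" using s by (simp add: field_simps)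
    then have "ln (2 * ?n) \<le> ln (1 / (1 - t))" using s by (subst ln_le_cancel_iff) auto
    moreover have "ln (2 * ?n) = ln 2 + ln ?n" by (rule ln_mult_pos) auto
    moreover have "1 / 2 \<le> ln (2::real)" using ln_add_one_self_le_self2 ln2_ge_two_thirds by simp
    moreover have "0 \<le> ln ?n" by simp
    ultimately have "(1 + ln ?n) / 2 \<le> ln (1 / (1 - t))" by argo
    then show "((1 + ln ?n) / 2) ^ k \<le> ln (1 / (1 - t)) ^ k" by (intro power_mono) auto
  qed simp
  moreover have "((1 + ln ?n) / 2) ^ k / (8 * ?n) = 1 / (8 * 2 ^ k) * (1 + ln ?n) ^ k / ?n"
    by (simp add: power_divide algebra_simps)
  ultimately show ?thesis by (simp only:)
qed

text \<open>On the window 1 - t >= 1/(4n), n = i + 2, the regularised logarithm is at most 1 + ln 4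
  + ln n, and ln 4 <= 2 gives at most 3 (1 + ln n).\<close>

lemma moment_inverse_log_lower:
  "ennreal (1 / (8 * 3 ^ k) * (1 / (1 + ln (real (i + 2))) ^ k) / real (i + 2))
    \<le> moment (\<lambda>t. 1 / ln (exp 1 / (1 - t)) ^ k) i"
proof -
  let ?n = "real (i + 2)"
  have n: "0 \<le> ln ?n" by simp
  have "ennreal (1 / (3 * (1 + ln ?n)) ^ k / (8 * ?n)) \<le> moment (\<lambda>t. 1 / ln (exp 1 / (1 - t)) ^ k) i"
  proof (rule moment_lower)
    fix t assume t: "1 - 1 / (2 * ?n) \<le> t" "t \<le> 1 - 1 / (4 * ?n)"
    have "0 < 1 / (4 * ?n)" "1 / (2 * ?n) \<le> 1" by simp_all
    then have s: "0 < 1 - t" "0 \<le> t" using t by linarith+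
    have "1 / (4 * ?n) \<le> 1 - t" using t by simp
    then have "1 / (1 - t) \<le> 4 * ?n" using s by (simp add: field_simps)
    then have "ln (1 / (1 - t)) \<le> ln (4 * ?n)" using s by (subst ln_le_cancel_iff) auto
    moreover have "ln (4 * ?n) = ln 4 + ln ?n" by (rule ln_mult_pos) auto
    moreover have "ln (4::real) \<le> 2"
    proof -
      have "ln (4::real) = ln (2 * 2)" by simp
      also have "\<dots> = ln 2 + ln 2" by (rule ln_mult_pos) auto
      finally show ?thesis using ln_add_one_self_le_self[of "1::real"] by simp
    qed
    moreover have eq: "ln (exp 1 / (1 - t)) = 1 + ln (1 / (1 - t))" using s by (intro ln_exp_div) simp
    moreover have "E \<le> 3 * (1 + b)" if "x \<le> y" "y = a + b" "a \<le> 2" "E = 1 + x" "0 \<le> b" for x y a b E :: real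
      using that by simp
    ultimately have "ln (exp 1 / (1 - t)) \<le> 3 * (1 + ln ?n)" using n by blast
    moreover have "0 < ln (exp 1 / (1 - t))"
      unfolding eq by (intro add_pos_nonneg ln_weight_nonneg) (use s in auto)
    ultimately show "1 / (3 * (1 + ln ?n)) ^ k \<le> 1 / ln (exp 1 / (1 - t)) ^ k"
      using n by (intro divide_left_mono power_mono) auto
  qed (use n in simp)
  moreover have "1 / (3 * (1 + ln ?n)) ^ k / (8 * ?n) = 1 / (8 * 3 ^ k) * (1 / (1 + ln ?n) ^ k) / ?n"
    by (simp only: power_mult_distrib) (simp add: algebra_simps)
  ultimately show ?thesis by (simp only:)
qed

text \<open>With \<open>L = ln (1 / (1 - t)) \<ge> t\<close> one has \<open>t * (1 + L) \<le> 2 * L\<close>, which costs \<open>k\<close> powers of \<open>t\<close>.\<close>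

lemma moment_inverse_log_singular_upper:
  assumes i: "k \<le> i"
  shows "moment (\<lambda>t. 1 / ln (1 / (1 - t)) ^ k) i
    \<le> ennreal (2 ^ k * (4 * (2 ^ k * fact k * exp 1)) * (real (k + 1) * (1 + ln (real (k + 1))) ^ k)
        * (1 / (1 + ln (real (i + 2))) ^ k) / real (i + 1))"
proof -
  let ?M = "4 * (2 ^ k * fact k * exp 1) :: real"
  have "moment (\<lambda>t. 1 / ln (1 / (1 - t)) ^ k) i \<le> ennreal (2 ^ k) * moment (\<lambda>t. 1 / ln (exp 1 / (1 - t)) ^ k) (i - k)"
    unfolding moment_def
  proof (subst nn_integral_cmult[symmetric], measurable, rule nn_integral_mono)
    fix t :: real
    show "ennreal (t ^ i * (1 / ln (1 / (1 - t)) ^ k)) * indicator {0<..<1} t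
      \<le> ennreal (2 ^ k) * (ennreal (t ^ (i - k) * (1 / ln (exp 1 / (1 - t)) ^ k)) * indicator {0<..<1} t)"
    proof (cases "0 < t \<and> t < 1")
      case True
      let ?L = "ln (1 / (1 - t))"
      have "ln (1 - t) \<le> - t" using ln_le_minus_one[of "1 - t"] True by simp
      then have L: "t \<le> ?L" using True by (simp add: ln_div)
      then have L0: "0 < ?L" using True by linarith
      have "t * ?L \<le> 1 * ?L" using True L0 by (intro mult_right_mono) auto
      then have "t * (1 + ?L) \<le> 2 * ?L" using L by (simp add: algebra_simps)
      then have "(t * (1 + ?L)) ^ k \<le> (2 * ?L) ^ k" using True L0 by (intro power_mono) auto
      then have *: "t ^ k * (1 + ?L) ^ k \<le> 2 ^ k * ?L ^ k" by (simp only: power_mult_distrib)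
      have pos: "0 < ?L ^ k" "0 < (1 + ?L) ^ k" using L0 by simp_all
      have "a * (1 / b) \<le> c * (1 / e)" if "a * e \<le> c * b" "0 < b" "0 < e" for a b c e :: real
        using that by (simp add: field_simps)
      from this[OF * pos] have "t ^ (i - k) * (t ^ k * (1 / ?L ^ k)) \<le> t ^ (i - k) * (2 ^ k * (1 / (1 + ?L) ^ k))"
        using True by (intro mult_left_mono) auto
      moreover have "t ^ (i - k) * t ^ k = t ^ i" using i by (simp add: power_add[symmetric])
      ultimately have "t ^ i * (1 / ?L ^ k) \<le> 2 ^ k * (t ^ (i - k) * (1 / ln (exp 1 / (1 - t)) ^ k))"
        using True by (simp add: ln_exp_div mult_ac flip: mult.assoc)
      then show ?thesis using True
        by (subst mult.assoc[symmetric], subst ennreal_mult'[symmetric]) (auto intro!: ennreal_leI)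
    qed auto
  qed
  also have "\<dots> \<le> ennreal (2 ^ k) * ennreal (?M * (1 / (1 + ln (real (i - k + 2))) ^ k) / real (i - k + 1))"
    by (intro mult_left_mono moment_inverse_log_upper) simp
  also have "\<dots> = ennreal (2 ^ k * (?M * (1 / (1 + ln (real (i - k + 2))) ^ k) / real (i - k + 1)))"
    by (rule ennreal_mult'[symmetric]) simp
  also have "\<dots> \<le> ennreal (2 ^ k * ?M * (real (k + 1) * (1 + ln (real (k + 1))) ^ k)
        * (1 / (1 + ln (real (i + 2))) ^ k) / real (i + 1))"
  proof (rule ennreal_leI)
    \<comment> \<open>The estimate is now at index m = i - k and has to return to i. The
      inequalities i + 2 <= (k+1)(m+2) and i + 1 <= (k+1)(m+1) make the loss a constant depending on
      k only.\<close>
    define m where "m = i - k"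
    have im: "i = m + k" using i by (simp add: m_def)
    let ?a = "1 + ln (real (m + 2))" and ?b = "1 + ln (real (i + 2))" and ?c = "1 + ln (real (k + 1))"
    have nn: "0 \<le> ln (real (m + 2))" "0 \<le> ln (real (k + 1))" "0 \<le> ln (real (i + 2))" by simp_all
    have "real (i + 2) \<le> real (k + 1) * real (m + 2)" by (simp add: im algebra_simps)
    then have "ln (real (i + 2)) \<le> ln (real (k + 1) * real (m + 2))" by (subst ln_le_cancel_iff) auto
    also have "\<dots> = ln (real (k + 1)) + ln (real (m + 2))" by (rule ln_mult_pos) auto
    finally have "ln (real (i + 2)) \<le> ln (real (k + 1)) + ln (real (m + 2))" .
    moreover have "1 + x \<le> (1 + c) * (1 + a)" if "x \<le> c + a" "0 \<le> c" "0 \<le> a" for x a c :: real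
      using that mult_nonneg_nonneg[of c a] unfolding distrib_left distrib_right by linarith
    ultimately have "?b \<le> ?c * ?a" using nn by blast
    then have "?b ^ k \<le> (?c * ?a) ^ k" using nn by (intro power_mono) auto
    then have 1: "?b ^ k \<le> ?c ^ k * ?a ^ k" by (simp only: power_mult_distrib)
    have 2: "real (i + 1) \<le> real (k + 1) * real (m + 1)" by (simp add: im algebra_simps)
    have pos: "0 < ?a ^ k" "0 < ?b ^ k" "0 < real (m + 1)" "0 < real (i + 1)" "0 < ?M"
      using nn by (auto intro!: zero_less_power add_pos_nonneg)
    have prod: "?b ^ k * real (i + 1) \<le> (?c ^ k * ?a ^ k) * (real (k + 1) * real (m + 1))"
      using 1 2 nn by (intro mult_mono) auto
    have "P * (M * (1 / a) / x) \<le> P * M * (K * c) * (1 / b) / y"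
      if "b * y \<le> (c * a) * (K * x)" "0 < a" "0 < b" "0 < x" "0 < y" "0 < M" "0 < P" for a b c x y K M P :: real
    proof -
      have "1 / (a * x) \<le> (K * c) / (b * y)" using that by (simp add: field_simps)
      from mult_left_mono[OF this, of "P * M"] that show ?thesis by simp
    qed
    from this[OF prod pos, of "2 ^ k"]
    show "2 ^ k * (?M * (1 / (1 + ln (real (i - k + 2))) ^ k) / real (i - k + 1))
      \<le> 2 ^ k * ?M * (real (k + 1) * (1 + ln (real (k + 1))) ^ k) * (1 / (1 + ln (real (i + 2))) ^ k) / real (i + 1)"
      unfolding m_def by simp
  qed
  finally show ?thesis .
qed

text \<open>\<open>v\<close> is the profile of the moments, normalised by \<open>v 0 = 1\<close> to
  match the separate value of \<open>area_weight\<close> at 0.\<close>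

lemma area_weight_upper:
  assumes "1 \<le> C" "0 < v j" "v 0 = 1" "j \<noteq> 0 \<Longrightarrow> moment om (j - 1) \<le> ennreal (C * v j / real j)"
  shows "area_weight om j \<le> ennreal (C * (real (j + 1) * v j))"
proof (cases "j = 0")
  case True
  then show ?thesis using assms(1,3) by (simp add: area_weight_def)
next
  case False
  have "area_weight om j \<le> ennreal ((real j)\<^sup>2) * ennreal (C * v j / real j)"
    using False assms(4) by (simp add: area_weight_def mult_left_mono)
  also have "\<dots> = ennreal ((real j)\<^sup>2 * (C * v j / real j))" by (rule ennreal_mult'[symmetric]) simp
  also have "\<dots> \<le> ennreal (C * (real (j + 1) * v j))"
    using False assms(1,2) by (intro ennreal_leI) (simp add: power2_eq_square field_simps)
  finally show ?thesis .
qed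

text \<open>Since j + 1 <= 2j for j >= 1, replacing j^2/(j + 1) by j + 1 costs the factor 4.\<close>

lemma area_weight_lower:
  assumes "0 < c" "c \<le> 1" "0 < v j" "v 0 = 1" "j \<noteq> 0 \<Longrightarrow> ennreal (c * v j / real (j + 1)) \<le> moment om (j - 1)"
  shows "ennreal (real (j + 1) * v j) \<le> ennreal (4 / c) * area_weight om j"
proof (cases "j = 0")
  case True
  have "1 \<le> 4 / c" using assms(1,2) by (simp add: field_simps)
  then have "ennreal 1 \<le> ennreal (4 / c)" by (rule ennreal_leI)
  then show ?thesis using True assms(4) by (simp add: area_weight_def)
next
  case False
  then have "j + 1 \<le> 2 * j" by simp
  then have "real (j + 1) \<le> 2 * real j" by linarith
  then have "(real (j + 1))\<^sup>2 \<le> (2 * real j)\<^sup>2" by (intro power_mono) auto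
  then have "real (j + 1) \<le> 4 * ((real j)\<^sup>2 / real (j + 1))"
    by (simp add: pos_le_divide_eq power2_eq_square)
  from mult_right_mono[OF this, of "v j"]
  have "real (j + 1) * v j \<le> 4 / c * ((real j)\<^sup>2 * (c * v j / real (j + 1)))"
    using assms(1,3) by (simp add: mult_ac)
  then have "ennreal (real (j + 1) * v j) \<le> ennreal (4 / c * ((real j)\<^sup>2 * (c * v j / real (j + 1))))"
    by (rule ennreal_leI)
  also have "\<dots> = ennreal (4 / c) * (ennreal ((real j)\<^sup>2) * ennreal (c * v j / real (j + 1)))"
    by (subst ennreal_mult', use assms(1) in simp, subst ennreal_mult') simp_all
  also have "\<dots> \<le> ennreal (4 / c) * area_weight om j"
    using False assms(5) by (simp add: area_weight_def mult_left_mono)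
  finally show ?thesis .
qed

text \<open>The moment of index j - 1 has scale n = j + 1 and yields 1 + ln(j + 1), while the
  coefficient norms use ln(j + 2). Both are positive from j = 0 on and differ by at most a factor
  3.\<close>

lemma ln_shift_bounds:
  "ln (real (j + 2)) \<le> 1 + ln (real (j + 1))" "1 + ln (real (j + 1)) \<le> 3 * ln (real (j + 2))"
proof -
  have "ln (real (j + 2)) \<le> ln (2 * real (j + 1))" by (subst ln_le_cancel_iff) auto
  also have "\<dots> = ln 2 + ln (real (j + 1))" by (rule ln_mult_pos) auto
  also have "\<dots> \<le> 1 + ln (real (j + 1))" using ln_add_one_self_le_self[of "1::real"] by simp
  finally show "ln (real (j + 2)) \<le> 1 + ln (real (j + 1))" .
  have "1 / 2 \<le> ln (2::real)" using ln2_ge_two_thirds by simp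
  also have "\<dots> \<le> ln (real (j + 2))" by simp
  finally have "1 \<le> 2 * ln (real (j + 2))" by simp
  moreover have "ln (real (j + 1)) \<le> ln (real (j + 2))" by simp
  ultimately show "1 + ln (real (j + 1)) \<le> 3 * ln (real (j + 2))" by linarith
qed

lemma ln_shift_power_bounds:
  "ln (real (j + 2)) ^ k \<le> (1 + ln (real (j + 1))) ^ k"
  "(1 + ln (real (j + 1))) ^ k \<le> 3 ^ k * ln (real (j + 2)) ^ k"
proof -
  show "ln (real (j + 2)) ^ k \<le> (1 + ln (real (j + 1))) ^ k"
    by (rule power_mono[OF ln_shift_bounds(1)]) simp
  have "(1 + ln (real (j + 1))) ^ k \<le> (3 * ln (real (j + 2))) ^ k"
    by (rule power_mono[OF ln_shift_bounds(2)]) simp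
  then show "(1 + ln (real (j + 1))) ^ k \<le> 3 ^ k * ln (real (j + 2)) ^ k"
    by (simp only: power_mult_distrib)
qed

lemma one_le_weight_const: "1 \<le> 4 * (2 ^ k * fact k * exp (1::real))"
proof -
  have f: "1 \<le> (fact k :: real)" by (rule fact_ge_1)
  have "1 * 1 * 1 \<le> 2 ^ k * fact k * exp (1::real)"
    by (intro mult_mono f) auto
  then show ?thesis by simp
qed

text \<open>The upper bound is inherited from the larger weight with e/(1 - t) in the logarithm; the
  lower bound concerns t near 1, where the unshifted logarithm is already large enough.\<close>

lemma area_weight_log:
  "\<exists>C>0. \<forall>j. area_weight (\<lambda>t. ln (1 / (1 - t)) ^ k) j \<le> ennreal C * ennreal (real (j + 1) * ln (real (j + 2)) ^ k)
     \<and> ennreal (real (j + 1) * ln (real (j + 2)) ^ k) \<le> ennreal C * area_weight (\<lambda>t. ln (1 / (1 - t)) ^ k) j"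
proof -
  let ?om = "\<lambda>t. ln (1 / (1 - t)) ^ k"
  let ?v = "\<lambda>j. (1 + ln (real (j + 1))) ^ k"
  let ?C = "4 * (2 ^ k * fact k * exp 1) :: real"
  have v: "0 < ?v j" for j by (simp add: add_pos_nonneg)
  have up: "area_weight ?om j \<le> ennreal (?C * (real (j + 1) * ?v j))" for j
  proof (rule area_weight_upper[where v = ?v, OF one_le_weight_const v])
    assume j: "j \<noteq> 0"
    have "moment ?om (j - 1) \<le> moment (\<lambda>t. ln (exp 1 / (1 - t)) ^ k) (j - 1)"
      by (rule moment_mono, rule power_mono) (auto simp: ln_exp_div ln_weight_nonneg)
    also have "\<dots> \<le> ennreal (?C * ?v j / real j)"
      using moment_log_upper[of k "j - 1"] j by (simp add: add_ac)
    finally show "moment ?om (j - 1) \<le> ennreal (?C * ?v j / real j)" .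
  qed simp
  have low: "ennreal (real (j + 1) * ?v j) \<le> ennreal (4 / (1 / (8 * 2 ^ k))) * area_weight ?om j" for j
  proof (rule area_weight_lower[where v = ?v, OF _ _ v])
    have "1 * 1 \<le> 8 * (2::real) ^ k" by (intro mult_mono one_le_power) auto
    then show "1 / (8 * 2 ^ k) \<le> (1::real)" by simp
    assume j: "j \<noteq> 0"
    then show "ennreal (1 / (8 * 2 ^ k) * ?v j / real (j + 1)) \<le> moment ?om (j - 1)"
      using moment_log_lower[of k "j - 1"] by (simp add: add_ac)
  qed simp_all
  show ?thesis
  proof (intro exI[of _ "?C * 3 ^ k + 4 / (1 / (8 * 2 ^ k))"] conjI allI)
    fix j
    have "area_weight ?om j \<le> ennreal (?C * (real (j + 1) * ?v j))" by (rule up)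
    also have "\<dots> \<le> ennreal ((?C * 3 ^ k + 4 / (1 / (8 * 2 ^ k))) * (real (j + 1) * ln (real (j + 2)) ^ k))"
    proof (rule ennreal_leI)
      have "?C * (real (j + 1) * ?v j) \<le> ?C * (real (j + 1) * (3 ^ k * ln (real (j + 2)) ^ k))"
        by (intro mult_left_mono ln_shift_power_bounds) auto
      also have "\<dots> \<le> (?C * 3 ^ k + 4 / (1 / (8 * 2 ^ k))) * (real (j + 1) * ln (real (j + 2)) ^ k)"
        by (simp only: distrib_right) simp
      finally show "?C * (real (j + 1) * ?v j)
        \<le> (?C * 3 ^ k + 4 / (1 / (8 * 2 ^ k))) * (real (j + 1) * ln (real (j + 2)) ^ k)" .
    qed
    also have "\<dots> = ennreal (?C * 3 ^ k + 4 / (1 / (8 * 2 ^ k))) * ennreal (real (j + 1) * ln (real (j + 2)) ^ k)"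
      by (rule ennreal_mult'') simp
    finally show "area_weight ?om j
      \<le> ennreal (?C * 3 ^ k + 4 / (1 / (8 * 2 ^ k))) * ennreal (real (j + 1) * ln (real (j + 2)) ^ k)" .
    have "ennreal (real (j + 1) * ln (real (j + 2)) ^ k) \<le> ennreal (real (j + 1) * ?v j)"
      by (intro ennreal_leI mult_left_mono ln_shift_power_bounds) simp
    also note low
    also have "ennreal (4 / (1 / (8 * 2 ^ k))) * area_weight ?om j
        \<le> ennreal (?C * 3 ^ k + 4 / (1 / (8 * 2 ^ k))) * area_weight ?om j"
      by (intro mult_right_mono ennreal_leI) auto
    finally show "ennreal (real (j + 1) * ln (real (j + 2)) ^ k)
      \<le> ennreal (?C * 3 ^ k + 4 / (1 / (8 * 2 ^ k))) * area_weight ?om j" .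
  qed (simp add: add_pos_pos)
qed

lemma inverse_ln_shift_power_bounds:
  "1 / (1 + ln (real (j + 1))) ^ k \<le> 1 / ln (real (j + 2)) ^ k"
  "1 / ln (real (j + 2)) ^ k \<le> 3 ^ k * (1 / (1 + ln (real (j + 1))) ^ k)"
proof -
  have pos: "0 < (1 + ln (real (j + 1))) ^ k" "0 < ln (real (j + 2)) ^ k"
    by (auto intro!: zero_less_power add_pos_nonneg)
  show "1 / (1 + ln (real (j + 1))) ^ k \<le> 1 / ln (real (j + 2)) ^ k"
    using pos by (intro divide_left_mono ln_shift_power_bounds) auto
  have "1 / b \<le> c * (1 / a)" if "a \<le> c * b" "0 < a" "0 < b" for a b c :: real
    using that by (simp add: field_simps)
  from this[OF ln_shift_power_bounds(2) pos]
  show "1 / ln (real (j + 2)) ^ k \<le> 3 ^ k * (1 / (1 + ln (real (j + 1))) ^ k)" .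
qed

lemma area_weight_inverse_log_upper:
  assumes C: "1 \<le> C"
    and "j \<noteq> 0 \<Longrightarrow> moment om (j - 1) \<le> ennreal (C * (1 / (1 + ln (real (j + 1))) ^ k) / real j)"
  shows "area_weight om j \<le> ennreal C * ennreal (real (j + 1) / ln (real (j + 2)) ^ k)"
proof -
  let ?v = "\<lambda>j. 1 / (1 + ln (real (j + 1))) ^ k"
  have "area_weight om j \<le> ennreal (C * (real (j + 1) * ?v j))"
    by (rule area_weight_upper[where v = ?v, OF C _ _ assms(2)])
       (auto intro!: zero_less_divide_iff[THEN iffD2] zero_less_power add_pos_nonneg)
  also have "\<dots> \<le> ennreal (C * (real (j + 1) * (1 / ln (real (j + 2)) ^ k)))"
    using C by (intro ennreal_leI mult_left_mono inverse_ln_shift_power_bounds) auto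
  also have "\<dots> = ennreal C * ennreal (real (j + 1) / ln (real (j + 2)) ^ k)"
    by (subst ennreal_mult'') simp_all
  finally show ?thesis .
qed

lemma area_weight_inverse_log:
  "\<exists>C>0. \<forall>j. area_weight (\<lambda>t. 1 / ln (exp 1 / (1 - t)) ^ k) j \<le> ennreal C * ennreal (real (j + 1) / ln (real (j + 2)) ^ k)
     \<and> ennreal (real (j + 1) / ln (real (j + 2)) ^ k) \<le> ennreal C * area_weight (\<lambda>t. 1 / ln (exp 1 / (1 - t)) ^ k) j"
proof -
  let ?om = "\<lambda>t. 1 / ln (exp 1 / (1 - t)) ^ k"
  let ?v = "\<lambda>j. 1 / (1 + ln (real (j + 1))) ^ k"
  let ?C = "4 * (2 ^ k * fact k * exp 1) :: real"
  let ?D = "4 / (1 / (8 * 3 ^ k)) :: real"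
  have v: "0 < ?v j" for j by (auto intro!: zero_less_divide_iff[THEN iffD2] zero_less_power add_pos_nonneg)
  have up: "area_weight ?om j \<le> ennreal ?C * ennreal (real (j + 1) / ln (real (j + 2)) ^ k)" for j
    by (rule area_weight_inverse_log_upper[OF one_le_weight_const])
       (use moment_inverse_log_upper[of k "j - 1"] in \<open>simp add: add_ac\<close>)
  have low: "ennreal (real (j + 1) * ?v j) \<le> ennreal ?D * area_weight ?om j" for j
  proof (rule area_weight_lower[where v = ?v, OF _ _ v])
    have "1 * 1 \<le> 8 * (3::real) ^ k" by (intro mult_mono one_le_power) auto
    then show "1 / (8 * 3 ^ k) \<le> (1::real)" by simp
    assume j: "j \<noteq> 0"
    then show "ennreal (1 / (8 * 3 ^ k) * ?v j / real (j + 1)) \<le> moment ?om (j - 1)"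
      using moment_inverse_log_lower[of k "j - 1"] by (simp add: add_ac)
  qed simp_all
  show ?thesis
  proof (intro exI[of _ "?C + 3 ^ k * ?D"] conjI allI)
    fix j
    show "area_weight ?om j \<le> ennreal (?C + 3 ^ k * ?D) * ennreal (real (j + 1) / ln (real (j + 2)) ^ k)"
      by (rule order.trans[OF up]) (auto intro!: mult_right_mono ennreal_leI)
    have "ennreal (real (j + 1) / ln (real (j + 2)) ^ k) = ennreal (real (j + 1) * (1 / ln (real (j + 2)) ^ k))" by simp
    also have "\<dots> \<le> ennreal (real (j + 1) * (3 ^ k * ?v j))"
      by (intro ennreal_leI mult_left_mono inverse_ln_shift_power_bounds) simp
    also have "\<dots> = ennreal (3 ^ k) * ennreal (real (j + 1) * ?v j)"
      using v[of j] by (subst ennreal_mult'[symmetric]) (simp_all add: mult_ac)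
    also have "\<dots> \<le> ennreal (3 ^ k) * (ennreal ?D * area_weight ?om j)"
      by (intro mult_left_mono low) simp
    also have "\<dots> = ennreal (3 ^ k * ?D) * area_weight ?om j"
      by (subst ennreal_mult) (auto simp: mult.assoc)
    also have "\<dots> \<le> ennreal (?C + 3 ^ k * ?D) * area_weight ?om j"
      by (intro mult_right_mono ennreal_leI) auto
    finally show "ennreal (real (j + 1) / ln (real (j + 2)) ^ k) \<le> ennreal (?C + 3 ^ k * ?D) * area_weight ?om j" .
  qed (simp add: add_pos_pos)
qed

text \<open>The pole of order k at t = 0 must be absorbed by t^(j-1), hence k < j; at j = 0 no
  integral occurs. With k = d - 1 the excluded indices are exactly 1, ..., d - 1.\<close>

lemma area_weight_inverse_log_singular:
  "\<exists>C>0. \<forall>j. j = 0 \<or> k < j \<longrightarrow>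
     area_weight (\<lambda>t. 1 / ln (1 / (1 - t)) ^ k) j \<le> ennreal C * ennreal (real (j + 1) / ln (real (j + 2)) ^ k)"
proof -
  let ?C = "2 ^ k * (4 * (2 ^ k * fact k * exp 1)) * (real (k + 1) * (1 + ln (real (k + 1))) ^ k)"
  have "1 * 1 * (1 * 1) \<le> ?C"
    by (intro mult_mono one_le_power one_le_weight_const) auto
  then have C: "1 \<le> ?C" by simp
  show ?thesis
  proof (intro exI[of _ ?C] conjI allI impI)
    fix j assume j: "j = 0 \<or> k < j"
    show "area_weight (\<lambda>t. 1 / ln (1 / (1 - t)) ^ k) j \<le> ennreal ?C * ennreal (real (j + 1) / ln (real (j + 2)) ^ k)"
    proof (rule area_weight_inverse_log_upper[OF C])
      assume "j \<noteq> 0"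
      with j have "k \<le> j - 1" "j - 1 + 2 = j + 1" "j - 1 + 1 = j" by auto
      with moment_inverse_log_singular_upper[of k "j - 1"]
      show "moment (\<lambda>t. 1 / ln (1 / (1 - t)) ^ k) (j - 1)
        \<le> ennreal (?C * (1 / (1 + ln (real (j + 1))) ^ k) / real j)" by (simp only:)
    qed
  qed (use C in linarith)
qed

lemma area_weight_mono:
  assumes "\<And>t. 0 < t \<Longrightarrow> t < 1 \<Longrightarrow> om t \<le> om' t"
  shows "area_weight om j \<le> area_weight om' j"
  by (simp add: area_weight_def mult_left_mono moment_mono assms)

lemma area_weight_inverse_log_le:
  "area_weight (\<lambda>t. 1 / ln (exp 1 / (1 - t)) ^ k) j \<le> area_weight (\<lambda>t. 1 / ln (1 / (1 - t)) ^ k) j"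
proof (rule area_weight_mono)
  fix t :: real assume t: "0 < t" "t < 1"
  then have "0 < ln (1 / (1 - t))" by (intro ln_gt_zero) (simp add: field_simps)
  then show "1 / ln (exp 1 / (1 - t)) ^ k \<le> 1 / ln (1 / (1 - t)) ^ k"
    using t by (intro divide_left_mono power_mono mult_pos_pos zero_less_power)
      (auto simp: ln_exp_div intro: add_pos_pos)
qed

section \<open>Duality\<close>

definition monomial :: "nat \<Rightarrow> complex \<Rightarrow> complex" where
  "monomial m = power_series (\<lambda>j. if j = m then 1 else 0)"

definition truncate :: "nat \<Rightarrow> (nat \<Rightarrow> complex) \<Rightarrow> complex \<Rightarrow> complex" where
  "truncate N c = power_series (\<lambda>j. if j < N then c j else 0)"

lemma monomial: "monomial m \<in> hol_disc" "taylor (monomial m) j = (if j = m then 1 else 0)"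
  unfolding monomial_def by (rule polynomial_hol_disc[of "Suc m"] taylor_polynomial[of "Suc m"]; simp)+

lemma truncate: "truncate N c \<in> hol_disc" "taylor (truncate N c) j = (if j < N then c j else 0)"
  unfolding truncate_def by (rule polynomial_hol_disc[of N] taylor_polynomial[of N]; simp)+

lemma monomial_weighted_hol: "monomial m \<in> weighted_hol {} w"
  unfolding weighted_hol_def
  by (auto simp: monomial intro!: summable_of_finite_support[of "Suc m"])

lemma truncate_weighted_hol: "truncate N c \<in> weighted_hol {} w"
  unfolding weighted_hol_def
  by (auto simp: truncate intro!: summable_of_finite_support[of N])

lemma truncate_Suc: "truncate (Suc N) c = (\<lambda>z. truncate N c z + c N * monomial N z)"
  by (rule hol_disc_eqI)
     (auto simp: truncate monomial hol_disc_add hol_disc_scale taylor_add taylor_scale less_Suc_eq)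

lemma truncate_0: "truncate 0 c = (\<lambda>z. 0)"
  by (auto simp: truncate_def power_series_def)

definition weighted_linear :: "(nat \<Rightarrow> real) \<Rightarrow> ((complex \<Rightarrow> complex) \<Rightarrow> complex) \<Rightarrow> bool" where
  "weighted_linear w L \<longleftrightarrow>
     (\<forall>f\<in>weighted_hol {} w. \<forall>g\<in>weighted_hol {} w. L (\<lambda>x. f x + g x) = L f + L g) \<and>
     (\<forall>f\<in>weighted_hol {} w. \<forall>c. L (\<lambda>x. c * f x) = c * L f)"

lemma weighted_linearD:
  assumes "weighted_linear w L" "f \<in> weighted_hol {} w"
  shows "g \<in> weighted_hol {} w \<Longrightarrow> L (\<lambda>x. f x + g x) = L f + L g"
    and "L (\<lambda>x. c * f x) = c * L f"
  using assms by (auto simp: weighted_linear_def)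

lemma linear_truncate:
  assumes w: "\<And>j. 0 < w j" and lin: "weighted_linear w L"
  shows "L (truncate N c) = (\<Sum>j<N. c j * L (monomial j))"
proof (induction N)
  case 0
  show ?case using weighted_linearD(2)[OF lin monomial_weighted_hol, of 0 0] by (simp add: truncate_0)
next
  case (Suc N)
  show ?case
    unfolding truncate_Suc
    using weighted_linearD(1)[OF lin truncate_weighted_hol weighted_hol_scale[OF monomial_weighted_hol]]
      weighted_linearD(2)[OF lin monomial_weighted_hol]
    by (simp add: Suc)
qed

text \<open>The functional is tested on the polynomial with coefficients
  \<open>cnj (L (monomial j)) / (w j * sqrt Q)\<close>, Q the sum in question, which is extremal in
  Cauchy-Schwarz: it has norm 1 and value sqrt Q.\<close>

lemma dual_norm_lower:
  assumes w: "\<And>j. 0 < w j"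
    and nrm: "\<And>f. f \<in> weighted_hol {} w \<Longrightarrow> nrm f = sqrt (\<Sum>j. w j * (cmod (taylor f j))\<^sup>2)"
    and lin: "weighted_linear w L"
  shows "ennreal (sqrt (\<Sum>j<N. (cmod (L (monomial j)))\<^sup>2 / w j)) \<le> dual_norm (weighted_hol {} w) nrm L"
proof (cases "(\<Sum>j<N. (cmod (L (monomial j)))\<^sup>2 / w j) = 0")
  case False
  let ?b = "\<lambda>j. L (monomial j)"
  define Q where "Q = (\<Sum>j<N. (cmod (?b j))\<^sup>2 / w j)"
  have "0 \<le> Q" unfolding Q_def by (intro sum_nonneg divide_nonneg_pos w) simp
  then have Q: "0 < Q" using False by (simp add: Q_def)
  define c where "c j = cnj (?b j) / of_real (w j * sqrt Q)" for j
  have c: "c j * ?b j = of_real ((cmod (?b j))\<^sup>2 / w j / sqrt Q)" for j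
    using complex_norm_square[of "?b j"] by (simp add: c_def mult.commute)
  have "(\<Sum>j<N. (cmod (?b j))\<^sup>2 / w j / sqrt Q) = Q / sqrt Q"
    by (simp only: Q_def sum_divide_distrib)
  then have "L (truncate N c) = of_real (Q / sqrt Q)"
    by (simp only: linear_truncate[OF w lin] c of_real_sum[symmetric])
  then have L: "cmod (L (truncate N c)) = sqrt Q"
    using Q by (simp add: real_div_sqrt flip: of_real_divide)
  have "w j * (cmod (c j))\<^sup>2 = (cmod (?b j))\<^sup>2 / w j / Q" for j
    using w[of j] Q by (simp add: c_def norm_divide norm_mult power_divide power_mult_distrib power2_eq_square[of "w j"])
  then have "(\<Sum>j<N. w j * (cmod (c j))\<^sup>2) = Q / Q"
    by (simp only: Q_def sum_divide_distrib)
  then have "(\<Sum>j<N. w j * (cmod (c j))\<^sup>2) = 1" using Q by simp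
  moreover have "(\<Sum>j. w j * (cmod (taylor (truncate N c) j))\<^sup>2) = (\<Sum>j<N. w j * (cmod (c j))\<^sup>2)"
    by (subst suminf_finite[of "{..<N}"]) (auto simp: truncate)
  ultimately have "nrm (truncate N c) \<le> 1"
    by (simp add: nrm truncate_weighted_hol)
  then have "ennreal (cmod (L (truncate N c))) \<le> dual_norm (weighted_hol {} w) nrm L"
    unfolding dual_norm_def by (intro SUP_upper) (simp add: truncate_weighted_hol)
  then show ?thesis by (simp only: L Q_def)
qed simp

text \<open>The weight is distributed as sqrt w on one factor and 1/sqrt w on the other; the finite
  inequality bounds all partial sums at once.\<close>

lemma weighted_Cauchy_Schwarz:
  fixes x b :: "nat \<Rightarrow> complex"
  assumes w: "\<And>j. 0 < w j"
    and x: "summable (\<lambda>j. w j * (cmod (x j))\<^sup>2)" and b: "summable (\<lambda>j. (cmod (b j))\<^sup>2 / w j)"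
  shows "summable (\<lambda>j. x j * b j)"
    and "cmod (\<Sum>j. x j * b j) \<le> sqrt (\<Sum>j. w j * (cmod (x j))\<^sup>2) * sqrt (\<Sum>j. (cmod (b j))\<^sup>2 / w j)"
proof -
  have w0: "0 \<le> w j" for j using w[of j] by simp
  have part: "(\<Sum>j<N. cmod (x j * b j)) \<le> sqrt (\<Sum>j. w j * (cmod (x j))\<^sup>2) * sqrt (\<Sum>j. (cmod (b j))\<^sup>2 / w j)" for N
  proof -
    let ?u = "\<lambda>j. sqrt (w j) * cmod (x j)" and ?v = "\<lambda>j. cmod (b j) / sqrt (w j)"
    have "(\<Sum>j<N. cmod (x j * b j)) = (\<Sum>j<N. \<bar>?u j\<bar> * \<bar>?v j\<bar>)"
      using w by (intro sum.cong refl) (simp add: norm_mult abs_mult less_imp_le less_imp_neq[THEN not_sym])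
    also have "\<dots> \<le> L2_set ?u {..<N} * L2_set ?v {..<N}" by (rule L2_set_mult_ineq)
    also have "\<dots> = sqrt (\<Sum>j<N. w j * (cmod (x j))\<^sup>2) * sqrt (\<Sum>j<N. (cmod (b j))\<^sup>2 / w j)"
      by (simp add: L2_set_def power_mult_distrib power_divide w0)
    also have "\<dots> \<le> sqrt (\<Sum>j. w j * (cmod (x j))\<^sup>2) * sqrt (\<Sum>j. (cmod (b j))\<^sup>2 / w j)"
      using w0 by (intro mult_mono real_sqrt_le_mono sum_le_suminf x b)
        (auto intro!: sum_nonneg suminf_nonneg x b)
    finally show ?thesis .
  qed
  have n: "summable (\<lambda>j. norm (x j * b j))"
    by (rule bounded_imp_summable[OF _ part[of "Suc _", unfolded lessThan_Suc_atMost]]) simp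
  then show "summable (\<lambda>j. x j * b j)" by (rule summable_norm_cancel)
  show "cmod (\<Sum>j. x j * b j) \<le> sqrt (\<Sum>j. w j * (cmod (x j))\<^sup>2) * sqrt (\<Sum>j. (cmod (b j))\<^sup>2 / w j)"
    by (rule order.trans[OF summable_norm[OF n]]) (rule suminf_le_const[OF n part])
qed

lemma dual_norm_coefficient_functional:
  assumes w: "\<And>j. 0 < w j"
    and nrm: "\<And>f. f \<in> weighted_hol {} w \<Longrightarrow> nrm f = sqrt (\<Sum>j. w j * (cmod (taylor f j))\<^sup>2)"
    and b: "summable (\<lambda>j. (cmod (b j))\<^sup>2 / w j)"
    and L: "L = (\<lambda>f. \<Sum>j. taylor f j * b j)"
  shows "bounded_functional (weighted_hol {} w) nrm L"
    and "dual_norm (weighted_hol {} w) nrm L = ennreal (sqrt (\<Sum>j. (cmod (b j))\<^sup>2 / w j))"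
proof -
  note CS = weighted_Cauchy_Schwarz[OF w weighted_holD(3) b]
  have lin: "weighted_linear w L"
    unfolding weighted_linear_def
  proof (intro conjI ballI allI)
    fix f c assume f: "f \<in> weighted_hol {} w"
    show "L (\<lambda>x. c * f x) = c * L f"
      unfolding L by (simp only: taylor_scale weighted_holD(1)[OF f] suminf_mult[OF CS(1)[OF f]] mult.assoc)
    fix g assume g: "g \<in> weighted_hol {} w"
    show "L (\<lambda>x. f x + g x) = L f + L g"
      unfolding L
      by (simp only: taylor_add weighted_holD(1)[OF f] weighted_holD(1)[OF g]
          suminf_add[OF CS(1)[OF f] CS(1)[OF g]] distrib_right)
  qed
  have mono: "L (monomial j) = b j" for j
    unfolding L by (subst suminf_finite[of "{j}"]) (auto simp: monomial)
  have Q: "0 \<le> (\<Sum>j. (cmod (b j))\<^sup>2 / w j)" using w by (intro suminf_nonneg b) (simp add: less_imp_le)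
  show eq: "dual_norm (weighted_hol {} w) nrm L = ennreal (sqrt (\<Sum>j. (cmod (b j))\<^sup>2 / w j))"
  proof (rule antisym)
    show "dual_norm (weighted_hol {} w) nrm L \<le> ennreal (sqrt (\<Sum>j. (cmod (b j))\<^sup>2 / w j))"
      unfolding dual_norm_def
    proof (rule SUP_least, rule ennreal_leI)
      fix f assume f: "f \<in> {f \<in> weighted_hol {} w. nrm f \<le> 1}"
      have "cmod (L f) \<le> nrm f * sqrt (\<Sum>j. (cmod (b j))\<^sup>2 / w j)"
        using CS(2)[of f "{}"] f nrm[of f] by (simp add: L)
      also have "\<dots> \<le> 1 * sqrt (\<Sum>j. (cmod (b j))\<^sup>2 / w j)"
        using f Q by (intro mult_right_mono) auto
      finally show "cmod (L f) \<le> sqrt (\<Sum>j. (cmod (b j))\<^sup>2 / w j)" by simp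
    qed
    have "(\<lambda>N. ennreal (sqrt (\<Sum>j<N. (cmod (b j))\<^sup>2 / w j))) \<longlonglongrightarrow> ennreal (sqrt (\<Sum>j. (cmod (b j))\<^sup>2 / w j))"
      by (intro tendsto_ennrealI tendsto_real_sqrt summable_LIMSEQ b)
    then show "ennreal (sqrt (\<Sum>j. (cmod (b j))\<^sup>2 / w j)) \<le> dual_norm (weighted_hol {} w) nrm L"
      by (rule LIMSEQ_le_const2) (use dual_norm_lower[OF w nrm lin] in \<open>simp add: mono\<close>)
  qed
  show "bounded_functional (weighted_hol {} w) nrm L"
    unfolding bounded_functional_def eq using lin by (simp add: weighted_linear_def)
qed

text \<open>\<open>dual_norm\<close> only sees the unit ball, so f is scaled to norm 1; if its norm
  is 0, definiteness makes f itself 0.\<close>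

lemma bounded_functional_le:
  assumes w: "disc_weight w"
    and nrm: "\<And>f. f \<in> weighted_hol {} w \<Longrightarrow> nrm f = sqrt (\<Sum>j. w j * (cmod (taylor f j))\<^sup>2)"
    and L: "bounded_functional (weighted_hol {} w) nrm L" and f: "f \<in> weighted_hol {} w"
  shows "cmod (L f) \<le> enn2real (dual_norm (weighted_hol {} w) nrm L) * nrm f"
proof -
  interpret hilbert_function_space unit_disc "weighted_hol {} w" "weighted_ip w"
    by (rule hilbert_function_space_weighted_hol[OF w])
  let ?D = "dual_norm (weighted_hol {} w) nrm L"
  have D: "?D < \<infinity>" and scale: "\<And>f c. f \<in> weighted_hol {} w \<Longrightarrow> L (\<lambda>x. c * f x) = c * L f"
    using L by (auto simp: bounded_functional_def)
  have nrm': "nrm g = ip_norm (weighted_ip w) g" if "g \<in> weighted_hol {} w" for g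
    using nrm[OF that] ip_norm_weighted_ip[OF that] by simp
  have n0: "0 \<le> nrm f" using ip_nonneg[OF f] by (simp add: nrm'[OF f] ip_norm_def)
  show ?thesis
  proof (cases "nrm f = 0")
    case True
    then have "Re (weighted_ip w f f) = 0" by (simp add: nrm'[OF f] ip_norm_def)
    then have "weighted_ip w f f = 0"
      using weighted_ip_self[OF weighted_holD(3)[OF f]] by simp
    from ip_definite[OF f this] have "f = (\<lambda>x. 0)" .
    then have "L f = 0" using scale[OF f, of 0] by simp
    then show ?thesis using True by simp
  next
    case False
    define c where "c = complex_of_real (1 / nrm f)"
    have cf: "(\<lambda>x. c * f x) \<in> weighted_hol {} w" by (rule weighted_hol_scale[OF f])
    have "nrm (\<lambda>x. c * f x) = sqrt (\<Sum>j. (1 / nrm f)\<^sup>2 * (w j * (cmod (taylor f j))\<^sup>2))"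
      unfolding nrm[OF cf] taylor_scale[OF weighted_holD(1)[OF f]]
      by (simp add: c_def norm_divide norm_mult power_divide power_mult_distrib mult_ac n0)
    also have "\<dots> = sqrt ((1 / nrm f)\<^sup>2 * (\<Sum>j. w j * (cmod (taylor f j))\<^sup>2))"
      by (simp only: suminf_mult[OF weighted_holD(3)[OF f]])
    also have "\<dots> = 1 / nrm f * nrm f"
      using n0 by (simp only: real_sqrt_mult nrm[OF f, symmetric]) simp
    finally have "nrm (\<lambda>x. c * f x) \<le> 1" by simp
    with cf have "ennreal (cmod (L (\<lambda>x. c * f x))) \<le> ?D"
      unfolding dual_norm_def by (intro SUP_upper) simp
    from enn2real_mono[OF this] have "cmod (L (\<lambda>x. c * f x)) \<le> enn2real ?D"
      using D by simp
    moreover have "cmod (L (\<lambda>x. c * f x)) = cmod (L f) / nrm f"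
      unfolding scale[OF f] using n0 by (simp add: c_def norm_mult norm_divide)
    ultimately have "cmod (L f) / nrm f \<le> enn2real ?D" by simp
    then show ?thesis using False n0 by (simp add: field_simps)
  qed
qed

lemma truncate_tendsto:
  assumes w: "\<And>j. 0 < w j" and f: "f \<in> weighted_hol {} w"
    and nrm: "\<And>f. f \<in> weighted_hol {} w \<Longrightarrow> nrm f = sqrt (\<Sum>j. w j * (cmod (taylor f j))\<^sup>2)"
  shows "(\<lambda>N. nrm (\<lambda>z. f z + (-1) * truncate N (taylor f) z)) \<longlonglongrightarrow> 0"
proof -
  let ?d = "\<lambda>N z. f z + (-1) * truncate N (taylor f) z"
  let ?s = "\<lambda>j. w j * (cmod (taylor f j))\<^sup>2"
  have s: "summable ?s" by (rule weighted_holD(3)[OF f])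
  have d: "?d N \<in> weighted_hol {} w" for N
    using w by (intro weighted_hol_add weighted_hol_scale f truncate_weighted_hol) (simp add: less_imp_le)
  have "nrm (?d N) = sqrt ((\<Sum>j. ?s j) - (\<Sum>j<N. ?s j))" for N
  proof -
    have "taylor (?d N) j = (if j < N then 0 else taylor f j)" for j
      using taylor_add[OF weighted_holD(1)[OF f] hol_disc_scale[OF truncate(1)], of "-1" N "taylor f" j]
        taylor_scale[OF truncate(1), of "-1" N "taylor f" j] by (simp add: truncate)
    then have "w j * (cmod (taylor (?d N) j))\<^sup>2 = ?s j - (if j \<in> {..<N} then ?s j else 0)" for j by simp
    moreover have "(\<lambda>j. ?s j - (if j \<in> {..<N} then ?s j else 0)) sums ((\<Sum>j. ?s j) - (\<Sum>j<N. ?s j))"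
      by (intro sums_diff summable_sums s sums_If_finite_set) simp
    ultimately show ?thesis unfolding nrm[OF d] by (simp only: sums_iff)
  qed
  moreover have "(\<lambda>N. sqrt ((\<Sum>j. ?s j) - (\<Sum>j<N. ?s j))) \<longlonglongrightarrow> sqrt ((\<Sum>j. ?s j) - (\<Sum>j. ?s j))"
    by (intro tendsto_intros summable_LIMSEQ s)
  ultimately show ?thesis by simp
qed

text \<open>The lower bound for the dual norm on polynomials is uniform in the degree, which gives
  summability. Truncations converge in norm, so boundedness extends the formula from polynomials to
  f.\<close>

lemma bounded_functional_representation:
  assumes w: "disc_weight w"
    and nrm: "\<And>f. f \<in> weighted_hol {} w \<Longrightarrow> nrm f = sqrt (\<Sum>j. w j * (cmod (taylor f j))\<^sup>2)"
    and L: "bounded_functional (weighted_hol {} w) nrm L"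
  shows "summable (\<lambda>j. (cmod (L (monomial j)))\<^sup>2 / w j)"
    and "f \<in> weighted_hol {} w \<Longrightarrow> L f = (\<Sum>j. taylor f j * L (monomial j))"
proof -
  let ?D = "enn2real (dual_norm (weighted_hol {} w) nrm L)"
  note w0 = disc_weight_pos[OF w]
  have D: "dual_norm (weighted_hol {} w) nrm L < \<infinity>"
    and lin: "weighted_linear w L"
    using L by (auto simp: bounded_functional_def weighted_linear_def)
  show s: "summable (\<lambda>j. (cmod (L (monomial j)))\<^sup>2 / w j)"
  proof (rule bounded_imp_summable[of _ "?D\<^sup>2"])
    show "0 \<le> (cmod (L (monomial j)))\<^sup>2 / w j" for j using w0[of j] by simp
    fix N
    have "ennreal (sqrt (\<Sum>j<Suc N. (cmod (L (monomial j)))\<^sup>2 / w j)) \<le> dual_norm (weighted_hol {} w) nrm L"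
      by (rule dual_norm_lower[OF w0 nrm lin])
    from enn2real_mono[OF this] have "sqrt (\<Sum>j<Suc N. (cmod (L (monomial j)))\<^sup>2 / w j) \<le> ?D"
      using D w0 by (simp add: sum_nonneg less_imp_le del: sum.lessThan_Suc)
    then have "(\<Sum>j<Suc N. (cmod (L (monomial j)))\<^sup>2 / w j) \<le> ?D\<^sup>2" by (rule sqrt_le_D)
    then show "(\<Sum>j\<le>N. (cmod (L (monomial j)))\<^sup>2 / w j) \<le> ?D\<^sup>2" by (simp only: lessThan_Suc_atMost)
  qed
  show "L f = (\<Sum>j. taylor f j * L (monomial j))" if f: "f \<in> weighted_hol {} w"
  proof -
    let ?d = "\<lambda>N z. f z + (-1) * truncate N (taylor f) z"
    have d: "?d N \<in> weighted_hol {} w" for N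
      using w0 by (intro weighted_hol_add weighted_hol_scale f truncate_weighted_hol) (simp add: less_imp_le)
    have "(\<lambda>N. L (?d N)) \<longlonglongrightarrow> 0"
    proof (rule Lim_null_comparison)
      show "eventually (\<lambda>N. norm (L (?d N)) \<le> ?D * nrm (?d N)) sequentially"
        by (intro always_eventually allI bounded_functional_le[OF w nrm L d])
      show "(\<lambda>N. ?D * nrm (?d N)) \<longlonglongrightarrow> 0"
        by (intro tendsto_mult_right_zero truncate_tendsto[OF w0 f nrm])
    qed
    moreover have "L (?d N) = L f - (\<Sum>j<N. taylor f j * L (monomial j))" for N
      using weighted_linearD(1)[OF lin f weighted_hol_scale[OF truncate_weighted_hol], of "-1"]
        weighted_linearD(2)[OF lin truncate_weighted_hol, of "-1"] linear_truncate[OF w0 lin] by simp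
    moreover have "(\<lambda>N. L f - (\<Sum>j<N. taylor f j * L (monomial j)))
        \<longlonglongrightarrow> L f - (\<Sum>j. taylor f j * L (monomial j))"
      by (intro tendsto_diff tendsto_const summable_LIMSEQ
          weighted_Cauchy_Schwarz(1)[OF w0 weighted_holD(3)[OF f] s])
    ultimately have "L f - (\<Sum>j. taylor f j * L (monomial j)) = 0"
      using LIMSEQ_unique by (metis (no_types, lifting) ext)
    then show ?thesis by simp
  qed
qed

lemma dirichlet_ip_eq: "dirichlet_ip f g = (\<Sum>j. taylor f j * (of_nat (j + 1) * cnj (taylor g j)))"
  by (simp add: dirichlet_ip_def mult_ac)

text \<open>Under the pairing, \<psi> acts through the numbers b = (j + 1) times the conjugate of
  its coefficient, and |b|^2 / w is exactly the term of the norm with weight u. A functional L is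
  represented by solving for \<psi> from its values on monomials; these values also force
  uniqueness.\<close>

lemma weighted_hol_dual:
  assumes w: "disc_weight w" and u: "disc_weight u" "\<And>j. u j = (real (j + 1))\<^sup>2 / w j"
    and nrm: "\<And>f. f \<in> weighted_hol {} w \<Longrightarrow> nrm f = sqrt (\<Sum>j. w j * (cmod (taylor f j))\<^sup>2)"
  shows "is_dual_under (weighted_hol {} w) nrm (weighted_hol {} u) (coeff_norm u) dirichlet_ip"
    and "\<phi> \<in> weighted_hol {} w \<Longrightarrow> \<psi> \<in> weighted_hol {} u \<Longrightarrow>
      summable (\<lambda>j. of_nat (j + 1) * taylor \<phi> j * cnj (taylor \<psi> j))"
proof -
  note w0 = disc_weight_pos[OF w] and u0 = disc_weight_pos[OF u(1)]
  have eq: "(cmod (of_nat (j + 1) * cnj a))\<^sup>2 / w j = u j * (cmod a)\<^sup>2" for a j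
    by (simp add: u(2) norm_mult power_mult_distrib del: of_nat_add of_nat_Suc)
  have b: "summable (\<lambda>j. (cmod (of_nat (j + 1) * cnj (taylor \<psi> j)))\<^sup>2 / w j)"
    if "\<psi> \<in> weighted_hol {} u" for \<psi>
    unfolding eq using weighted_holD(3)[OF that] .
  show "summable (\<lambda>j. of_nat (j + 1) * taylor \<phi> j * cnj (taylor \<psi> j))"
    if "\<phi> \<in> weighted_hol {} w" "\<psi> \<in> weighted_hol {} u" for \<phi> \<psi>
    using weighted_Cauchy_Schwarz(1)[OF w0 weighted_holD(3)[OF that(1)] b[OF that(2)]]
    by (simp add: mult_ac)
  show "is_dual_under (weighted_hol {} w) nrm (weighted_hol {} u) (coeff_norm u) dirichlet_ip"
    unfolding is_dual_under_def
  proof (intro conjI ballI allI impI)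
    fix \<psi> assume \<psi>: "\<psi> \<in> weighted_hol {} u"
    have L: "(\<lambda>\<phi>. dirichlet_ip \<phi> \<psi>) = (\<lambda>\<phi>. \<Sum>j. taylor \<phi> j * (of_nat (j + 1) * cnj (taylor \<psi> j)))"
      by (rule ext) (rule dirichlet_ip_eq)
    note dn = dual_norm_coefficient_functional[OF w0 nrm b[OF \<psi>] L]
    show "bounded_functional (weighted_hol {} w) nrm (\<lambda>\<phi>. dirichlet_ip \<phi> \<psi>)" by (rule dn(1))
    show "dual_norm (weighted_hol {} w) nrm (\<lambda>\<phi>. dirichlet_ip \<phi> \<psi>) = coeff_norm u \<psi>"
      using dn(2)[unfolded eq] coeff_norm_eq_sqrt_suminf[OF less_imp_le[OF u0] weighted_holD(3)[OF \<psi>]]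
      by (rule trans[OF _ sym])
  next
    fix L assume L: "bounded_functional (weighted_hol {} w) nrm L"
    note rep = bounded_functional_representation[OF w nrm L]
    define c where "c j = cnj (L (monomial j)) / of_nat (j + 1)" for j
    have c: "of_nat (j + 1) * cnj (c j) = L (monomial j)" for j
      by (simp add: c_def del: of_nat_add of_nat_Suc)
    have "summable (\<lambda>j. u j * (cmod (c j))\<^sup>2)"
      using rep(1) unfolding eq[symmetric] c .
    from power_series_weighted_hol[OF u(1) this, of "{}"]
    have ps: "power_series c \<in> weighted_hol {} u" "taylor (power_series c) j = c j" for j by simp_all
    show "\<exists>!\<psi>. \<psi> \<in> weighted_hol {} u \<and> (\<forall>\<phi>\<in>weighted_hol {} w. L \<phi> = dirichlet_ip \<phi> \<psi>)"
    proof (rule ex1I[of _ "power_series c"])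
      show "power_series c \<in> weighted_hol {} u \<and> (\<forall>\<phi>\<in>weighted_hol {} w. L \<phi> = dirichlet_ip \<phi> (power_series c))"
        using ps rep(2) by (simp only: dirichlet_ip_eq c) simp
      fix \<psi> assume \<psi>: "\<psi> \<in> weighted_hol {} u \<and> (\<forall>\<phi>\<in>weighted_hol {} w. L \<phi> = dirichlet_ip \<phi> \<psi>)"
      have "taylor \<psi> j = c j" for j
      proof -
        have "L (monomial j) = dirichlet_ip (monomial j) \<psi>" using \<psi> monomial_weighted_hol by blast
        also have "\<dots> = of_nat (j + 1) * cnj (taylor \<psi> j)"
          unfolding dirichlet_ip_eq by (subst suminf_finite[of "{j}"]) (auto simp: monomial)
        finally show ?thesis by (simp add: c_def del: of_nat_add of_nat_Suc)
      qed
      then show "\<psi> = power_series c"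
        using \<psi> ps by (intro hol_disc_eqI) (auto dest: weighted_holD(1))
    qed
  qed
qed

section \<open>The spaces with kernel \<open>k\<^sup>d\<close> and their duals\<close>

text \<open>A nonnegative unordered sum is the supremum over finite subsets, and the unions of the
  first N finite level sets of s are cofinal among these.\<close>

lemma nonneg_infsum_partition:
  fixes g :: "'a \<Rightarrow> ennreal" and s :: "'a \<Rightarrow> nat"
  assumes fin: "\<And>j. finite {n \<in> A. s n = j}"
  shows "(\<Sum>\<^sub>\<infinity>n\<in>A. g n) = (\<Sum>j. \<Sum>n\<in>{n \<in> A. s n = j}. g n)"
proof -
  have infsum: "(\<Sum>\<^sub>\<infinity>n\<in>A. g n) = (SUP F\<in>{F. finite F \<and> F \<subseteq> A}. sum g F)"
    by (rule nonneg_infsum_complete) simp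
  have part: "(\<Sum>j<N. \<Sum>n\<in>{n \<in> A. s n = j}. g n) = sum g (\<Union>j<N. {n \<in> A. s n = j})" for N
    by (rule sum.UNION_disjoint[symmetric]) (use fin in auto)
  show ?thesis
  proof (rule antisym)
    show "(\<Sum>\<^sub>\<infinity>n\<in>A. g n) \<le> (\<Sum>j. \<Sum>n\<in>{n \<in> A. s n = j}. g n)"
      unfolding infsum
    proof (rule SUP_least)
      fix F assume F: "F \<in> {F. finite F \<and> F \<subseteq> A}"
      \<comment> \<open>A finite F meets only levels up to its largest value of s. For empty F the
        maximum is unspecified, but the inclusion is trivial.\<close>
      then have "F \<subseteq> (\<Union>j<Suc (Max (s ` F)). {n \<in> A. s n = j})"
        by (auto simp: less_Suc_eq_le)
      then have "sum g F \<le> sum g (\<Union>j<Suc (Max (s ` F)). {n \<in> A. s n = j})"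
        by (intro sum_mono2) (use fin in auto)
      also have "\<dots> \<le> (\<Sum>j. \<Sum>n\<in>{n \<in> A. s n = j}. g n)"
        unfolding part[symmetric] by (intro sum_le_suminf summableI) auto
      finally show "sum g F \<le> (\<Sum>j. \<Sum>n\<in>{n \<in> A. s n = j}. g n)" .
    qed
    show "(\<Sum>j. \<Sum>n\<in>{n \<in> A. s n = j}. g n) \<le> (\<Sum>\<^sub>\<infinity>n\<in>A. g n)"
      unfolding infsum
      by (intro suminf_le_const summableI) (unfold part, intro SUP_upper, use fin in auto)
  qed
qed

text \<open>The product is a multiple of one monomial. It is not extended by zero, but the pairing
  only looks at Taylor coefficients at 0.\<close>

lemma dirichlet_ip_basis_product:
  "dirichlet_ip (\<lambda>z. \<Prod>i<d. dirichlet_basis (n i) z) \<psi>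
    = of_nat ((\<Sum>i<d. n i) + 1) * cnj (taylor \<psi> (\<Sum>i<d. n i)) / of_real (\<Prod>i<d. sqrt (real (n i + 1)))"
proof -
  let ?s = "\<Sum>i<d. n i"
  have "(\<lambda>z. \<Prod>i<d. dirichlet_basis (n i) z) = (\<lambda>z. 1 / of_real (\<Prod>i<d. sqrt (real (n i + 1))) * z ^ ?s)"
    by (simp add: dirichlet_basis_def prod_dividef power_sum fun_eq_iff)
  then have "taylor (\<lambda>z. \<Prod>i<d. dirichlet_basis (n i) z) j
      = (if j = ?s then 1 / of_real (\<Prod>i<d. sqrt (real (n i + 1))) else 0)" for j
    by (simp only: taylor_monomial)
  then show ?thesis
    unfolding dirichlet_ip_def by (subst suminf_finite[of "{?s}"]) auto
qed

text \<open>Multi-indices are grouped by their total degree j. Each contributes (j+1)^2 |c|^2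
  divided by the product of the n_i + 1, c the coefficient of \<psi> at j, and these reciprocals add
  up to a_d(j).\<close>

lemma HS_norm_power2:
  "(HS_norm d \<psi>)\<^sup>2 = (\<Sum>\<^sub>\<infinity>n\<in>multi_indices d.
     ennreal ((cmod (dirichlet_ip (\<lambda>z. \<Prod>i<d. dirichlet_basis (n i) z) \<psi>))\<^sup>2))"
proof -
  let ?g = "\<lambda>n. ennreal ((cmod (dirichlet_ip (\<lambda>z. \<Prod>i<d. dirichlet_basis (n i) z) \<psi>))\<^sup>2)"
  have g: "?g n = ennreal ((real (j + 1))\<^sup>2 * (cmod (taylor \<psi> j))\<^sup>2 * (1 / (\<Prod>i<d. real (n i + 1))))"
    if "(\<Sum>i<d. n i) = j" for n j
  proof -
    have "(\<Prod>i<d. sqrt (real (n i + 1)))\<^sup>2 = (\<Prod>i<d. real (n i + 1))"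
      by (simp add: prod_power_distrib)
    then show ?thesis
      unfolding dirichlet_ip_basis_product that
      by (simp add: norm_mult norm_divide power_mult_distrib power_divide del: of_nat_add of_nat_Suc of_real_prod)
  qed
  have "(\<Sum>n\<in>{n \<in> multi_indices d. (\<Sum>i<d. n i) = j}. ?g n)
      = ennreal ((real (j + 1))\<^sup>2 * a_coeff d j * (cmod (taylor \<psi> j))\<^sup>2)" for j
  proof -
    have "(\<Sum>n\<in>{n \<in> multi_indices d. (\<Sum>i<d. n i) = j}. ?g n)
        = (\<Sum>n\<in>{n \<in> multi_indices d. (\<Sum>i<d. n i) = j}.
            ennreal ((real (j + 1))\<^sup>2 * (cmod (taylor \<psi> j))\<^sup>2 * (1 / (\<Prod>i<d. real (n i + 1)))))"
      by (rule sum.cong[OF refl], rule g) simp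
    also have "\<dots> = ennreal (\<Sum>n\<in>{n \<in> multi_indices d. (\<Sum>i<d. n i) = j}.
            (real (j + 1))\<^sup>2 * (cmod (taylor \<psi> j))\<^sup>2 * (1 / (\<Prod>i<d. real (n i + 1))))"
      by (rule sum_ennreal) (intro mult_nonneg_nonneg divide_nonneg_nonneg prod_nonneg; simp)
    also have "(\<Sum>n\<in>{n \<in> multi_indices d. (\<Sum>i<d. n i) = j}.
            (real (j + 1))\<^sup>2 * (cmod (taylor \<psi> j))\<^sup>2 * (1 / (\<Prod>i<d. real (n i + 1))))
        = (real (j + 1))\<^sup>2 * a_coeff d j * (cmod (taylor \<psi> j))\<^sup>2"
      unfolding a_coeff_def sum_distrib_left[symmetric] by (simp only: mult_ac)
    finally show ?thesis .
  qed
  then have "(\<Sum>\<^sub>\<infinity>n\<in>multi_indices d. ?g n)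
      = (\<Sum>j. ennreal ((real (j + 1))\<^sup>2 * a_coeff d j * (cmod (taylor \<psi> j))\<^sup>2))"
    using nonneg_infsum_partition[where A = "multi_indices d" and s = "\<lambda>n. \<Sum>i<d. n i" and g = ?g, OF finite_multi_indices_sum] by simp
  then show ?thesis unfolding coeff_norm_def esqrt_power2 by simp
qed

lemma comparable_on_finite_iff:
  assumes "comparable_on S A B" "f \<in> S"
  shows "A f < \<infinity> \<longleftrightarrow> B f < \<infinity>"
proof -
  obtain C where C: "A f \<le> ennreal C * B f" "B f \<le> ennreal C * A f"
    using comparable_onE[OF assms(1)] assms(2) by metis
  show ?thesis
    using le_less_trans[OF C(1)] le_less_trans[OF C(2)] by (auto simp: ennreal_mult_less_top)
qed

text \<open>Coefficients with index in \<open>S\<close> vanish, so there \<open>W\<close> may be infinite and is replaced by \<open>w\<close>.\<close>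

lemma hilbert_norm_on_ecoeff_norm:
  assumes w: "disc_weight w" and C: "0 < C"
    and bounds: "\<And>j. j \<notin> S \<Longrightarrow> ennreal (w j) \<le> ennreal C * W j" "\<And>j. j \<notin> S \<Longrightarrow> W j \<le> ennreal C * ennreal (w j)"
    and N: "\<And>f. f \<in> weighted_hol S w \<Longrightarrow> N f = ecoeff_norm W f"
  shows "hilbert_norm_on unit_disc (weighted_hol S w) N"
proof -
  define v where "v j = (if j \<in> S then w j else enn2real (W j))" for j
  note w0 = disc_weight_pos[OF w]
  have W: "W j = ennreal (v j)" if "j \<notin> S" for j
  proof -
    have "W j < \<infinity>" by (rule le_less_trans[OF bounds(2)[OF that]]) (simp add: ennreal_mult_less_top)
    then show ?thesis using that by (simp add: v_def)
  qed
  \<comment> \<open>The maximum with 1 covers the indices in S, where v coincides with w.\<close>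
  have wv: "w j \<le> max C 1 * v j" and vw: "v j \<le> max C 1 * w j" and v0: "0 < v j" for j
  proof -
    have "w j \<le> max C 1 * v j \<and> v j \<le> max C 1 * w j \<and> 0 < v j"
    proof (cases "j \<in> S")
      case True
      then show ?thesis using w0[of j] by (simp add: v_def mult_le_cancel_right1)
    next
      case False
      have nn: "0 \<le> v j" using False by (simp add: v_def)
      have "ennreal (w j) \<le> ennreal (C * v j)" "ennreal (v j) \<le> ennreal (C * w j)"
        using bounds[OF False] C nn w0[of j] by (simp_all add: W[OF False] ennreal_mult less_imp_le)
      then have 1: "w j \<le> C * v j" and 2: "v j \<le> C * w j"
        using C nn w0[of j] by (simp_all add: ennreal_le_iff)
      have "C * v j \<le> max C 1 * v j" "C * w j \<le> max C 1 * w j"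
        using nn w0[of j] by (intro mult_right_mono; simp)+
      moreover have "0 < v j" using 1 w0[of j] C nn by (cases "v j = 0") auto
      ultimately show ?thesis using 1 2 by linarith
    qed
    then show "w j \<le> max C 1 * v j" "v j \<le> max C 1 * w j" "0 < v j" by auto
  qed
  have C1: "0 < max C 1" by simp
  have v: "disc_weight v" by (rule disc_weight_mono[OF w C1 v0 wv])
  have cmp: "comparable_on hol_disc (coeff_norm w) (coeff_norm v)"
    by (rule comparable_on_coeff_norm[OF C1 C1 _ _ wv vw]) (use w0 v0 in \<open>auto simp: less_imp_le\<close>)
  have eq: "weighted_hol S w = weighted_hol S v"
    using comparable_on_finite_iff[OF cmp]
    by (auto simp: weighted_hol_eq less_imp_le w0 v0)
  show ?thesis
    unfolding hilbert_norm_on_def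
  proof (intro exI conjI ballI)
    show "hilbert_function_space unit_disc (weighted_hol S w) (weighted_ip v)"
      unfolding eq by (rule hilbert_function_space_weighted_hol[OF v])
    fix f assume f: "f \<in> weighted_hol S w"
    have "ecoeff_norm W f = coeff_norm v f"
    proof -
      have "W j * ennreal ((cmod (taylor f j))\<^sup>2) = ennreal (v j) * ennreal ((cmod (taylor f j))\<^sup>2)" for j
        using weighted_holD(2)[OF f, of j] W[of j] by (cases "j \<in> S") auto
      then show ?thesis
        by (simp only: coeff_norm_eq_ecoeff_norm[OF less_imp_le[OF v0]] ecoeff_norm_def)
    qed
    also have "\<dots> = ennreal (ip_norm (weighted_ip v) f)"
      by (rule ennreal_ip_norm_weighted_ip[symmetric, OF less_imp_le[OF v0]]) (use f eq in simp)
    finally show "N f = ennreal (ip_norm (weighted_ip v) f)" by (simp only: N[OF f])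
  qed
qed

lemma weighted_hol_cong:
  assumes "disc_weight w" "disc_weight v" "comparable_on hol_disc (coeff_norm w) (coeff_norm v)"
  shows "weighted_hol S w = weighted_hol S v"
  using comparable_on_finite_iff[OF assms(3)]
  by (auto simp: weighted_hol_eq less_imp_le disc_weight_pos[OF assms(1)] disc_weight_pos[OF assms(2)])

lemma disc_weight_one: "disc_weight (\<lambda>j. 1)"
  by (simp add: disc_weight_def summable_geometric)

lemma disc_weight_inverse_a_coeff: "disc_weight (\<lambda>j. 1 / a_coeff (Suc k) j)"
proof -
  have "summable (\<lambda>j. r ^ j / (1 / a_coeff (Suc k) j))" if "0 < r" "r < 1" for r
    using summable_a_coeff[of r "Suc k"] that by (simp add: mult.commute)
  then show ?thesis by (simp add: disc_weight_def a_coeff_pos)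
qed

text \<open>With x = j + 1, y the k-th power of ln(j + 2) and a the coefficient, all four
  inequalities are rearrangements of the comparability of a x and y.\<close>

lemma a_coeff_bounds:
  obtains C where "0 < C"
    "\<And>j. 1 / a_coeff (Suc k) j \<le> C * (real (j + 1) / ln (real (j + 2)) ^ k)"
    "\<And>j. real (j + 1) / ln (real (j + 2)) ^ k \<le> C * (1 / a_coeff (Suc k) j)"
    "\<And>j. (real (j + 1))\<^sup>2 * a_coeff (Suc k) j \<le> C * (real (j + 1) * ln (real (j + 2)) ^ k)"
    "\<And>j. real (j + 1) * ln (real (j + 2)) ^ k \<le> C * ((real (j + 1))\<^sup>2 * a_coeff (Suc k) j)"
proof -
  obtain c where c: "0 < c" "\<And>j. c * ln (real (j + 2)) ^ k / real (j + 1) \<le> a_coeff (Suc k) j"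
    using a_coeff_lower by blast
  obtain C where C: "0 < C" "\<And>j. a_coeff (Suc k) j \<le> C * ln (real (j + 2)) ^ k / real (j + 1)"
    using a_coeff_upper by blast
  let ?D = "max (1 / c) C"
  have D: "0 < ?D" "1 / c \<le> ?D" "C \<le> ?D" using c(1) by (auto simp: less_max_iff_disj)
  have key: "1 / a \<le> ?D * (x / y) \<and> x / y \<le> ?D * (1 / a) \<and> x\<^sup>2 * a \<le> ?D * (x * y) \<and> x * y \<le> ?D * (x\<^sup>2 * a)"
    if "c * y / x \<le> a" "a \<le> C * y / x" "0 < x" "0 < y" "0 < a" for a x y :: real
  proof -
    have "c * y \<le> a * x" using that by (simp add: divide_le_eq)
    then have 1: "y \<le> 1 / c * (a * x)" using c(1) by (simp add: field_simps)
    also have "\<dots> \<le> ?D * (a * x)" using D that by (intro mult_right_mono) auto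
    finally have 1: "y \<le> ?D * (a * x)" .
    have "a * x \<le> C * y" using that by (simp add: le_divide_eq)
    also have "\<dots> \<le> ?D * y" using D that by (intro mult_right_mono) auto
    finally have 2: "a * x \<le> ?D * y" .
    have "x * y \<le> ?D * (x\<^sup>2 * a)" "x\<^sup>2 * a \<le> ?D * (x * y)"
      using mult_left_mono[OF 1, of x] mult_left_mono[OF 2, of x] that
      by (simp_all add: power2_eq_square mult_ac)
    moreover have "1 / a \<le> ?D * (x / y)" "x / y \<le> ?D * (1 / a)"
      using 1 2 that by (simp_all add: divide_le_eq le_divide_eq mult_ac)
    ultimately show ?thesis by blast
  qed
  have "0 < ln (real (j + 2)) ^ k" "0 < real (j + 1)" for j by simp_all
  note K = key[OF c(2) C(2) this(2) this(1) a_coeff_pos]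
  show thesis
    by (rule that[OF D(1)]) (use K in blast)+
qed

theorem theorem1:
  fixes d :: nat
  assumes "1 \<le> d"
  shows "(\<exists>V ip. powered_dirichlet_rkhs d V ip) \<and>
    (\<forall>V ip. powered_dirichlet_rkhs d V ip \<longrightarrow>
      \<comment> \<open>(i)\<close>
      V = {\<phi> \<in> hol_disc. D_norm d \<phi> < \<infinity>} \<and>
      (\<forall>\<phi>\<in>V. ennreal (ip_norm ip \<phi>) = D_norm d \<phi>) \<and>
      comparable_on hol_disc (D_norm d) (D_log_norm d) \<and>
      \<comment> \<open>(ii)\<close>
      hilbert_norm_on unit_disc V (D_area_norm_reg d) \<and>
      comparable_on hol_disc (D_area_norm_reg d) (D_log_norm d) \<and>
      hilbert_norm_on unit_disc (V \<inter> low_coeffs_vanish d) (D_area_norm d) \<and>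
      comparable_on (hol_disc \<inter> low_coeffs_vanish d) (D_area_norm d) (D_log_norm d) \<and>
      (\<exists>C::real. 0 < C \<and> (\<forall>\<phi>\<in>hol_disc. D_log_norm d \<phi> \<le> ennreal C * D_area_norm d \<phi>)) \<and>
      \<comment> \<open>(iii)\<close>
      (\<forall>\<phi>\<in>V. \<forall>\<psi>\<in>HS d. summable (\<lambda>j. of_nat (j + 1) * taylor \<phi> j * cnj (taylor \<psi> j))) \<and>
      is_dual_under V (ip_norm ip) (HS d) (HS_norm d) dirichlet_ip \<and>
      \<comment> \<open>(iv)\<close>
      comparable_on hol_disc (HS_norm d) (HS_log_norm d) \<and>
      comparable_on hol_disc (HS_log_norm d) (HS_area_norm d) \<and>
      \<comment> \<open>(v)\<close>
      (\<forall>\<psi>\<in>hol_disc. (HS_norm d \<psi>)\<^sup>2 =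
         (\<Sum>\<^sub>\<infinity>n\<in>multi_indices d.
            ennreal ((cmod (dirichlet_ip (\<lambda>z. \<Prod>i<d. dirichlet_basis (n i) z) \<psi>))\<^sup>2))))"
proof -
  obtain k where d: "d = Suc k" using assms by (cases d) auto
  define w where "w j = 1 / a_coeff d j" for j
  define l where "l j = real (j + 1) / ln (real (j + 2)) ^ k" for j
  define u where "u j = (real (j + 1))\<^sup>2 * a_coeff d j" for j
  define h where "h j = real (j + 1) * ln (real (j + 2)) ^ k" for j
  \<comment> \<open>The radial weights as functions of t = |z|^2, the variable in which the moments
    are taken.\<close>
  define regular where "regular t = 1 / ln (exp 1 / (1 - t)) ^ k" for t :: real
  define singular where "singular t = 1 / ln (1 / (1 - t)) ^ k" for t :: real
  define growing where "growing t = ln (1 / (1 - t)) ^ k" for t :: real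
  have meas: "regular \<in> borel_measurable borel" "singular \<in> borel_measurable borel"
    "growing \<in> borel_measurable borel"
    unfolding regular_def singular_def growing_def by measurable
  have norms: "D_norm d = coeff_norm w" "D_log_norm d = coeff_norm l"
    "HS_norm d = coeff_norm u" "HS_log_norm d = coeff_norm h"
    "D_area_norm_reg d = area_norm (\<lambda>z. regular ((cmod z)\<^sup>2))"
    "D_area_norm d = area_norm (\<lambda>z. singular ((cmod z)\<^sup>2))"
    "HS_area_norm d = area_norm (\<lambda>z. growing ((cmod z)\<^sup>2))"
    by (simp_all add: w_def[abs_def] l_def[abs_def] u_def[abs_def] h_def[abs_def]
        regular_def singular_def growing_def d)
  obtain C where C: "0 < C" and wl: "\<And>j. w j \<le> C * l j" and lw: "\<And>j. l j \<le> C * w j"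
    and uh: "\<And>j. u j \<le> C * h j" and hu: "\<And>j. h j \<le> C * u j"
    using a_coeff_bounds[of k] unfolding w_def l_def u_def h_def d by blast
  have pos: "0 < w j" "0 < l j" "0 < u j" "0 < h j" for j
    by (simp_all add: w_def l_def u_def h_def d a_coeff_pos)
  note nonneg = pos[THEN less_imp_le]
  have w: "disc_weight w" unfolding w_def d by (rule disc_weight_inverse_a_coeff)
  have l: "disc_weight l" by (rule disc_weight_mono[OF w C pos(2) wl])
  \<comment> \<open>The weight h is at least a power of ln 2, so u is bounded below by a positive
    constant and the constant weight serves for comparison.\<close>
  have u: "disc_weight u"
  proof (rule disc_weight_mono[OF disc_weight_one])
    show "0 < C / ln 2 ^ k" using C by simp
    fix j
    have "ln 2 ^ k \<le> ln (real (j + 2)) ^ k" by (intro power_mono) auto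
    also have "\<dots> \<le> h j" unfolding h_def by (simp add: mult_le_cancel_right1)
    also have "\<dots> \<le> C * u j" by (rule hu)
    finally show "1 \<le> C / ln 2 ^ k * u j" by (simp add: field_simps)
  qed (rule pos)
  have w_sq: "u j = (real (j + 1))\<^sup>2 / w j" for j by (simp add: u_def w_def)
  have cmp: "comparable_on hol_disc (coeff_norm w) (coeff_norm l)"
    "comparable_on hol_disc (coeff_norm u) (coeff_norm h)"
    by (rule comparable_on_coeff_norm[OF C C nonneg(1,2) wl lw] comparable_on_coeff_norm[OF C C nonneg(3,4) uh hu])+
  obtain R where R: "0 < R" "\<And>j. area_weight regular j \<le> ennreal R * ennreal (l j)"
    "\<And>j. ennreal (l j) \<le> ennreal R * area_weight regular j"
    using area_weight_inverse_log[of k] unfolding regular_def[abs_def] l_def by blast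
  obtain G where G: "0 < G" "\<And>j. area_weight growing j \<le> ennreal G * ennreal (h j)"
    "\<And>j. ennreal (h j) \<le> ennreal G * area_weight growing j"
    using area_weight_log[of k] unfolding growing_def[abs_def] h_def by blast
  obtain T where T: "0 < T" "\<And>j. j = 0 \<or> k < j \<Longrightarrow> area_weight singular j \<le> ennreal T * ennreal (l j)"
    using area_weight_inverse_log_singular[of k] unfolding singular_def[abs_def] l_def by blast
  \<comment> \<open>The singular weight dominates the regular one, so the lower bound transfers at
    every index, including those where the singular moment is infinite.\<close>
  have lT: "ennreal (l j) \<le> ennreal R * area_weight singular j" for j
  proof (rule order.trans[OF R(3)])
    show "ennreal R * area_weight regular j \<le> ennreal R * area_weight singular j"
      unfolding regular_def singular_def by (intro mult_left_mono area_weight_inverse_log_le) simp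
  qed
  let ?S = "{j. 1 \<le> j \<and> j < d}"
  have notS: "j = 0 \<or> k < j" if "j \<notin> ?S" for j using that by (auto simp: d)
  have area: "area_norm (\<lambda>z. om ((cmod z)\<^sup>2)) f = ecoeff_norm (area_weight om) f"
    if "om \<in> borel_measurable borel" "f \<in> hol_disc" for om f
    by (rule area_norm_eq_ecoeff_norm[OF that])
  have rkhs: "powered_dirichlet_rkhs d (weighted_hol {} w) (weighted_ip w)"
    unfolding powered_dirichlet_rkhs_def
  proof (rule reproducing_kernel_weighted_hol[OF w])
    fix x z :: complex assume "x \<in> unit_disc" "z \<in> unit_disc"
    then have "cmod z * cmod x < 1 * 1" by (intro mult_strict_mono) auto
    then have "cmod (cnj z * x) < 1" by (simp add: norm_mult)
    from dirichlet_kernel_power_sums[OF this, of d]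
    show "(\<lambda>j. complex_of_real (1 / w j) * (cnj z * x) ^ j) sums dirichlet_kernel x z ^ d"
      by (simp add: w_def)
  qed
  have V: "weighted_hol {} w = {\<phi> \<in> hol_disc. D_norm d \<phi> < \<infinity>}"
    unfolding norms weighted_hol_eq[OF nonneg(1)] by simp
  have HS: "weighted_hol {} u = HS d"
    unfolding HS_def norms weighted_hol_eq[OF nonneg(3)] by simp
  have low: "weighted_hol {} w \<inter> low_coeffs_vanish d = weighted_hol ?S w"
    by (auto simp: weighted_hol_def low_coeffs_vanish_def)
  have wl_eq: "weighted_hol S w = weighted_hol S l" for S
    by (rule weighted_hol_cong[OF w l cmp(1)])
  have reg: "hilbert_norm_on unit_disc (weighted_hol {} w) (D_area_norm_reg d)"
    unfolding norms wl_eq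
    by (rule hilbert_norm_on_ecoeff_norm[OF l R(1) R(3) R(2)]) (rule area[OF meas(1) weighted_holD(1)])
  have sing: "hilbert_norm_on unit_disc (weighted_hol {} w \<inter> low_coeffs_vanish d) (D_area_norm d)"
    unfolding norms low unfolding wl_eq
  proof (rule hilbert_norm_on_ecoeff_norm[OF l, of "R + T"])
    show "0 < R + T" using R(1) T(1) by simp
    fix j assume "j \<notin> ?S"
    note j = notS[OF this]
    show "ennreal (l j) \<le> ennreal (R + T) * area_weight singular j"
      by (rule order.trans[OF lT]) (use R(1) T(1) in \<open>auto intro!: mult_right_mono ennreal_leI\<close>)
    show "area_weight singular j \<le> ennreal (R + T) * ennreal (l j)"
      by (rule order.trans[OF T(2)[OF j]]) (use R(1) T(1) in \<open>auto intro!: mult_right_mono ennreal_leI\<close>)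
  qed (rule area[OF meas(2) weighted_holD(1)])
  have ecoeff: "coeff_norm l = ecoeff_norm (\<lambda>j. ennreal (l j))" "coeff_norm h = ecoeff_norm (\<lambda>j. ennreal (h j))"
    using coeff_norm_eq_ecoeff_norm[OF nonneg(2)] coeff_norm_eq_ecoeff_norm[OF nonneg(4)] .
  have comparable_cong: "comparable_on A N N'"
    if "comparable_on A N1 N1'" "\<And>f. f \<in> A \<Longrightarrow> N f = N1 f" "\<And>f. f \<in> A \<Longrightarrow> N' f = N1' f"
    for A :: "(complex \<Rightarrow> complex) set" and N N' N1 N1'
    using that unfolding comparable_on_def by simp
  have cmp_reg: "comparable_on hol_disc (D_area_norm_reg d) (D_log_norm d)"
    unfolding norms
    by (rule comparable_cong[OF comparable_on_ecoeff_norm[OF R(1) R(1) R(2) R(3)]])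
       (simp_all only: area[OF meas(1)] ecoeff)
  have cmp_sing: "comparable_on (hol_disc \<inter> low_coeffs_vanish d) (D_area_norm d) (D_log_norm d)"
    unfolding norms
  proof (rule comparable_cong[OF comparable_on_ecoeff_norm[OF T(1) R(1) T(2) lT]])
    fix f j assume "f \<in> hol_disc \<inter> low_coeffs_vanish d" "taylor f j \<noteq> 0"
    then show "j = 0 \<or> k < j" by (intro notS) (auto simp: low_coeffs_vanish_def)
  qed (auto simp only: area[OF meas(2)] ecoeff Int_iff)
  have one_sided: "\<exists>C::real. 0 < C \<and> (\<forall>\<phi>\<in>hol_disc. D_log_norm d \<phi> \<le> ennreal C * D_area_norm d \<phi>)"
  proof (intro exI[of _ "sqrt R"] conjI ballI)
    fix \<phi> assume \<phi>: "\<phi> \<in> hol_disc"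
    show "D_log_norm d \<phi> \<le> ennreal (sqrt R) * D_area_norm d \<phi>"
      unfolding norms area[OF meas(2) \<phi>] ecoeff by (rule ecoeff_norm_mono[OF lT R(1)])
  qed (use R(1) in simp)
  have cmp_HS: "comparable_on hol_disc (HS_log_norm d) (HS_area_norm d)"
    unfolding norms
    by (rule comparable_cong[OF comparable_on_ecoeff_norm[OF G(1) G(1) G(3) G(2)]])
       (simp_all only: area[OF meas(3)] ecoeff)
  show ?thesis
  proof (intro conjI allI impI)
    show "\<exists>V ip. powered_dirichlet_rkhs d V ip" using rkhs by blast
  next
    fix V ip assume "powered_dirichlet_rkhs d V ip"
    \<comment> \<open>An arbitrary space with this kernel is identified with the concrete one, with
      the same norm; the claims about \<open>V\<close> and \<open>ip\<close> now become claims about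
      \<open>weighted_hol {} w\<close>.\<close>
    note unique = rkhs_unique[OF this[unfolded powered_dirichlet_rkhs_def] rkhs[unfolded powered_dirichlet_rkhs_def]]
    note eq = unique(1)
    have nrm: "ip_norm ip f = sqrt (\<Sum>j. w j * (cmod (taylor f j))\<^sup>2)" if "f \<in> weighted_hol {} w" for f
      using unique(2)[of f] that ip_norm_weighted_ip[OF that] by (simp add: eq)
    note dual = weighted_hol_dual[OF w u w_sq, of "ip_norm ip", OF nrm]
    show "V = {\<phi> \<in> hol_disc. D_norm d \<phi> < \<infinity>}" unfolding eq by (rule V)
    show "\<forall>\<phi>\<in>V. ennreal (ip_norm ip \<phi>) = D_norm d \<phi>"
      unfolding norms
      using unique(2) ennreal_ip_norm_weighted_ip[OF nonneg(1)] by (simp add: eq)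
    show "comparable_on hol_disc (D_norm d) (D_log_norm d)" unfolding norms by (rule cmp)
    show "hilbert_norm_on unit_disc V (D_area_norm_reg d)" unfolding eq by (rule reg)
    show "comparable_on hol_disc (D_area_norm_reg d) (D_log_norm d)" by (rule cmp_reg)
    show "hilbert_norm_on unit_disc (V \<inter> low_coeffs_vanish d) (D_area_norm d)" unfolding eq by (rule sing)
    show "comparable_on (hol_disc \<inter> low_coeffs_vanish d) (D_area_norm d) (D_log_norm d)" by (rule cmp_sing)
    show "\<exists>C::real. 0 < C \<and> (\<forall>\<phi>\<in>hol_disc. D_log_norm d \<phi> \<le> ennreal C * D_area_norm d \<phi>)" by (rule one_sided)
    show "\<forall>\<phi>\<in>V. \<forall>\<psi>\<in>HS d. summable (\<lambda>j. of_nat (j + 1) * taylor \<phi> j * cnj (taylor \<psi> j))"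
      unfolding eq HS[symmetric] using dual(2) by blast
    show "is_dual_under V (ip_norm ip) (HS d) (HS_norm d) dirichlet_ip"
      unfolding eq HS[symmetric] norms by (rule dual(1))
    show "comparable_on hol_disc (HS_norm d) (HS_log_norm d)" unfolding norms by (rule cmp)
    show "comparable_on hol_disc (HS_log_norm d) (HS_area_norm d)" by (rule cmp_HS)
    show "\<forall>\<psi>\<in>hol_disc. (HS_norm d \<psi>)\<^sup>2 = (\<Sum>\<^sub>\<infinity>n\<in>multi_indices d.
        ennreal ((cmod (dirichlet_ip (\<lambda>z. \<Prod>i<d. dirichlet_basis (n i) z) \<psi>))\<^sup>2))"
      by (intro ballI HS_norm_power2)
  qed
qed

end
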